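(* Let $n\ge1$ be an integer, $s\in(0,1)$, and let $f$ be a nondecreasing function of class $C^2$. Let $u\in H^s(\mathbb{R}^n)$ be a radially decreasing weak solution of $$(-\Delta)^s u=f(u)\ \text{ in } B_1,\qquad u=0\ \text{ in } \mathbb{R}^n\setminus B_1 .$$ Let $v$ be the $s$-harmonic extension of $u$ to $\mathbb{R}^{n+1}_+$ and let $$A:=\left(B_{3/4}\setminus\overline{B_{1/2}}\right)\times(0,1)\subset\mathbb{R}^{n+1}_+ .$$ Then $$\|\nabla_x v\|_{L^\infty(A)}\le C$$ for some constant $C$ depending only on $n$, $s$, $\|u\|_{L^1(B_1)}$, $\|u\|_{L^\infty(B_{7/8}\setminus B_{3/8})}$ and $\|f'(u)\|_{L^\infty(B_{7/8}\setminus B_{3/8})}$.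
   Context: $B_R$ is the ball of radius $R$ centered at the origin of $\mathbb{R}^n$. The fractional Laplacian is $(-\Delta)^s u(x)=c_{n,s}\,\mathrm{P.V.}\int_{\mathbb{R}^n}\frac{u(x)-u(z)}{|x-z|^{n+2s}}\,dz$, with $c_{n,s}>0$ the usual normalizing constant (Fourier symbol $|\xi|^{2s}$). Weak solution: $u\in L^1(B_1)$ (with $u=0$ outside $B_1$), $f(u)\delta^s\in L^1(B_1)$ with $\delta(x)=\mathrm{dist}(x,\partial B_1)$, and $\int_{B_1}u\,(-\Delta)^s\zeta\,dx=\int_{B_1}f(u)\zeta\,dx$ for all $\zeta$ such that $\zeta$ and $(-\Delta)^s\zeta$ are bounded in $B_1$ and $\zeta\equiv0$ in $\mathbb{R}^n\setminus B_1$. Radially decreasing: $u$ depends only on $|x|$ and is decreasing as a function of $|x|$ in $B_1\setminus\{0\}$. Points of $\mathbb{R}^{n+1}_+=\mathbb{R}^n\times(0,\infty)$ are written $(x,y)$, and $\nabla_x$ is the gradient in the variables $x\in\mathbb{R}^n$. The $s$-harmonic extension $v$ of $u$ is the solution of $\mathrm{div}(y^{1-2s}\nabla v)=0$ in $\mathbb{R}^{n+1}_+$, $v=u$ on $\partial\mathbb{R}^{n+1}_+=\mathbb{R}^n$, given by the Poisson formula $v(x,y)=\int_{\mathbb{R}^n}P(x-z,y)u(z)\,dz$ with $P(x,y)=P_{n,s}\,\frac{y^{2s}}{(|x|^2+y^2)^{(n+2s)/2}}$ and $P_{n,s}$ such that $\int_{\mathbb{R}^n}P(x,y)\,dx=1$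 for every $y>0$. *)

theory Defs
  imports "HOL-Analysis.Analysis" "HOL-Probability.Essential_Supremum"
begin

text \<open>The space $\mathbb{R}^n$ is \<^typ>\<open>real ^ 'n\<close> with $n$ = \<^term>\<open>CARD('n)\<close> (so $n \ge 1$ automatically), and
  $\mathbb{R}^{n+1}_+$ is the part of \<^typ>\<open>(real ^ 'n) \<times> real\<close> with positive second component.
  Elements of $L^p$ are represented by Borel functions.\<close>

definition class_C2 :: "(real \<Rightarrow> real) \<Rightarrow> bool" where
  "class_C2 f \<longleftrightarrow>
     (\<forall>t. f field_differentiable at t) \<and>
     (\<forall>t. deriv f field_differentiable at t) \<and>
     continuous_on UNIV (deriv (deriv f))"

text \<open>The values are extended reals, so an essentially unbounded or non-measurable function has
  norm \<^term>\<open>\<infinity>::ereal\<close>.\<close>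

definition Linf_norm ::
    "'a::euclidean_space set \<Rightarrow> ('a \<Rightarrow> 'b::real_normed_vector) \<Rightarrow> ereal" where
  "Linf_norm S g = esssup (restrict_space lborel S) (\<lambda>x. ereal (norm (g x)))"

definition L1_norm :: "'a::euclidean_space set \<Rightarrow> ('a \<Rightarrow> real) \<Rightarrow> real" where
  "L1_norm S g = (LINT x:S|lborel. \<bar>g x\<bar>)"

text \<open>$H^s(\mathbb{R}^n)$ for $0 < s < 1$, defined by finiteness of the $L^2$ norm and of the Gagliardo seminorm.\<close>

definition frac_sobolev :: "real \<Rightarrow> (real ^ 'n \<Rightarrow> real) set" where
  "frac_sobolev s = {u. u \<in> borel_measurable lborel \<and>
     integrable lborel (\<lambda>x. (u x)\<^sup>2) \<and>
     integrable (lborel \<Otimes>\<^sub>M lborel)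
       (\<lambda>(x, z). (u x - u z)\<^sup>2 / norm (x - z) powr (real CARD('n) + 2 * s))}"

text \<open>The constant for which the fractional Laplacian has Fourier symbol $|\xi|^{2s}$:
  $c_{n,s} = \frac{s\, 4^s\, \Gamma(n/2+s)}{\pi^{n/2}\, \Gamma(1-s)}$.\<close>

definition frac_lap_const :: "nat \<Rightarrow> real \<Rightarrow> real" where
  "frac_lap_const n s =
     s * 4 powr s * Gamma (real n / 2 + s) / (pi powr (real n / 2) * Gamma (1 - s))"

text \<open>The principal value, with the requirement that the truncated integrals converge absolutely.\<close>

definition has_frac_laplacian ::
    "real \<Rightarrow> (real ^ 'n \<Rightarrow> real) \<Rightarrow> real ^ 'n \<Rightarrow> real \<Rightarrow> bool" where
  "has_frac_laplacian s u x L \<longleftrightarrow>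
     (\<forall>\<epsilon>>0. set_integrable lborel (- cball x \<epsilon>)
        (\<lambda>z. (u x - u z) / norm (x - z) powr (real CARD('n) + 2 * s))) \<and>
     ((\<lambda>\<epsilon>. frac_lap_const CARD('n) s *
        (LINT z:- cball x \<epsilon>|lborel.
           (u x - u z) / norm (x - z) powr (real CARD('n) + 2 * s))) \<longlongrightarrow> L) (at_right 0)"

definition frac_laplacian :: "real \<Rightarrow> (real ^ 'n \<Rightarrow> real) \<Rightarrow> real ^ 'n \<Rightarrow> real" where
  "frac_laplacian s u x = (THE L. has_frac_laplacian s u x L)"

definition test_function :: "real \<Rightarrow> (real ^ 'n \<Rightarrow> real) \<Rightarrow> bool" where
  "test_function s \<zeta> \<longleftrightarrow>
     \<zeta> \<in> borel_measurable lborel \<and>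
     bounded (\<zeta> ` ball 0 1) \<and>
     (\<forall>x\<in>ball 0 1. \<exists>L. has_frac_laplacian s \<zeta> x L) \<and>
     bounded (frac_laplacian s \<zeta> ` ball 0 1) \<and>
     (\<forall>x. x \<notin> ball 0 1 \<longrightarrow> \<zeta> x = 0)"

text \<open>In the last clause the integrability conjunct only says that the right-hand integral makes
  sense (a Bochner integral is 0 by convention otherwise); the left-hand one always does, since
  \<^term>\<open>u\<close> is integrable and the fractional Laplacian of a test function is bounded.\<close>

definition weak_solution :: "real \<Rightarrow> (real \<Rightarrow> real) \<Rightarrow> (real ^ 'n \<Rightarrow> real) \<Rightarrow> bool" where
  "weak_solution s f u \<longleftrightarrow>
     set_integrable lborel (ball 0 1) u \<and>
     (\<forall>x. x \<notin> ball 0 1 \<longrightarrow> u x = 0) \<and>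
     set_integrable lborel (ball 0 1)
       (\<lambda>x. f (u x) * infdist x (frontier (ball 0 1)) powr s) \<and>
     (\<forall>\<zeta>. test_function s \<zeta> \<longrightarrow>
        set_integrable lborel (ball 0 1) (\<lambda>x. f (u x) * \<zeta> x) \<and>
        (LINT x:ball 0 1|lborel. u x * frac_laplacian s \<zeta> x) =
        (LINT x:ball 0 1|lborel. f (u x) * \<zeta> x))"

text \<open>``Decreasing'' is taken in the weak sense; the strictly decreasing case is included.\<close>

definition radially_decreasing :: "(real ^ 'n \<Rightarrow> real) \<Rightarrow> bool" where
  "radially_decreasing u \<longleftrightarrow>
     (\<exists>\<phi>. (\<forall>x\<in>ball 0 1 - {0}. u x = \<phi> (norm x)) \<and> antimono_on {0<..<1::real} \<phi>)"

definition poisson_profile :: "real \<Rightarrow> real ^ 'n \<Rightarrow> real \<Rightarrow> real" where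
  "poisson_profile s x y =
     y powr (2 * s) / ((norm x)\<^sup>2 + y\<^sup>2) powr ((real CARD('n) + 2 * s) / 2)"

definition poisson_const :: "'n::finite itself \<Rightarrow> real \<Rightarrow> real" where
  "poisson_const TYPE('n) s =
     (THE c. \<forall>y>0. (LINT x|lborel. c * poisson_profile s (x :: real ^ 'n) y) = 1)"

definition poisson_kernel :: "real \<Rightarrow> real ^ 'n \<Rightarrow> real \<Rightarrow> real" where
  "poisson_kernel s x y = poisson_const TYPE('n) s * poisson_profile s x y"

definition s_harmonic_ext :: "real \<Rightarrow> (real ^ 'n \<Rightarrow> real) \<Rightarrow> (real ^ 'n) \<times> real \<Rightarrow> real" where
  "s_harmonic_ext s u = (\<lambda>(x, y). LINT z|lborel. poisson_kernel s (x - z) y * u z)"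

definition has_gradient_x ::
    "((real ^ 'n) \<times> real \<Rightarrow> real) \<Rightarrow> (real ^ 'n) \<times> real \<Rightarrow> real ^ 'n \<Rightarrow> bool" where
  "has_gradient_x v p D \<longleftrightarrow> (GDERIV (\<lambda>x. v (x, snd p)) (fst p) :> D)"

definition gradient_x ::
    "((real ^ 'n) \<times> real \<Rightarrow> real) \<Rightarrow> (real ^ 'n) \<times> real \<Rightarrow> real ^ 'n" where
  "gradient_x v p = (THE D. has_gradient_x v p D)"

definition annular_cylinder :: "((real ^ 'n) \<times> real) set" where
  "annular_cylinder = (ball 0 (3/4) - closure (ball 0 (1/2))) \<times> {0<..<1}"

end

theory Submission
  imports Defs
begin

text \<open>
  The heart of the matter is a Lipschitz bound for \<open>u\<close> on an annulus; the bound for the extension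
  follows from it. The equation gives such a bound directly, through a maximum principle for
  difference quotients.

  Write the kernel of the fractional Laplacian as a near part, supported in the ball of radius \<open>r\<close>,
  plus the far part \<open>max |w| r\<close> to the power \<open>-(n+2s)\<close>, which is integrable and Lipschitz. For a
  difference \<open>W = u(\<cdot> + h) - u\<close> the far part contributes \<open>W\<close> times the mass of the far kernel, of
  order \<open>r\<close> to the power \<open>-2s\<close>, minus a convolution in which the difference can be moved from \<open>u\<close>
  to the kernel, so that this last term is at most a multiple of \<open>|h|\<close> times the \<open>L\<^sup>1\<close> norm of \<open>u\<close>.
  Suppose that \<open>W\<close> times the power \<open>n+1\<close> of \<open>R\<^sup>2 - |x-a|\<^sup>2\<close> is maximal at \<open>x\<close>, and take
  \<open>r = \<kappa> (R\<^sup>2 - |x-a|\<^sup>2)\<close>. At \<open>x\<close> the near part sees at most the second differences of the barrier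
  given by the negative power of \<open>R\<^sup>2 - |x-a|\<^sup>2\<close>, and for small \<open>\<kappa>\<close> it cancels at most half of the mass
  term. The right-hand side \<open>f(u(x+h)) - f(u(x))\<close> is at most \<open>K |W|\<close>, which the mass term also absorbs
  for small \<open>\<kappa>\<close>. What remains is \<open>|W| \<le> C |h|\<close> with \<open>C\<close> depending only on \<open>n\<close>, \<open>s\<close>, \<open>K\<close>, \<open>R\<close> and
  the \<open>L\<^sup>1\<close> norm (\<open>interior_Lipschitz\<close>).

  Since \<open>u\<close> is only a weak solution, the argument is run for its mollifications: translates of a
  \<open>C\<^sup>1\<^sup>,\<^sup>1\<close> bump are test functions, so the mollified equation holds pointwise (\<open>mollified_equation\<close>).
  The weighted maximum of the mollified difference is then at most half of the weighted supremum of
  the original difference plus \<open>C |h|\<close> (\<open>weighted_difference_estimate\<close>). Letting the mollification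
  radius tend to 0 at points of continuity, which are almost all points because \<open>u\<close> is radially
  monotone, gives the same inequality for the supremum itself (\<open>difference_improvement\<close>).

  A monotone profile may jump, and then the size of \<open>f'\<close> on the range of \<open>u\<close> does not control
  \<open>f(u(x)) - f(u(y))\<close>. So the estimate is applied twice: first with a Lipschitz constant of \<open>f\<close> on a
  whole interval containing the values of \<open>u\<close>, which shows only that \<open>u\<close> is continuous in a smaller
  annulus, and then with the essential supremum of \<open>|f'(u)|\<close>, which is now a Lipschitz constant of \<open>f\<close>
  on the connected range of \<open>u\<close> (\<open>solution_profile_Lipschitz\<close>).

  Finally \<open>u\<close> is cut into a globally Lipschitz function supported in the annulus and a remainder
  that vanishes near \<open>1/2 \<le> |x| \<le> 3/4\<close>. The Poisson kernel is a probability density, so the extension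
  of the first is Lipschitz in \<open>x\<close>; for the second the gradient of the kernel is bounded, as it is
  evaluated at distance at least 1/32 from the origin (\<open>extension_gradient_bound\<close>).
\<close>

section \<open>Affine changes of variables and integrable powers of the norm\<close>

lemma nn_integral_lborel_affine:
  fixes c :: real and t :: "'a::euclidean_space"
  assumes [measurable]: "f \<in> borel_measurable borel" and c: "c \<noteq> 0"
  shows "(\<integral>\<^sup>+x. f x \<partial>lborel) = \<bar>c\<bar> ^ DIM('a) * (\<integral>\<^sup>+x. f (t + c *\<^sub>R x) \<partial>lborel)"
  by (subst lborel_affine[OF c, of t])
     (simp add: nn_integral_density nn_integral_distr nn_integral_cmult)

lemma lborel_integrable_affine:
  fixes f :: "'a::euclidean_space \<Rightarrow> 'b::{banach, second_countable_topology}"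
  assumes f: "integrable lborel f" and c: "c \<noteq> 0"
  shows "integrable lborel (\<lambda>x. f (t + c *\<^sub>R x))"
proof -
  have [measurable]: "f \<in> borel_measurable borel"
    using f by simp
  have "(\<integral>\<^sup>+x. norm (f x) \<partial>lborel) < \<infinity>"
    using f by (simp add: integrable_iff_bounded)
  then have "ennreal (\<bar>c\<bar> ^ DIM('a)) * (\<integral>\<^sup>+x. norm (f (t + c *\<^sub>R x)) \<partial>lborel) < \<infinity>"
    using nn_integral_lborel_affine[of "\<lambda>x. ennreal (norm (f x))" c t] c
    by (simp add: ennreal_power)
  then show ?thesis
    using c by (auto simp: integrable_iff_bounded ennreal_mult_less_top)
qed

lemma lborel_integral_affine:
  fixes f :: "'a::euclidean_space \<Rightarrow> 'b::{banach, second_countable_topology}"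
  assumes c: "c \<noteq> 0"
  shows "(LINT x|lborel. f x) = \<bar>c\<bar> ^ DIM('a) *\<^sub>R (LINT x|lborel. f (t + c *\<^sub>R x))"
proof cases
  assume f: "integrable lborel f"
  then have [measurable]: "f \<in> borel_measurable borel" by simp
  show ?thesis
    using c f lborel_integrable_affine[OF f c, of t]
    by (subst lborel_affine[OF c, of t])
       (simp add: integral_density integral_distr)
next
  assume n: "\<not> integrable lborel f"
  have "\<not> integrable lborel (\<lambda>x. f (t + c *\<^sub>R x))"
  proof
    assume "integrable lborel (\<lambda>x. f (t + c *\<^sub>R x))"
    from lborel_integrable_affine[OF this, of "1/c" "- (1/c) *\<^sub>R t"] c n
    show False by (simp add: algebra_simps)
  qed
  with n show ?thesis by (simp add: not_integrable_integral_eq)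
qed

lemmas lborel_integrable_reflect = lborel_integrable_affine[of _ "-1", simplified]
  and lborel_integral_reflect = lborel_integral_affine[of "-1", simplified]
  and lborel_integrable_shift = lborel_integrable_affine[of _ 1, simplified]
  and lborel_integral_shift = lborel_integral_affine[of 1, simplified]

lemma AE_lborel_reflect:
  fixes x :: "'a::euclidean_space"
  assumes "AE z in lborel. P z"
  shows "AE z in lborel. P (x - z)"
proof -
  from assms obtain N where N: "{z. \<not> P z} \<subseteq> N" "N \<in> sets lborel" "emeasure lborel N = 0"
    by (auto elim!: AE_E)
  have [measurable]: "N \<in> sets borel" using N by simp
  have "(\<integral>\<^sup>+z. indicator N z \<partial>lborel) = 0" using N by simp
  then have "(\<integral>\<^sup>+z. indicator N (x - z) \<partial>lborel) = 0"
    using nn_integral_lborel_affine[of "indicator N" "-1" x] by simp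
  then have "AE z in lborel. indicator N (x - z) = (0::ennreal)"
    by (subst (asm) nn_integral_0_iff_AE) auto
  then show ?thesis
    using N by (auto elim!: eventually_mono simp: indicator_def split: if_splits)
qed

text \<open>The functions to be integrated are powers of the norm near 0 and near infinity, and both
  cases reduce to a geometric series: on the ball \<open>ball 0 (r k)\<close> the function is compared with the
  constant \<open>a k\<close>, and \<open>a k\<close> times the volume decays like \<open>q ^ k\<close>.\<close>
lemma integrable_dyadic:
  fixes g :: "'a::euclidean_space \<Rightarrow> real"
  assumes [measurable]: "g \<in> borel_measurable borel"
    and B: "0 \<le> B" "0 < q" "q < 1"
    and r: "\<And>k. 0 \<le> r k" and a: "\<And>k. 0 \<le> a k"
    and a_r: "\<And>k::nat. a k * r k ^ DIM('a) \<le> B * q ^ k"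
    and bound: "\<And>w. g w \<noteq> 0 \<Longrightarrow> \<exists>k. norm w < r k \<and> \<bar>g w\<bar> \<le> a k"
  shows "integrable lborel g"
proof (rule integrableI_bounded)
  show "g \<in> borel_measurable lborel" by simp
  have "(\<integral>\<^sup>+w. norm (g w) \<partial>lborel)
      \<le> (\<integral>\<^sup>+w. (\<Sum>k. ennreal (a k) * indicator (ball (0::'a) (r k)) w) \<partial>lborel)"
  proof (rule nn_integral_mono)
    fix w :: 'a
    show "ennreal (norm (g w)) \<le> (\<Sum>k. ennreal (a k) * indicator (ball 0 (r k)) w)"
    proof (cases "g w = 0")
      case False
      with bound obtain k where k: "norm w < r k" "\<bar>g w\<bar> \<le> a k" by blast
      then have "ennreal (norm (g w)) \<le> ennreal (a k) * indicator (ball 0 (r k)) w"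
        by (simp add: ennreal_leI)
      also have "\<dots> \<le> (\<Sum>k. ennreal (a k) * indicator (ball 0 (r k)) w)"
      proof -
        have "F k \<le> (\<Sum>k. F k)" for F :: "nat \<Rightarrow> ennreal"
          using sum_le_suminf[of F "{k}"] by simp
        then show ?thesis .
      qed
      finally show ?thesis .
    qed simp
  qed
  also have "\<dots> = (\<Sum>k. \<integral>\<^sup>+w. ennreal (a k) * indicator (ball 0 (r k)) w \<partial>(lborel :: 'a measure))"
    by (intro nn_integral_suminf borel_measurable_times_ennreal borel_measurable_indicator) simp_all
  also have "\<dots> = (\<Sum>k. ennreal (unit_ball_vol (DIM('a)) * (a k * r k ^ DIM('a))))"
    using a r by (simp add: nn_integral_cmult_indicator emeasure_ball ennreal_mult'[symmetric] mult_ac)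
  also have "\<dots> \<le> (\<Sum>k. ennreal (unit_ball_vol (DIM('a)) * (B * q ^ k)))"
    using a_r by (intro suminf_le ennreal_leI mult_left_mono) auto
  also have "\<dots> < \<infinity>"
  proof -
    have "summable (\<lambda>k. unit_ball_vol (DIM('a)) * (B * q ^ k))"
      using B by (intro summable_mult summable_geometric) auto
    then have "(\<Sum>k. ennreal (unit_ball_vol (DIM('a)) * (B * q ^ k)))
        = ennreal (\<Sum>k. unit_ball_vol (DIM('a)) * (B * q ^ k))"
      using B by (intro suminf_ennreal2) auto
    then show ?thesis by simp
  qed
  finally show "(\<integral>\<^sup>+w. norm (g w) \<partial>lborel) < \<infinity>" .
qed

text \<open>Selects the dyadic shell that contains a given point.\<close>
lemma dyadic_bracket:
  fixes t :: real assumes "1 \<le> t"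
  shows "\<exists>k::nat. 2 ^ k \<le> t \<and> t < 2 ^ Suc k"
proof -
  define k where "k = (LEAST k. t < 2 ^ Suc k)"
  obtain k0 where k0: "t < 2 ^ k0"
    using real_arch_pow[of 2 t] by auto
  have "(2::real) ^ k0 \<le> 2 ^ Suc k0" by simp
  with k0 have ex: "\<exists>k. t < 2 ^ Suc k" by (meson less_le_trans)
  have 1: "t < 2 ^ Suc k" unfolding k_def using ex by (rule LeastI_ex)
  have 2: "2 ^ k \<le> t"
  proof (cases k)
    case 0 then show ?thesis using assms by simp
  next
    case (Suc j)
    then have "\<not> t < 2 ^ Suc j" unfolding k_def by (metis lessI not_less_Least)
    then show ?thesis using Suc by simp
  qed
  from 1 2 show ?thesis by blast
qed

lemma integrable_max_norm_powr:
  fixes c :: real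
  assumes c: "0 < c" 
  shows "integrable lborel (\<lambda>w::'a::euclidean_space. max (norm w) 1 powr (- (DIM('a) + c)))"
proof (rule integrable_dyadic[where a = "\<lambda>k. (2 ^ k) powr (- (DIM('a) + c))"
      and r = "\<lambda>k. 2 ^ Suc k" and q = "2 powr (-c)" and B = "2 ^ DIM('a)"])
  show "2 powr - c < 1" using c by (simp add: powr_less_one)
  fix k :: nat
  have pow_two: "(2::real) ^ j = 2 powr real j" for j
    by (simp add: powr_realpow)
  have "(2 ^ k) powr (- (DIM('a) + c)) * (2 ^ Suc k) ^ DIM('a)
      = 2 powr (real k * (- (DIM('a) + c))) * 2 powr (real (Suc k) * DIM('a))"
    by (simp only: powr_powr pow_two powr_power) (simp add: mult.commute)
  also have "\<dots> = 2 powr (DIM('a)) * 2 powr ((-c) * real k)"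
    by (simp add: powr_add[symmetric] algebra_simps)
  also have "\<dots> = 2 ^ DIM('a) * (2 powr (-c)) ^ k"
    by (simp only: powr_power powr_realpow[symmetric]) (simp add: powr_power mult_ac)
  finally show "(2 ^ k) powr (- (DIM('a) + c)) * (2 ^ Suc k) ^ DIM('a)
      \<le> 2 ^ DIM('a) * (2 powr (-c)) ^ k"
    by simp
next
  fix w :: 'a
  obtain k :: nat where k: "2 ^ k \<le> max (norm w) 1" "max (norm w) 1 < 2 ^ Suc k"
    using dyadic_bracket[of "max (norm w) 1"] by auto
  have "max (norm w) 1 powr (- (DIM('a) + c)) \<le> (2 ^ k) powr (- (DIM('a) + c))"
    using k c by (intro powr_mono2') auto
  with k show "\<exists>k. norm w < 2 ^ Suc k
      \<and> \<bar>max (norm w) 1 powr - (real DIM('a) + c)\<bar> \<le> (2 ^ k) powr - (real DIM('a) + c)"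
    by auto
qed auto

lemma integrable_near_norm_powr:
  fixes c :: real
  assumes c: "0 < c"
  shows "integrable lborel (\<lambda>w::'a::euclidean_space. indicator (ball 0 1) w
      * norm w powr (c - DIM('a)))"
proof (rule integrable_dyadic[where a = "\<lambda>k. 2 powr \<bar>c - DIM('a)\<bar> * (2 ^ k) powr (DIM('a) - c)"
      and r = "\<lambda>k. 2 * 2 powr (- real k)" and q = "2 powr (-c)"
          and B = "2 powr \<bar>c - DIM('a)\<bar> * 2 ^ DIM('a)"])
  show "2 powr - c < 1" using c by (simp add: powr_less_one)
  fix k :: nat
  have pow_two: "(2::real) ^ j = 2 powr real j" for j
    by (simp add: powr_realpow)
  have "(2 ^ k) powr (DIM('a) - c) * (2 powr (- real k)) ^ DIM('a)
      = 2 powr (real k * (DIM('a) - c)) * 2 powr (- real k * DIM('a))"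
    by (simp only: powr_powr pow_two powr_power) (simp add: mult.commute)
  also have "\<dots> = 2 powr ((-c) * real k)"
    by (simp add: powr_add[symmetric] algebra_simps)
  also have "\<dots> = (2 powr (-c)) ^ k"
    by (simp only: powr_power powr_realpow[symmetric]) (simp add: powr_power mult_ac)
  finally show "2 powr \<bar>c - DIM('a)\<bar> * (2 ^ k) powr (DIM('a) - c) * (2 * 2 powr (- real k)) ^ DIM('a)
       \<le> 2 powr \<bar>c - DIM('a)\<bar> * 2 ^ DIM('a) * (2 powr (-c)) ^ k"
    by (simp add: power_mult_distrib mult_ac)
next
  fix w :: 'a
  assume "indicator (ball 0 1) w * norm w powr (c - DIM('a)) \<noteq> 0"
  then have w: "norm w < 1" "0 < norm w" by (auto simp: indicator_def split: if_splits)
  obtain k :: nat where k: "2 ^ k \<le> 1 / norm w" "1 / norm w < 2 ^ Suc k"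
    using dyadic_bracket[of "1 / norm w"] w by auto
  define t where "t = 1 / (2 ^ k * norm w)"
  have t: "1 \<le> t" "t \<le> 2" using k w by (auto simp: t_def field_simps)
  have "norm w powr (c - DIM('a)) = (t * 2 ^ k) powr (DIM('a) - c)"
    using w by (simp add: t_def powr_divide powr_minus_divide[symmetric] powr_def ln_div algebra_simps)
  also have "\<dots> = t powr (DIM('a) - c) * (2 ^ k) powr (DIM('a) - c)"
    using t by (simp add: powr_mult)
  also have "t powr (DIM('a) - c) \<le> t powr \<bar>c - DIM('a)\<bar>"
    using t by (intro powr_mono) auto
  also have "\<dots> \<le> 2 powr \<bar>c - DIM('a)\<bar>"
    using t by (intro powr_mono2) auto
  finally have "norm w powr (c - DIM('a)) \<le> 2 powr \<bar>c - DIM('a)\<bar> * (2 ^ k) powr (DIM('a) - c)"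
    by (simp add: mult_right_mono)
  moreover have "norm w < 2 * 2 powr (- real k)"
  proof -
    have "norm w * 2 ^ k \<le> 1" using k w by (simp add: field_simps)
    then show ?thesis by (simp add: powr_minus powr_realpow field_simps)
  qed
  ultimately show "\<exists>k. norm w < 2 * 2 powr (- real k) \<and>
     \<bar>indicator (ball 0 1) w * norm w powr (c - DIM('a))\<bar>
       \<le> 2 powr \<bar>c - DIM('a)\<bar> * (2 ^ k) powr (DIM('a) - c)"
    using w by (auto intro!: exI[of _ k])
qed (auto intro!: borel_measurable_times borel_measurable_indicator)

section \<open>The kernel of the fractional Laplacian, split at a radius\<close>

text \<open>Truncating the norm from below at \<open>r\<close> leaves an integrable Lipschitz kernel, and the
  difference to the full kernel is supported in the ball of radius \<open>r\<close>.\<close>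

definition riesz_kernel :: "real \<Rightarrow> 'a::euclidean_space \<Rightarrow> real" where
  "riesz_kernel s w = norm w powr (- (real DIM('a) + 2 * s))"

definition far_kernel :: "real \<Rightarrow> real \<Rightarrow> 'a::euclidean_space \<Rightarrow> real" where
  "far_kernel s r w = max (norm w) r powr (- (real DIM('a) + 2 * s))"

definition near_kernel :: "real \<Rightarrow> real \<Rightarrow> 'a::euclidean_space \<Rightarrow> real" where
  "near_kernel s r w = riesz_kernel s w - far_kernel s r w"

text \<open>The two constants that survive after scaling to \<open>r = 1\<close>: the mass of the far kernel, and the
  second moment of the full kernel on the unit ball, which bounds that of the near kernel.\<close>
definition far_mass :: "'a::euclidean_space itself \<Rightarrow> real \<Rightarrow> real" where
  "far_mass TYPE('a) s = (LINT w|lborel. far_kernel s 1 (w :: 'a))"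

definition near_moment :: "'a::euclidean_space itself \<Rightarrow> real \<Rightarrow> real" where
  "near_moment TYPE('a) s = (LINT w|lborel. indicator (ball 0 1) (w :: 'a)
      * norm w powr (2 - 2 * s - real DIM('a)))"

definition second_diff :: "('a::real_vector \<Rightarrow> real) \<Rightarrow> 'a \<Rightarrow> 'a \<Rightarrow> real" where
  "second_diff g x w = g (x + w) + g (x - w) - 2 * g x"

lemma borel_measurable_kernels [measurable]:
  "riesz_kernel s \<in> borel_measurable borel"
  "far_kernel s r \<in> borel_measurable borel"
  "near_kernel s r \<in> borel_measurable borel"
  unfolding riesz_kernel_def[abs_def] far_kernel_def[abs_def] near_kernel_def[abs_def] by simp_all

lemma kernel_minus [simp]:
  "riesz_kernel s (- w) = riesz_kernel s w" "far_kernel s r (- w) = far_kernel s r w"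
  "near_kernel s r (- w) = near_kernel s r w"
  by (simp_all add: riesz_kernel_def far_kernel_def near_kernel_def)

lemma second_diff_minus [simp]: "second_diff g x (- w) = second_diff g x w"
  by (simp add: second_diff_def)

lemma second_diff_0 [simp]: "second_diff g x 0 = 0"
  by (simp add: second_diff_def)

lemma riesz_kernel_nonneg [simp]: "0 \<le> riesz_kernel s w"
  by (simp add: riesz_kernel_def)

lemma far_kernel_nonneg [simp]: "0 \<le> far_kernel s r w"
  by (simp add: far_kernel_def)

lemma near_kernel_eq_0: "r \<le> norm w \<Longrightarrow> near_kernel s r w = 0"
  by (simp add: near_kernel_def riesz_kernel_def far_kernel_def max_absorb1)

lemma near_kernel_nonneg: "0 < s \<Longrightarrow> w \<noteq> 0 \<Longrightarrow> 0 \<le> near_kernel s r w"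
  unfolding near_kernel_def riesz_kernel_def far_kernel_def by (auto intro!: powr_mono2')

lemma near_kernel_le: "near_kernel s r w \<le> riesz_kernel s w"
  by (simp add: near_kernel_def)

lemma far_kernel_le: "0 < s \<Longrightarrow> 0 < r \<Longrightarrow> far_kernel s r w \<le> r powr (- (real DIM('a) + 2 * s))"
  for w :: "'a::euclidean_space"
  unfolding far_kernel_def by (intro powr_mono2') auto

lemma far_kernel_scale:
  fixes w :: "'a::euclidean_space"
  assumes "0 < r"
  shows "far_kernel s r (r *\<^sub>R w) = r powr (- (real DIM('a) + 2 * s)) * far_kernel s 1 w"
proof -
  have "max (norm (r *\<^sub>R w)) r = r * max (norm w) 1"
    using assms by (simp add: max_mult_distrib_left)
  then show ?thesis
    using assms by (simp add: far_kernel_def powr_mult)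
qed

lemma integrable_far_kernel_1: "0 < s
    \<Longrightarrow> integrable lborel (far_kernel s 1 :: 'a::euclidean_space \<Rightarrow> real)"
  unfolding far_kernel_def[abs_def] by (rule integrable_max_norm_powr) simp

lemma integrable_far_kernel:
  fixes r :: real
  assumes "0 < s" "0 < r"
  shows "integrable lborel (far_kernel s r :: 'a::euclidean_space \<Rightarrow> real)"
proof -
  have "integrable lborel (\<lambda>w::'a. r powr (- (real DIM('a) + 2 * s))
      * far_kernel s 1 (0 + (1/r) *\<^sub>R w))"
    using assms by (intro integrable_mult_right lborel_integrable_affine integrable_far_kernel_1) auto
  moreover have "r powr (- (real DIM('a) + 2 * s)) * far_kernel s 1 (0 + (1/r) *\<^sub>R w)
      = far_kernel s r w" for w :: 'a
    using far_kernel_scale[of r s "(1/r) *\<^sub>R w"] assms by simp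
  ultimately show ?thesis by (simp only:)
qed

lemma integral_far_kernel:
  fixes r :: real
  assumes "0 < r"
  shows "(LINT w|lborel. far_kernel s r (w :: 'a::euclidean_space))
      = r powr (- 2 * s) * far_mass TYPE('a) s"
proof -
  have "(LINT w|lborel. far_kernel s r (w :: 'a))
      = r ^ DIM('a) * (r powr (- (real DIM('a) + 2 * s)) * far_mass TYPE('a) s)"
    using assms by (subst lborel_integral_affine[of r _ 0])
        (simp_all add: far_kernel_scale far_mass_def)
  also have "\<dots> = r powr (- 2 * s) * far_mass TYPE('a) s"
    using assms by (simp add: powr_realpow[symmetric] powr_add[symmetric])
  finally show ?thesis .
qed

lemma far_mass_pos:
  assumes "0 < s"
  shows "0 < far_mass TYPE('a::euclidean_space) s"
proof -
  have "0 < measure lborel (ball (0::'a) 1)" by (simp add: content_ball unit_ball_vol_pos)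
  also have "measure lborel (ball (0::'a) 1) = (LINT w|lborel. indicator (ball (0::'a) 1) w)" by simp
  also have "\<dots> \<le> far_mass TYPE('a) s"
    unfolding far_mass_def using assms
    by (intro integral_mono integrable_far_kernel integrable_real_indicator)
       (auto simp: far_kernel_def indicator_def max_absorb2 emeasure_ball)
  finally show ?thesis .
qed

text \<open>On \<open>{r..}\<close> the derivative of the power \<open>-(n+2s)\<close> is largest at \<open>r\<close>, and truncation is
  1-Lipschitz. The resulting power \<open>r powr (-(n+2s)-1)\<close> dictates the exponent \<open>n+1\<close> of the weight
  in the maximum principle.\<close>
lemma far_kernel_Lipschitz:
  fixes w w' :: "'a::euclidean_space"
  assumes "0 < s" "0 < r"
  shows "\<bar>far_kernel s r w - far_kernel s r w'\<bar>
      \<le> (real DIM('a) + 2 * s) * r powr (- (real DIM('a) + 2 * s) - 1) * norm (w - w')"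
proof -
  define e where "e = real DIM('a) + 2 * s"
  have e: "0 < e" using assms by (simp add: e_def add_nonneg_pos)
  have main: "\<bar>a powr (- e) - b powr (- e)\<bar> \<le> e * r powr (- e - 1) * (b - a)" if "r \<le> a" "a < b"
      for a b :: real
  proof -
    have "\<exists>z. z > a \<and> z < b \<and> b powr (- e) - a powr (- e) = (b - a) * ((- e) * z powr (- e - 1))"
      using that assms by (intro MVT2) (auto intro!: derivative_eq_intros)
    then obtain z where z: "a < z" "z < b" "b powr (- e) - a powr (- e)
        = (b - a) * ((- e) * z powr (- e - 1))"
      by auto
    have "z powr (- e - 1) \<le> r powr (- e - 1)"
      using z that assms e by (intro powr_mono2') auto
    then have "(b - a) * (e * z powr (- e - 1)) \<le> (b - a) * (e * r powr (- e - 1))"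
      using that e by (intro mult_left_mono) auto
    moreover have "\<bar>a powr (- e) - b powr (- e)\<bar> = (b - a) * (e * z powr (- e - 1))"
    proof -
      have "0 \<le> (b - a) * (e * z powr (- e - 1))" using that e by simp
      with z(3) show ?thesis by simp
    qed
    ultimately show ?thesis by (simp add: mult_ac)
  qed
  have main': "\<bar>a powr (- e) - b powr (- e)\<bar> \<le> e * r powr (- e - 1) * \<bar>a - b\<bar>" if "r \<le> a" "r \<le> b"
      for a b :: real
    using main[of a b] main[of b a] that
        by (cases a b rule: linorder_cases) (auto simp: abs_minus_commute)
  have "\<bar>max (norm w) r - max (norm w') r\<bar> \<le> norm (w - w')"
    using norm_triangle_ineq3[of w w'] by (auto simp: max_def abs_if split: if_splits)
  then have "e * r powr (- e - 1) * \<bar>max (norm w) r - max (norm w') r\<bar>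
      \<le> e * r powr (- e - 1) * norm (w - w')"
    using e by (intro mult_left_mono) auto
  then show ?thesis
    using main'[of "max (norm w) r" "max (norm w') r"] by (simp add: far_kernel_def e_def)
qed

lemma integrable_near_moment:
  assumes "s < 1" "0 < r"
  shows "integrable lborel (\<lambda>w::'a::euclidean_space. indicator (ball 0 r) w
      * norm w powr (2 - 2 * s - real DIM('a)))"
    and "(LINT w|lborel. indicator (ball 0 r) (w::'a) * norm w powr (2 - 2 * s - real DIM('a)))
        = r powr (2 - 2 * s) * near_moment TYPE('a) s"
proof -
  define F where "F r w = indicator (ball 0 r) (w::'a) * norm w powr (2 - 2 * s - real DIM('a))" for r w
  have F1: "integrable lborel (F 1)"
    unfolding F_def using assms by (intro integrable_near_norm_powr) auto
  have sc: "F r (r *\<^sub>R w) = r powr (2 - 2 * s - real DIM('a)) * F 1 w" for w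
    using assms by (auto simp: F_def powr_mult indicator_def)
  have "integrable lborel (\<lambda>w::'a. r powr (2 - 2 * s - real DIM('a)) * F 1 (0 + (1/r) *\<^sub>R w))"
    using assms by (intro integrable_mult_right lborel_integrable_affine F1) auto
  moreover have "r powr (2 - 2 * s - real DIM('a)) * F 1 (0 + (1/r) *\<^sub>R w) = F r w" for w
    using sc[of "(1/r) *\<^sub>R w"] assms by simp
  ultimately have "integrable lborel (F r)" by (simp only:)
  then show "integrable lborel (\<lambda>w::'a. indicator (ball 0 r) w
      * norm w powr (2 - 2 * s - real DIM('a)))"
    by (simp only: F_def[abs_def])
  have "(LINT w|lborel. F r w) = r ^ DIM('a)
      * (r powr (2 - 2 * s - real DIM('a)) * near_moment TYPE('a) s)"
    using assms by (subst lborel_integral_affine[of r _ 0])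
        (simp_all add: sc near_moment_def F_def[of 1])
  also have "\<dots> = r powr (2 - 2 * s) * near_moment TYPE('a) s"
    using assms by (simp add: powr_realpow[symmetric] powr_add[symmetric])
  finally show "(LINT w|lborel. indicator (ball 0 r) (w::'a) * norm w powr (2 - 2 * s - real DIM('a)))
      = r powr (2 - 2 * s) * near_moment TYPE('a) s"
    by (simp add: F_def)
qed

text \<open>Second differences vanish quadratically, so the near kernel only ever meets functions
  bounded by a multiple of \<open>(norm w)\<^sup>2\<close>; their product with it has an integrable majorant.\<close>
lemma near_kernel_square_le:
  fixes w :: "'a::euclidean_space"
  assumes "0 < s" 
  shows "near_kernel s r w * (norm w)\<^sup>2
      \<le> indicator (ball 0 r) w * norm w powr (2 - 2 * s - real DIM('a))"
proof (cases "w = 0 \<or> r \<le> norm w")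
  case False
  have "near_kernel s r w * (norm w)\<^sup>2 \<le> riesz_kernel s w * (norm w)\<^sup>2"
    by (intro mult_right_mono near_kernel_le) auto
  also have "\<dots> = norm w powr (2 - 2 * s - real DIM('a))"
    using False by (simp add: riesz_kernel_def powr_numeral[symmetric] powr_add[symmetric] algebra_simps
        del: powr_numeral)
  finally show ?thesis using False by simp
qed (auto simp: near_kernel_eq_0)

lemma integrable_near_kernel_mult:
  fixes g :: "'a::euclidean_space \<Rightarrow> real"
  assumes s: "0 < s" "s < 1" "0 < r" and [measurable]: "g \<in> borel_measurable borel"
    and g: "\<And>w. norm w < r \<Longrightarrow> \<bar>g w\<bar> \<le> B * (norm w)\<^sup>2"
  shows "integrable lborel (\<lambda>w. near_kernel s r w * g w)"
proof (rule Bochner_Integration.integrable_bound)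
  show "integrable lborel (\<lambda>w::'a. B
      * (indicator (ball 0 r) w * norm w powr (2 - 2 * s - real DIM('a))))"
    using s by (intro integrable_mult_right integrable_near_moment)
  show "AE w in lborel. norm (near_kernel s r w * g w)
      \<le> norm (B * (indicator (ball 0 r) w * norm w powr (2 - 2 * s - real DIM('a))))"
  proof (rule AE_I2)
    fix w :: 'a
    show "norm (near_kernel s r w * g w)
        \<le> norm (B * (indicator (ball 0 r) w * norm w powr (2 - 2 * s - real DIM('a))))"
    proof (cases "w = 0 \<or> r \<le> norm w")
      case True
      with g[of 0] s show ?thesis by (auto simp: near_kernel_eq_0)
    next
      case False
      have B: "0 \<le> B" 
      proof -
        have "0 \<le> B * (norm w)\<^sup>2" using g[of w] False by linarith
        with False show ?thesis by (simp add: zero_le_mult_iff)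
      qed
      have "norm (near_kernel s r w * g w) = near_kernel s r w * \<bar>g w\<bar>"
        using False s by (simp add: abs_mult near_kernel_nonneg)
      also have "\<dots> \<le> near_kernel s r w * (B * (norm w)\<^sup>2)"
        using False s g by (intro mult_left_mono near_kernel_nonneg) auto
      also have "\<dots> = B * (near_kernel s r w * (norm w)\<^sup>2)" by simp
      also have "\<dots> \<le> B * (indicator (ball 0 r) w * norm w powr (2 - 2 * s - real DIM('a)))"
        using B s by (intro mult_left_mono near_kernel_square_le) auto
      finally show ?thesis by simp
    qed
  qed
qed simp

lemma integral_near_kernel_mult_le:
  fixes g :: "'a::euclidean_space \<Rightarrow> real"
  assumes s: "0 < s" "s < 1" "0 < r" 
    and int: "integrable lborel (\<lambda>w. near_kernel s r w * g w)"
    and B: "0 \<le> B" and g: "\<And>w. norm w < r \<Longrightarrow> g w \<le> B * (norm w)\<^sup>2"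
    and g0: "g 0 = 0"
  shows "(LINT w|lborel. near_kernel s r w * g w) \<le> B * r powr (2 - 2 * s) * near_moment TYPE('a) s"
proof -
  have "(LINT w|lborel. near_kernel s r w * g w)
     \<le> (LINT w|lborel. B * (indicator (ball 0 r) (w::'a) * norm w powr (2 - 2 * s - real DIM('a))))"
  proof (rule integral_mono[OF int])
    show "integrable lborel (\<lambda>w::'a. B
        * (indicator (ball 0 r) w * norm w powr (2 - 2 * s - real DIM('a))))"
      using s by (intro integrable_mult_right integrable_near_moment)
    fix w :: 'a
    show "near_kernel s r w * g w \<le> B
        * (indicator (ball 0 r) w * norm w powr (2 - 2 * s - real DIM('a)))"
    proof (cases "w = 0 \<or> r \<le> norm w")
      case True
      with g0 s show ?thesis by (auto simp: near_kernel_eq_0)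
    next
      case False
      have "near_kernel s r w * g w \<le> near_kernel s r w * (B * (norm w)\<^sup>2)"
        using False s g by (intro mult_left_mono near_kernel_nonneg) auto
      also have "\<dots> = B * (near_kernel s r w * (norm w)\<^sup>2)" by simp
      also have "\<dots> \<le> B * (indicator (ball 0 r) w * norm w powr (2 - 2 * s - real DIM('a)))"
        using B s by (intro mult_left_mono near_kernel_square_le) auto
      finally show ?thesis .
    qed
  qed
  also have "\<dots> = B * r powr (2 - 2 * s) * near_moment TYPE('a) s"
    using s by (simp add: integrable_near_moment)
  finally show ?thesis .
qed

lemma integrable_far_kernel_mult:
  fixes g :: "'a::euclidean_space \<Rightarrow> real"
  assumes s: "0 < s" "0 < r" and [measurable]: "g \<in> borel_measurable borel"
    and g: "\<And>w. \<bar>g w\<bar> \<le> B"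
  shows "integrable lborel (\<lambda>w. far_kernel s r w * g w)"
proof (rule Bochner_Integration.integrable_bound)
  show "integrable lborel (\<lambda>w::'a. B * far_kernel s r w)"
    using s by (intro integrable_mult_right integrable_far_kernel)
  have B: "0 \<le> B" using g[of undefined] by linarith
  show "AE w in lborel. norm (far_kernel s r w * g w) \<le> norm (B * far_kernel s r w)"
    using B mult_right_mono[OF g far_kernel_nonneg] by (intro AE_I2) (simp add: abs_mult mult.commute)
qed simp

lemma integrable_riesz_kernel_mult:
  fixes g :: "'a::euclidean_space \<Rightarrow> real"
  assumes s: "0 < s" "s < 1" and [measurable]: "g \<in> borel_measurable borel"
    and g: "\<And>w. \<bar>g w\<bar> \<le> B * (norm w)\<^sup>2" and g': "\<And>w. \<bar>g w\<bar> \<le> B'"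
  shows "integrable lborel (\<lambda>w. riesz_kernel s w * g w)"
proof -
  have "integrable lborel (\<lambda>w. near_kernel s 1 w * g w + far_kernel s 1 w * g w)"
    using s g g' by (intro Bochner_Integration.integrable_add integrable_near_kernel_mult[where B=B]
        integrable_far_kernel_mult[where B=B']) auto
  then show ?thesis by (simp add: near_kernel_def algebra_simps)
qed

lemma frac_lap_const_pos: "0 < s \<Longrightarrow> s < 1 \<Longrightarrow> 0 < frac_lap_const n s"
  unfolding frac_lap_const_def by (intro divide_pos_pos mult_pos_pos Gamma_real_pos) auto

text \<open>Averaging the principal value over \<open>w\<close> and \<open>-w\<close> turns it into an absolutely convergent
  integral of second differences. This is the form used in all computations below.\<close>
definition symmetric_frac_lap :: "real \<Rightarrow> (real ^ 'n \<Rightarrow> real) \<Rightarrow> real ^ 'n \<Rightarrow> real" where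
  "symmetric_frac_lap s g x = - (frac_lap_const CARD('n) s / 2)
      * (LINT w|lborel. riesz_kernel s w * second_diff g x w)"

text \<open>For each truncation radius the reflection \<open>w \<mapsto> -w\<close> preserves the truncated integral, so
  first differences may be replaced by half the second differences; these are absolutely
  integrable against the kernel, and dominated convergence gives the limit.\<close>
lemma has_frac_laplacian_symmetric:
  fixes g :: "real ^ 'n \<Rightarrow> real"
  assumes s: "0 < s" "s < 1" and gm [measurable]: "g \<in> borel_measurable borel"
    and g2: "\<And>w. \<bar>second_diff g x w\<bar> \<le> B * (norm w)\<^sup>2" and gb: "\<And>w. \<bar>g w\<bar> \<le> B'"
  shows "has_frac_laplacian s g x (symmetric_frac_lap s g x)"
proof -
  define c where "c = frac_lap_const CARD('n) s"
  define n where "n = real CARD('n)"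
  define F where "F \<eta> w = indicator (- cball 0 \<eta>) w * (riesz_kernel s w * (g x - g (x + w)))" for \<eta> w
  define S where "S \<eta> w = indicator (- cball 0 \<eta>) w * (riesz_kernel s w * second_diff g x w)" for \<eta> w
  have [measurable]: "second_diff g x \<in> borel_measurable borel"
    unfolding second_diff_def[abs_def] by simp
  have intR: "integrable lborel (\<lambda>w. riesz_kernel s w * second_diff g x w)"
  proof (rule integrable_riesz_kernel_mult[OF s _ g2])
    show "\<bar>second_diff g x w\<bar> \<le> 4 * B'" for w
      using gb[of "x + w"] gb[of "x - w"] gb[of x] by (simp add: second_diff_def)
  qed simp
  have intF: "integrable lborel (F \<eta>)" if "0 < \<eta>" for \<eta>
  proof -
    have "integrable lborel (\<lambda>w. far_kernel s \<eta> w * (indicator (- cball 0 \<eta>) w * (g x - g (x + w))))"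
      using s that
    proof (intro integrable_far_kernel_mult[where B = "2 * B'"])
      show "\<bar>indicator (- cball 0 \<eta>) w * (g x - g (x + w))\<bar> \<le> 2 * B'" for w
        using gb[of "x + w"] gb[of x] by (auto simp: indicator_def)
    qed simp_all
    moreover have "far_kernel s \<eta> w * (indicator (- cball 0 \<eta>) w * (g x - g (x + w))) = F \<eta> w" for w
      by (auto simp: F_def far_kernel_def riesz_kernel_def indicator_def max_absorb1)
    ultimately show ?thesis by simp
  qed
  have eqF: "indicator (- cball x \<eta>) (x + w) *\<^sub>R
      ((g x - g (x + w)) / norm (x - (x + w)) powr (n + 2 * s)) = F \<eta> w" for \<eta> w
  proof -
    have "norm w powr (- real CARD('n) - 2 * s) = 1 / norm w powr (real CARD('n) + 2 * s)"
      using powr_minus_divide[of "norm w" "real CARD('n) + 2 * s"] by simp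
    then show ?thesis by (auto simp: F_def riesz_kernel_def indicator_def n_def dist_norm)
  qed
  have FS: "(LINT w|lborel. F \<eta> w) = - (1/2) * (LINT w|lborel. S \<eta> w)" if "0 < \<eta>" for \<eta>
  proof -
    have "(LINT w|lborel. F \<eta> w) = (LINT w|lborel. F \<eta> (- w))"
      using lborel_integral_reflect[of "F \<eta>" 0] by simp
    moreover have "integrable lborel (\<lambda>w. F \<eta> (- w))"
      using lborel_integrable_reflect[OF intF[OF that], of 0] by simp
    ultimately have "2 * (LINT w|lborel. F \<eta> w) = (LINT w|lborel. F \<eta> w + F \<eta> (- w))"
      using intF[OF that] by simp
    also have "\<dots> = (LINT w|lborel. - S \<eta> w)"
      by (intro Bochner_Integration.integral_cong)
         (auto simp: F_def S_def second_diff_def indicator_def algebra_simps)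
    finally show ?thesis by simp
  qed
  have lim: "((\<lambda>\<eta>. LINT w|lborel. S \<eta> w) \<longlongrightarrow> (LINT w|lborel. riesz_kernel s w * second_diff g x w))
      (at_right 0)"
  proof (rule tendsto_at_right_sequentially[of 0 1])
    fix e :: "nat \<Rightarrow> real"
    assume e: "\<And>n. 0 < e n" "e \<longlonglongrightarrow> 0"
    show "(\<lambda>n. LINT w|lborel. S (e n) w) \<longlonglongrightarrow> (LINT w|lborel. riesz_kernel s w * second_diff g x w)"
    proof (rule integral_dominated_convergence[where w = "\<lambda>w. norm
        (riesz_kernel s w * second_diff g x w)"])
      show "integrable lborel (\<lambda>w. norm (riesz_kernel s w * second_diff g x w))"
        using intR by (rule integrable_norm)
      show "AE w in lborel. (\<lambda>n. S (e n) w) \<longlonglongrightarrow> riesz_kernel s w * second_diff g x w"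
      proof (rule AE_I2)
        fix w :: "real ^ 'n"
        show "(\<lambda>n. S (e n) w) \<longlonglongrightarrow> riesz_kernel s w * second_diff g x w"
        proof (cases "w = 0")
          case False
          then have "eventually (\<lambda>n. e n < norm w) sequentially"
            using order_tendstoD(2)[OF e(2), of "norm w"] by simp
          then have "eventually (\<lambda>n. S (e n) w = riesz_kernel s w * second_diff g x w) sequentially"
            by eventually_elim (simp add: S_def)
          then show ?thesis by (rule tendsto_eventually)
        qed (simp add: S_def)
      qed
    qed (auto simp: S_def indicator_def)
  qed simp
  show ?thesis
    unfolding has_frac_laplacian_def
  proof (intro conjI allI impI)
    fix \<eta> :: real assume "0 < \<eta>"
    have "integrable lborel (\<lambda>z. F \<eta> (- x + z))"
      using lborel_integrable_shift[OF intF[OF \<open>0 < \<eta>\<close>], of "- x"] .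
    then show "set_integrable lborel (- cball x \<eta>)
        (\<lambda>z. (g x - g z) / norm (x - z) powr (real CARD('n) + 2 * s))"
      unfolding set_integrable_def using eqF[of \<eta> "- x + z" for z, symmetric] by (simp add: n_def)
  next
    have "(LINT z:- cball x \<eta>|lborel. (g x - g z) / norm (x - z) powr (n + 2 * s))
        = (LINT w|lborel. F \<eta> w)" for \<eta>
      unfolding set_lebesgue_integral_def by (subst lborel_integral_shift[of _ x]) (simp only: eqF)
    then have *: "c * (LINT z:- cball x \<eta>|lborel. (g x - g z) / norm (x - z) powr (n + 2 * s))
        = - (c / 2) * (LINT w|lborel. S \<eta> w)" if "0 < \<eta>" for \<eta>
      using FS[OF that] by simp
    have "((\<lambda>\<eta>. - (c / 2) * (LINT w|lborel. S \<eta> w)) \<longlongrightarrow> symmetric_frac_lap s g x) (at_right 0)"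
      unfolding symmetric_frac_lap_def c_def by (intro tendsto_intros lim)
    then have "((\<lambda>\<eta>. c * (LINT z:- cball x \<eta>|lborel. (g x - g z) / norm (x - z) powr (n + 2 * s))) \<longlongrightarrow>
        symmetric_frac_lap s g x) (at_right 0)"
      by (rule Lim_transform_eventually)
          (auto simp: eventually_at_right_less * intro!: eventually_mono[OF eventually_at_right_less])
    then show "((\<lambda>\<epsilon>. frac_lap_const CARD('n) s * (LINT z:- cball x \<epsilon>|lborel.
           (g x - g z) / norm (x - z) powr (real CARD('n) + 2 * s))) \<longlongrightarrow> symmetric_frac_lap s g x)
               (at_right 0)"
      by (simp add: c_def n_def)
  qed
qed

lemma frac_laplacian_eqI:
  assumes "has_frac_laplacian s g x L"
  shows "frac_laplacian s g x = L"
  unfolding frac_laplacian_def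
proof (rule the_equality, rule assms)
  fix L' assume "has_frac_laplacian s g x L'"
  with assms show "L' = L"
    unfolding has_frac_laplacian_def
    by (intro tendsto_unique[OF trivial_limit_at_right_real]) auto
qed

section \<open>Mollifiers as test functions\<close>

lemma integrable_mult_bounded:
  fixes g k :: "'a \<Rightarrow> real"
  assumes g: "integrable M g" and [measurable]: "k \<in> borel_measurable M" and k: "\<And>z. \<bar>k z\<bar> \<le> B"
  shows "integrable M (\<lambda>z. g z * k z)"
proof (rule Bochner_Integration.integrable_bound)
  show "integrable M (\<lambda>z. B * norm (g z))"
    using g by (intro integrable_mult_right integrable_norm)
  have "\<bar>g z\<bar> * \<bar>k z\<bar> \<le> \<bar>g z\<bar> * \<bar>B\<bar>" for z
    using k[of z] by (intro mult_left_mono) auto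
  then show "AE z in M. norm (g z * k z) \<le> norm (B * norm (g z))"
    by (intro AE_I2) (simp add: abs_mult mult.commute)
qed (use g in measurable)

lemma integrable_pair_mult:
  fixes g :: "'a::euclidean_space \<Rightarrow> real" and h :: "'b::euclidean_space \<Rightarrow> real"
  assumes g: "integrable lborel g" and h: "integrable lborel h"
  shows "integrable (lborel \<Otimes>\<^sub>M lborel) (\<lambda>(x, y). g x * h y)"
proof (rule lborel_pair.Fubini_integrable)
  have [measurable]: "g \<in> borel_measurable borel" "h \<in> borel_measurable borel"
    using g h by simp_all
  show "(\<lambda>(x, y). g x * h y) \<in> borel_measurable (lborel \<Otimes>\<^sub>M lborel)"
    by measurable
  show "integrable lborel (\<lambda>x. LINT y|lborel. norm (case (x, y) of (x, y) \<Rightarrow> g x * h y))"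
    using g h by (simp add: abs_mult)
  show "AE x in lborel. integrable lborel (\<lambda>y. case (x, y) of (x, y) \<Rightarrow> g x * h y)"
    using h by simp
qed

text \<open>The square makes the first derivative Lipschitz across the unit sphere, so that second
  differences are bounded by a multiple of \<open>(norm w)\<^sup>2\<close>.\<close>

definition bump :: "'a::euclidean_space \<Rightarrow> real" where
  "bump x = (max 0 (1 - (norm x)\<^sup>2))\<^sup>2"

lemma bump_bounds: "0 \<le> bump x" "bump x \<le> 1"
proof -
  have "max 0 (1 - (norm x)\<^sup>2) \<le> 1" by simp
  then show "bump x \<le> 1" unfolding bump_def by (intro power_le_one) auto
qed (simp add: bump_def)

lemma bump_eq_0: "1 \<le> norm x \<Longrightarrow> bump x = 0"
  by (simp add: bump_def)

text \<open>The function \<open>\<lambda>t. (max 0 (1 - t))\<^sup>2\<close> has a derivative with Lipschitz constant 2, whence the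
  quadratic remainder. Proved by cases to avoid differentiating at the kink.\<close>
lemma square_positive_part_Taylor:
  fixes t a :: real
  shows "\<bar>(max 0 (1 - (t + a)))\<^sup>2 - (max 0 (1 - t))\<^sup>2 + 2 * max 0 (1 - t) * a\<bar> \<le> a\<^sup>2"
proof -
  define p where "p = 1 - t"
  have eq: "1 - (t + a) = p - a" by (simp add: p_def)
  consider "0 \<le> p" "a \<le> p" | "0 \<le> p" "p < a" | "p < 0" "a \<le> p" | "p < 0" "p < a" by linarith
  then show ?thesis
  proof cases
    case 1 then show ?thesis unfolding eq p_def[symmetric] by (simp add: power2_eq_square algebra_simps)
  next
    case 2
    have "0 \<le> p * (2 * a - p)" using 2 by simp
    moreover have "p * (2 * a - p) \<le> a\<^sup>2"
      using sum_squares_ge_zero[of "a - p" 0] by (simp add: power2_eq_square algebra_simps)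
    ultimately show ?thesis using 2 unfolding eq p_def[symmetric]
      by (simp add: power2_eq_square algebra_simps)
  next
    case 3
    have "(p - a)\<^sup>2 \<le> (- a)\<^sup>2" by (rule power_mono) (use 3 in auto)
    with 3 show ?thesis unfolding eq p_def[symmetric] by simp
  next
    case 4 then show ?thesis unfolding eq p_def[symmetric] by simp
  qed
qed

text \<open>With \<open>t = (norm x)\<^sup>2\<close> the linear Taylor terms at \<open>x + w\<close> and \<open>x - w\<close> cancel up to \<open>(norm
  w)\<^sup>2\<close>. The remainders are quadratic in \<open>w\<close> only for bounded \<open>x\<close>; for large \<open>x\<close> all three values
  vanish.\<close>
lemma second_diff_bump_le:
  fixes x w :: "'a::euclidean_space"
  shows "\<bar>second_diff bump x w\<bar> \<le> 54 * (norm w)\<^sup>2"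
proof (cases "1 \<le> norm w")
  case True
  then have "1 \<le> (norm w)\<^sup>2" by simp
  moreover have "\<bar>second_diff bump x w\<bar> \<le> 4"
    using bump_bounds[of x] bump_bounds[of "x + w"] bump_bounds[of "x - w"]
    unfolding second_diff_def by linarith
  ultimately show ?thesis by linarith
next
  case False
  show ?thesis
  proof (cases "2 \<le> norm x")
    case True
    have "1 \<le> norm (x + w)" "1 \<le> norm (x - w)"
      using True False norm_triangle_ineq2[of x w] norm_triangle_ineq2[of x "- w"] by auto
    then show ?thesis using True by (simp add: second_diff_def bump_eq_0)
  next
    case x: False
    define t where "t = (norm x)\<^sup>2"
    define a where "a = (norm w)\<^sup>2 + 2 * (x \<bullet> w)"
    define b where "b = (norm w)\<^sup>2 - 2 * (x \<bullet> w)"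
    define d where "d = max 0 (1 - t)"
    have d: "0 \<le> d" "d \<le> 1" by (auto simp: d_def t_def)
    have eqs: "(norm (x + w))\<^sup>2 = t + a" "(norm (x - w))\<^sup>2 = t + b"
      by (simp_all add: t_def a_def b_def power2_norm_eq_inner inner_simps inner_commute)
    have "\<bar>x \<bullet> w\<bar> \<le> norm x * norm w" by (rule Cauchy_Schwarz_ineq2)
    also have "\<dots> \<le> 2 * norm w" using x by (intro mult_right_mono) auto
    finally have xw: "\<bar>x \<bullet> w\<bar> \<le> 2 * norm w" .
    have "(norm w)\<^sup>2 \<le> norm w"
      using False by (simp add: power2_eq_square mult_left_le_one_le)
    then have ab: "\<bar>a\<bar> \<le> 5 * norm w" "\<bar>b\<bar> \<le> 5 * norm w"
      using xw zero_le_power2[of "norm w"] unfolding a_def b_def by linarith+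
    then have ab2: "a\<^sup>2 \<le> 25 * (norm w)\<^sup>2" "b\<^sup>2 \<le> 25 * (norm w)\<^sup>2"
      using power_mono[of "\<bar>a\<bar>" "5 * norm w" 2] power_mono[of "\<bar>b\<bar>" "5 * norm w" 2]
      by (auto simp: power_mult_distrib)
    have "2 * d * a + 2 * d * b = 4 * (d * (norm w)\<^sup>2)" by (simp add: a_def b_def algebra_simps)
    moreover have "0 \<le> d * (norm w)\<^sup>2" "d * (norm w)\<^sup>2 \<le> (norm w)\<^sup>2"
      using d by (auto intro: mult_left_le_one_le)
    moreover have "\<bar>bump (x + w) - bump x + 2 * d * a\<bar> \<le> a\<^sup>2" "\<bar>bump (x - w) - bump x + 2 * d * b\<bar>
        \<le> b\<^sup>2"
      using square_positive_part_Taylor[of t a] square_positive_part_Taylor[of t b]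
      by (simp_all add: bump_def eqs d_def t_def[symmetric])
    ultimately show ?thesis
      using ab2 unfolding second_diff_def by linarith
  qed
qed

definition mollifier :: "real \<Rightarrow> ('a::euclidean_space \<Rightarrow> real) \<Rightarrow> bool" where
  "mollifier \<epsilon> \<rho> \<longleftrightarrow>
     continuous_on UNIV \<rho> \<and> (\<forall>x. 0 \<le> \<rho> x) \<and> (\<forall>x. \<epsilon> \<le> norm x \<longrightarrow> \<rho> x = 0) \<and>
     (\<exists>B. \<forall>x. \<rho> x \<le> B) \<and> (\<exists>B. \<forall>x w. \<bar>second_diff \<rho> x w\<bar> \<le> B * (norm w)\<^sup>2) \<and>
     (LINT x|lborel. \<rho> x) = 1"

lemma continuous_on_bump: "continuous_on UNIV (bump :: 'a::euclidean_space \<Rightarrow> real)"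
  unfolding bump_def[abs_def] by (intro continuous_intros)

lemma mollifier_exists:
  assumes "0 < \<epsilon>"
  shows "\<exists>\<rho> :: 'a::euclidean_space \<Rightarrow> real. mollifier \<epsilon> \<rho>"
proof -
  define b where "b x = bump ((1 / \<epsilon>) *\<^sub>R x)" for x :: 'a
  define m where "m = (LINT x|lborel. b x)"
  have b_cont: "continuous_on UNIV b"
    unfolding b_def by (rule continuous_on_compose2[OF continuous_on_bump])
        (auto intro!: continuous_intros)
  have [measurable]: "b \<in> borel_measurable borel"
    using b_cont by (rule borel_measurable_continuous_onI)
  have b01: "0 \<le> b x" "b x \<le> 1" for x by (simp_all add: b_def bump_bounds)
  have b_supp: "\<epsilon> \<le> norm x \<Longrightarrow> b x = 0" for x
    using assms unfolding b_def by (intro bump_eq_0) (simp add: field_simps)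
  have b_int: "integrable lborel b"
  proof (rule Bochner_Integration.integrable_bound)
    show "integrable lborel (indicator (ball (0::'a) \<epsilon>) :: 'a \<Rightarrow> real)"
      using assms by (intro integrable_real_indicator) (auto simp: emeasure_ball)
    show "AE x in lborel. norm (b x) \<le> norm (indicator (ball 0 \<epsilon>) x :: real)"
      using b01 b_supp by (intro AE_I2) (auto simp: indicator_def)
  qed simp
  have b_half: "1/4 \<le> b x" if "norm x \<le> \<epsilon> / 2" for x
  proof -
    define y where "y = norm ((1 / \<epsilon>) *\<^sub>R x)"
    have "y \<le> 1/2" using that assms by (simp add: y_def field_simps)
    then have "y\<^sup>2 \<le> (1/2)\<^sup>2" by (intro power_mono) (auto simp: y_def)
    then have "1/2 \<le> max 0 (1 - y\<^sup>2)" by (simp add: power_divide max_def)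
    then have "(1/2)\<^sup>2 \<le> (max 0 (1 - y\<^sup>2))\<^sup>2" by (rule power_mono) simp
    then show ?thesis unfolding b_def bump_def y_def[symmetric] by (simp add: power_divide)
  qed
  have "0 < 1/4 * measure lborel (ball (0::'a) (\<epsilon> / 2))"
    using assms by (simp add: content_ball unit_ball_vol_pos)
  also have "\<dots> = (LINT x|lborel. 1/4 * indicator (ball (0::'a) (\<epsilon> / 2)) x)" by simp
  also have "\<dots> \<le> m"
    unfolding m_def using assms b_half b01
    by (intro integral_mono b_int integrable_mult_right integrable_real_indicator)
       (auto simp: emeasure_ball indicator_def)
  finally have m: "0 < m" .
  have "mollifier \<epsilon> (\<lambda>x. b x / m)"
    unfolding mollifier_def
  proof (intro conjI allI impI)
    show "continuous_on UNIV (\<lambda>x. b x / m)" using m by (intro continuous_intros b_cont) auto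
    show "\<exists>B. \<forall>x. b x / m \<le> B" using m b01 by (intro exI[of _ "1 / m"]) (auto intro: divide_right_mono)
    show "\<exists>B. \<forall>x w. \<bar>second_diff (\<lambda>x. b x / m) x w\<bar> \<le> B * (norm w)\<^sup>2"
    proof (intro exI[of _ "54 / (\<epsilon>\<^sup>2 * m)"] allI)
      fix x w :: 'a
      have "second_diff (\<lambda>x. b x / m) x w = second_diff bump ((1 / \<epsilon>) *\<^sub>R x) ((1 / \<epsilon>) *\<^sub>R w) / m"
        by (simp add: second_diff_def b_def diff_divide_distrib add_divide_distrib scaleR_add_right
            scaleR_diff_right)
      also have "\<bar>\<dots>\<bar> \<le> 54 * (norm ((1 / \<epsilon>) *\<^sub>R w))\<^sup>2 / m"
        using second_diff_bump_le[of "(1 / \<epsilon>) *\<^sub>R x" "(1 / \<epsilon>) *\<^sub>R w"] m by (simp add: divide_right_mono)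
      also have "\<dots> = 54 / (\<epsilon>\<^sup>2 * m) * (norm w)\<^sup>2"
        by (simp add: power_divide)
      finally show "\<bar>second_diff (\<lambda>x. b x / m) x w\<bar> \<le> 54 / (\<epsilon>\<^sup>2 * m) * (norm w)\<^sup>2" .
    qed
    show "(LINT x|lborel. b x / m) = 1" using m by (simp add: m_def)
  qed (use m b01 b_supp in auto)
  then show ?thesis by (rule exI[where x = "\<lambda>x. b x / m"])
qed

text \<open>A weak solution together with a mollifier. Below, \<open>U\<close> and \<open>E\<close> are the mollifications of \<open>u\<close>
  and of \<open>f \<circ> u\<close>, and \<open>V r\<close> is the mollification of the far kernel.\<close>

locale mollified_solution =
  fixes s :: real and f :: "real \<Rightarrow> real" and u :: "real ^ 'n \<Rightarrow> real"
    and \<epsilon> :: real and \<rho> :: "real ^ 'n \<Rightarrow> real"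
  assumes s: "0 < s" "s < 1"
    and u_weak: "weak_solution s f u"
    and u_measurable [measurable]: "u \<in> borel_measurable borel"
    and \<rho>: "mollifier \<epsilon> \<rho>"
begin

definition U :: "real ^ 'n \<Rightarrow> real" where
  "U x = (LINT z|lborel. u z * \<rho> (x - z))"

definition E :: "real ^ 'n \<Rightarrow> real" where
  "E x = (LINT z|lborel. f (u z) * \<rho> (x - z))"

definition V :: "real \<Rightarrow> real ^ 'n \<Rightarrow> real" where
  "V r p = (LINT w|lborel. far_kernel s r w * \<rho> (p - w))"

lemma u_outside: "x \<notin> ball 0 1 \<Longrightarrow> u x = 0"
  using u_weak by (auto simp: weak_solution_def)

lemma u_integrable: "integrable lborel u"
proof -
  have "indicator (ball 0 1) x *\<^sub>R u x = u x" for x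
    using u_outside[of x] by (auto simp: indicator_def)
  moreover have "set_integrable lborel (ball 0 1) u" using u_weak unfolding weak_solution_def by blast
  ultimately show ?thesis by (simp only: set_integrable_def)
qed

lemma \<rho>_continuous: "continuous_on UNIV \<rho>"
  and \<rho>_nonneg [simp]: "0 \<le> \<rho> x"
  and \<rho>_eq_0: "\<epsilon> \<le> norm x \<Longrightarrow> \<rho> x = 0"
  and \<rho>_integral: "(LINT x|lborel. \<rho> x) = 1"
  using \<rho> by (auto simp: mollifier_def)

lemma \<rho>_measurable [measurable]: "\<rho> \<in> borel_measurable borel"
  using \<rho>_continuous by (rule borel_measurable_continuous_onI)

lemma \<rho>_integrable: "integrable lborel \<rho>"
  using \<rho>_integral not_integrable_integral_eq by fastforce

lemma \<rho>_bounded: obtains B where "0 \<le> B" "\<And>x. \<bar>\<rho> x\<bar> \<le> B"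
proof -
  obtain B where "\<And>x. \<rho> x \<le> B" using \<rho> by (auto simp: mollifier_def)
  then have "\<And>x. \<bar>\<rho> x\<bar> \<le> B" "0 \<le> B" by (simp, meson \<rho>_nonneg order_trans)
  with that show ?thesis by blast
qed

lemma \<rho>_second_diff_bounded: obtains B where "0 \<le> B" "\<And>x w. \<bar>second_diff \<rho> x w\<bar> \<le> B * (norm w)\<^sup>2"
proof -
  obtain B where B: "\<And>x w. \<bar>second_diff \<rho> x w\<bar> \<le> B * (norm w)\<^sup>2" using \<rho> by (auto simp: mollifier_def)
  have "\<bar>second_diff \<rho> x w\<bar> \<le> \<bar>B\<bar> * (norm w)\<^sup>2" for x w
    using B[of x w] mult_right_mono[OF abs_ge_self[of B] zero_le_power2[of "norm w"]] by linarith
  with that[of "\<bar>B\<bar>"] show ?thesis by simp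
qed

lemma second_diff_measurable [measurable]: "second_diff \<rho> p \<in> borel_measurable borel"
  unfolding second_diff_def[abs_def] by measurable

lemma integrable_near_second_diff: "0 < r
    \<Longrightarrow> integrable lborel (\<lambda>w. near_kernel s r w * second_diff \<rho> p w)"
proof -
  assume r: "0 < r"
  obtain B where "\<And>x w. \<bar>second_diff \<rho> x w\<bar> \<le> B * (norm w)\<^sup>2" by (rule \<rho>_second_diff_bounded) blast
  then show ?thesis using s r by (intro integrable_near_kernel_mult[where B=B]) auto
qed

lemma integrable_far_\<rho>: "0 < r \<Longrightarrow> integrable lborel (\<lambda>w. far_kernel s r w * \<rho> (p - w))"
proof -
  assume r: "0 < r"
  obtain B where "\<And>x. \<bar>\<rho> x\<bar> \<le> B" by (rule \<rho>_bounded) blast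
  then show ?thesis using s r by (intro integrable_far_kernel_mult[where B=B]) auto
qed

lemma far_second_diff:
  assumes r: "0 < r"
  shows "integrable lborel (\<lambda>w. far_kernel s r w * second_diff \<rho> p w)"
    and "(LINT w|lborel. far_kernel s r w * second_diff \<rho> p w)
      = 2 * V r p - 2 * (r powr (- 2 * s) * far_mass TYPE(real ^ 'n) s) * \<rho> p"
proof -
  note i1 = integrable_far_\<rho>[OF r, of p]
  have i2: "integrable lborel (\<lambda>w. far_kernel s r w * \<rho> (p + w))"
    using lborel_integrable_reflect[OF i1, of 0] by simp
  have e2: "(LINT w|lborel. far_kernel s r w * \<rho> (p + w)) = V r p"
    unfolding V_def by (subst (2) lborel_integral_reflect[of _ 0]) simp
  have i3: "integrable lborel (\<lambda>w::real ^ 'n. far_kernel s r w * (2 * \<rho> p))"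
    using integrable_far_kernel[OF s(1) r] by (intro integrable_mult_left)
  have eq: "far_kernel s r w * second_diff \<rho> p w =
      far_kernel s r w * \<rho> (p + w) + far_kernel s r w * \<rho> (p - w) - far_kernel s r w * (2 * \<rho> p)" for w
    by (simp add: second_diff_def algebra_simps)
  show "integrable lborel (\<lambda>w. far_kernel s r w * second_diff \<rho> p w)"
    unfolding eq using i1 i2 i3 by (intro Bochner_Integration.integrable_add
        Bochner_Integration.integrable_diff)
  show "(LINT w|lborel. far_kernel s r w * second_diff \<rho> p w)
      = 2 * V r p - 2 * (r powr (- 2 * s) * far_mass TYPE(real ^ 'n) s) * \<rho> p"
    unfolding eq using r i1 i2 i3 by (simp add: e2 V_def[symmetric] integral_far_kernel)
qed

lemma symmetric_frac_lap_\<rho>: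
  assumes r: "0 < r"
  shows "symmetric_frac_lap s \<rho> p =
    frac_lap_const CARD('n) s * (- (1/2) * (LINT w|lborel. near_kernel s r w * second_diff \<rho> p w)
         + r powr (- 2 * s) * far_mass TYPE(real ^ 'n) s * \<rho> p - V r p)"
proof -
  have "(LINT w|lborel. riesz_kernel s w * second_diff \<rho> p w) =
      (LINT w|lborel. near_kernel s r w * second_diff \<rho> p w + far_kernel s r w * second_diff \<rho> p w)"
    by (simp add: near_kernel_def algebra_simps)
  also have "\<dots> = (LINT w|lborel. near_kernel s r w * second_diff \<rho> p w)
      + (2 * V r p - 2 * (r powr (- 2 * s) * far_mass TYPE(real ^ 'n) s) * \<rho> p)"
    using integrable_near_second_diff[OF r] far_second_diff[OF r] by simp
  finally have eq: "(LINT w|lborel. riesz_kernel s w * second_diff \<rho> p w) =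
      (LINT w|lborel. near_kernel s r w * second_diff \<rho> p w)
      + (2 * V r p - 2 * (r powr (- 2 * s) * far_mass TYPE(real ^ 'n) s) * \<rho> p)" .
  show ?thesis unfolding symmetric_frac_lap_def eq by (simp add: field_simps)
qed

lemma near_second_diff_bounded:
  assumes r: "0 < r"
  obtains B where "\<And>p. \<bar>LINT w|lborel. near_kernel s r w * second_diff \<rho> p w\<bar> \<le> B"
proof -
  obtain B where B: "0 \<le> B" "\<And>x w. \<bar>second_diff \<rho> x w\<bar> \<le> B * (norm w)\<^sup>2"
      by (rule \<rho>_second_diff_bounded) blast
  have "\<bar>LINT w|lborel. near_kernel s r w * second_diff \<rho> p w\<bar>
      \<le> B * r powr (2 - 2 * s) * near_moment TYPE(real ^ 'n) s" for p
  proof -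
    have 1: "second_diff \<rho> p w \<le> B * (norm w)\<^sup>2" and 2: "- second_diff \<rho> p w \<le> B * (norm w)\<^sup>2" for w
      using B(2)[of p w] by auto
    have "(LINT w|lborel. near_kernel s r w * second_diff \<rho> p w)
        \<le> B * r powr (2 - 2 * s) * near_moment TYPE(real ^ 'n) s"
      using s r B(1) 1 integrable_near_second_diff[OF r] by (intro integral_near_kernel_mult_le) auto
    moreover have "(LINT w|lborel. near_kernel s r w * (- second_diff \<rho> p w))
        \<le> B * r powr (2 - 2 * s) * near_moment TYPE(real ^ 'n) s"
      using s r B(1) 2 integrable_near_second_diff[OF r] by (intro integral_near_kernel_mult_le) auto
    ultimately show ?thesis by simp
  qed
  with that show ?thesis by blast
qed

lemma V_bounded:
  assumes r: "0 < r"
  shows "\<bar>V r p\<bar> \<le> r powr (- (real CARD('n) + 2 * s))"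
proof -
  have i: "integrable lborel (\<lambda>w. \<rho> (p - w))"
    using lborel_integrable_reflect[OF \<rho>_integrable] .
  have "V r p \<le> (LINT w|lborel. r powr (- (real CARD('n) + 2 * s)) * \<rho> (p - w))"
    unfolding V_def using s r i far_kernel_le[OF s(1) r, where 'a = "real ^ 'n"]
    by (intro integral_mono integrable_far_\<rho> integrable_mult_right mult_right_mono) auto
  also have "\<dots> = r powr (- (real CARD('n) + 2 * s))"
    using lborel_integral_reflect[of \<rho> p] \<rho>_integral by simp
  finally show ?thesis
    unfolding V_def by (simp add: integral_nonneg_AE)
qed

text \<open>Mollification does not increase the Lipschitz constant, so this bound is uniform in the
  mollifier.\<close>
lemma V_Lipschitz:
  assumes r: "0 < r"
  shows "\<bar>V r p - V r q\<bar> \<le> (real CARD('n) + 2 * s) * r powr (- (real CARD('n) + 2 * s) - 1)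
      * norm (p - q)"
proof -
  have V_eq: "V r p = (LINT w|lborel. far_kernel s r (p - w) * \<rho> w)" for p
    unfolding V_def by (subst lborel_integral_reflect[of _ p]) simp
  have i: "integrable lborel (\<lambda>w. far_kernel s r (p - w) * \<rho> w)" for p
    using lborel_integrable_reflect[OF integrable_far_\<rho>[OF r, of p], of p] by simp
  define L where "L = (real CARD('n) + 2 * s) * r powr (- (real CARD('n) + 2 * s) - 1) * norm (p - q)"
  have "V r p - V r q = (LINT w|lborel. far_kernel s r (p - w) * \<rho> w - far_kernel s r (q - w) * \<rho> w)"
    using i by (simp add: V_eq)
  also have "\<bar>\<dots>\<bar> \<le> (LINT w|lborel. \<bar>far_kernel s r (p - w) * \<rho> w - far_kernel s r (q - w) * \<rho> w\<bar>)"
    by (rule integral_abs_bound)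
  also have "\<dots> \<le> (LINT w|lborel. L * \<rho> w)"
  proof (rule integral_mono)
    fix w
    have "\<bar>far_kernel s r (p - w) - far_kernel s r (q - w)\<bar> * \<rho> w \<le> L * \<rho> w"
      using far_kernel_Lipschitz[OF s(1) r, of "p - w" "q - w"]
          by (intro mult_right_mono) (auto simp: L_def)
    then show "\<bar>far_kernel s r (p - w) * \<rho> w - far_kernel s r (q - w) * \<rho> w\<bar> \<le> L * \<rho> w"
      by (simp add: abs_mult left_diff_distrib[symmetric])
  qed (use i \<rho>_integrable in auto)
  also have "\<dots> = L" by (simp add: \<rho>_integral)
  finally show ?thesis by (simp add: L_def)
qed

lemma V_measurable [measurable]: "V r \<in> borel_measurable borel"
  unfolding V_def[abs_def] by measurable

lemma integrable_u_mult:
  assumes [measurable]: "k \<in> borel_measurable borel" and k: "\<And>z. \<bar>k z\<bar> \<le> B"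
  shows "integrable lborel (\<lambda>z. u z * k (x - z))"
  using u_integrable k by (intro integrable_mult_bounded[where B=B]) auto

lemma integrable_u_\<rho>: "integrable lborel (\<lambda>z. u z * \<rho> (x - z))"
proof -
  obtain B where "\<And>x. \<bar>\<rho> x\<bar> \<le> B" by (rule \<rho>_bounded) blast
  then show ?thesis by (intro integrable_u_mult) auto
qed

lemma second_diff_U: "second_diff U x w = (LINT z|lborel. u z * second_diff \<rho> (x - z) w)"
proof -
  have "(LINT z|lborel. u z * second_diff \<rho> (x - z) w)
      = (LINT z|lborel. u z * \<rho> (x + w - z) + u z * \<rho> (x - w - z) - 2 * (u z * \<rho> (x - z)))"
    by (intro Bochner_Integration.integral_cong) (auto simp: second_diff_def algebra_simps)
  also have "\<dots> = second_diff U x w"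
    using integrable_u_\<rho>[of "x + w"] integrable_u_\<rho>[of "x - w"] integrable_u_\<rho>[of x]
    by (simp add: second_diff_def U_def)
  finally show ?thesis ..
qed

text \<open>Fubini is legitimate because the second differences of the mollifier bring the factor \<open>(norm
  w)\<^sup>2\<close> that makes the near kernel integrable, whereas \<open>u\<close> alone has no such regularity.\<close>
lemma near_convolution:
  assumes r: "0 < r"
  shows "(LINT z|lborel. u z * (LINT w|lborel. near_kernel s r w * second_diff \<rho> (x - z) w))
     = (LINT w|lborel. near_kernel s r w * second_diff U x w)"
    and "integrable lborel (\<lambda>w. near_kernel s r w * second_diff U x w)"
proof -
  obtain B where B: "0 \<le> B" "\<And>x w. \<bar>second_diff \<rho> x w\<bar> \<le> B * (norm w)\<^sup>2"
      by (rule \<rho>_second_diff_bounded) blast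
  define F where "F z w = u z * (near_kernel s r w * second_diff \<rho> (x - z) w)" for z w
  have [measurable]: "(\<lambda>(z, w). F z w) \<in> borel_measurable (lborel \<Otimes>\<^sub>M lborel)"
    unfolding F_def second_diff_def by measurable
  have intF: "integrable (lborel \<Otimes>\<^sub>M lborel) (\<lambda>(z, w). F z w)"
  proof (rule Bochner_Integration.integrable_bound)
    show "integrable (lborel \<Otimes>\<^sub>M lborel) (\<lambda>(z, w). u z * (near_kernel s r w * (B * (norm w)\<^sup>2)))"
      using s r B u_integrable by (intro integrable_pair_mult integrable_near_kernel_mult[where B=B])
          auto
    show "AE p in lborel \<Otimes>\<^sub>M lborel. norm (case p of (z, w) \<Rightarrow> F z w)
       \<le> norm (case p of (z, w) \<Rightarrow> u z * (near_kernel s r w * (B * (norm w)\<^sup>2)))"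
      using B by (intro AE_I2) (auto simp: F_def abs_mult mult.assoc intro!: mult_left_mono)
  qed measurable
  have "(LINT z|lborel. LINT w|lborel. F z w) = (LINT w|lborel. LINT z|lborel. F z w)"
    using lborel_pair.Fubini_integral[OF intF] ..
  moreover have "(LINT z|lborel. F z w) = near_kernel s r w * second_diff U x w" for w
    by (simp add: F_def second_diff_U mult.left_commute[of "u _"])
  ultimately show "(LINT z|lborel. u z * (LINT w|lborel. near_kernel s r w * second_diff \<rho> (x - z) w))
     = (LINT w|lborel. near_kernel s r w * second_diff U x w)"
    by (simp add: F_def)
  have "integrable lborel (\<lambda>w. LINT z|lborel. F z w)"
    using lborel_pair.integrable_snd[OF intF] .
  then show "integrable lborel (\<lambda>w. near_kernel s r w * second_diff U x w)"
    by (simp add: F_def second_diff_U mult.left_commute[of "u _"])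
qed

lemma second_diff_translate: "second_diff (\<lambda>z. \<rho> (x - z)) y w = second_diff \<rho> (x - y) w"
  by (simp add: second_diff_def algebra_simps)

lemma frac_laplacian_translate:
  "has_frac_laplacian s (\<lambda>z. \<rho> (x - z)) y (symmetric_frac_lap s \<rho> (x - y))"
proof -
  obtain B where B: "0 \<le> B" "\<And>x w. \<bar>second_diff \<rho> x w\<bar> \<le> B * (norm w)\<^sup>2"
      by (rule \<rho>_second_diff_bounded) blast
  obtain B' where B': "\<And>x. \<bar>\<rho> x\<bar> \<le> B'" by (rule \<rho>_bounded) blast
  have "has_frac_laplacian s (\<lambda>z. \<rho> (x - z)) y (symmetric_frac_lap s (\<lambda>z. \<rho> (x - z)) y)"
    using s B B' by (intro has_frac_laplacian_symmetric[where B=B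
        and B'=B']) (auto simp: second_diff_translate)
  then show ?thesis by (simp add: symmetric_frac_lap_def second_diff_translate)
qed

lemma symmetric_frac_lap_\<rho>_bounded: obtains B where "\<And>p. \<bar>symmetric_frac_lap s \<rho> p\<bar> \<le> B"
proof -
  obtain B1 where B1: "\<And>p. \<bar>LINT w|lborel. near_kernel s 1 w * second_diff \<rho> p w\<bar> \<le> B1"
    using near_second_diff_bounded[of 1] by auto
  obtain B2 where B2: "\<And>x. \<bar>\<rho> x\<bar> \<le> B2" by (rule \<rho>_bounded) blast
  have "\<bar>symmetric_frac_lap s \<rho> p\<bar>
      \<le> frac_lap_const CARD('n) s * (B1 + far_mass TYPE(real ^ 'n) s * B2 + 1)" for p
  proof -
    define X where "X = (LINT w|lborel. near_kernel s 1 w * second_diff \<rho> p w)"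
    define fm where "fm = far_mass TYPE(real ^ 'n) s"
    have fm: "0 \<le> fm" using far_mass_pos[OF s(1), where 'a="real ^ 'n"] by (simp add: fm_def)
    have "\<bar>V 1 p\<bar> \<le> 1" using V_bounded[of 1 p] by simp
    moreover have "\<bar>X\<bar> \<le> B1" using B1[of p] by (simp add: X_def)
    moreover have "\<bar>fm * \<rho> p\<bar> \<le> fm * B2" using B2[of p] fm by (simp add: abs_mult mult_left_mono)
    ultimately have "\<bar>- (1/2) * X + fm * \<rho> p - V 1 p\<bar> \<le> B1 + fm * B2 + 1" by linarith
    then have "frac_lap_const CARD('n) s * \<bar>- (1/2) * X + fm * \<rho> p - V 1 p\<bar>
        \<le> frac_lap_const CARD('n) s * (B1 + fm * B2 + 1)"
      using frac_lap_const_pos[OF s, of "CARD('n)"] by (intro mult_left_mono) auto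
    then show ?thesis
      using symmetric_frac_lap_\<rho>[of 1 p] frac_lap_const_pos[OF s, of "CARD('n)"]
      by (simp add: abs_mult X_def fm_def)
  qed
  with that show ?thesis by blast
qed

lemma test_function_translate:
  assumes "cball x \<epsilon> \<subseteq> ball 0 1"
  shows "test_function s (\<lambda>z. \<rho> (x - z))"
  unfolding test_function_def
proof (intro conjI ballI allI impI)
  obtain B where B: "\<And>x. \<bar>\<rho> x\<bar> \<le> B" by (rule \<rho>_bounded) blast
  then show "bounded ((\<lambda>z. \<rho> (x - z)) ` ball 0 1)"
    by (auto simp: bounded_iff)
  show "\<exists>L. has_frac_laplacian s (\<lambda>z. \<rho> (x - z)) y L" for y
    using frac_laplacian_translate by blast
  obtain B' where "\<And>p. \<bar>symmetric_frac_lap s \<rho> p\<bar> \<le> B'" by (rule symmetric_frac_lap_\<rho>_bounded) blast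
  then show "bounded (frac_laplacian s (\<lambda>z. \<rho> (x - z)) ` ball 0 1)"
    unfolding bounded_iff by (auto simp: frac_laplacian_eqI[OF frac_laplacian_translate])
  show "\<rho> (x - z) = 0" if "z \<notin> ball 0 1" for z
  proof (rule \<rho>_eq_0)
    have "z \<notin> cball x \<epsilon>" using that assms by auto
    then show "\<epsilon> \<le> norm (x - z)" by (simp add: dist_norm)
  qed
qed measurable

text \<open>Testing the weak equation with the translated mollifier turns it into a pointwise equation
  for \<open>U\<close>. Only the near part is written with second differences of \<open>U\<close>. In the far part the
  kernel stays mollified and integrated against \<open>u\<close>, so that differences in \<open>x\<close> can later be put
  on the kernel.\<close>
lemma mollified_equation:
  assumes x: "cball x \<epsilon> \<subseteq> ball 0 1" and r: "0 < r"
  shows "integrable lborel (\<lambda>z. f (u z) * \<rho> (x - z))"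
    and "E x = frac_lap_const CARD('n) s
        * (- (1/2) * (LINT w|lborel. near_kernel s r w * second_diff U x w)
         + r powr (- 2 * s) * far_mass TYPE(real ^ 'n) s * U x - (LINT z|lborel. u z * V r (x - z)))"
proof -
  let ?\<zeta> = "\<lambda>z. \<rho> (x - z)"
  note test = test_function_translate[OF x]
  have out: "\<rho> (x - z) = 0" if "z \<notin> ball 0 1" for z
    using test that by (auto simp: test_function_def)
  have *: "set_integrable lborel (ball 0 1) (\<lambda>z. f (u z) * ?\<zeta> z)"
    "(LINT z:ball 0 1|lborel. u z * frac_laplacian s ?\<zeta> z) = (LINT z:ball 0 1|lborel. f (u z) * ?\<zeta> z)"
    using u_weak test unfolding weak_solution_def by blast+
  have e1: "indicator (ball 0 1) z *\<^sub>R (f (u z) * ?\<zeta> z) = f (u z) * ?\<zeta> z" for z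
    using out[of z] by (auto simp: indicator_def)
  have e2: "indicator (ball 0 1) z *\<^sub>R (u z * frac_laplacian s ?\<zeta> z)
      = u z * symmetric_frac_lap s \<rho> (x - z)" for z
    using u_outside[of z] by (auto simp: indicator_def frac_laplacian_eqI[OF frac_laplacian_translate])
  show "integrable lborel (\<lambda>z. f (u z) * \<rho> (x - z))"
    using *(1) unfolding set_integrable_def e1 .
  define N where "N p = (LINT w|lborel. near_kernel s r w * second_diff \<rho> p w)" for p
  obtain B1 where B1: "\<And>p. \<bar>N p\<bar> \<le> B1"
    unfolding N_def using near_second_diff_bounded[OF r] by metis
  have [measurable]: "N \<in> borel_measurable borel"
    unfolding N_def[abs_def] second_diff_def by measurable
  have i1: "integrable lborel (\<lambda>z. u z * N (x - z))"
    using B1 by (intro integrable_u_mult) auto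
  have i2: "integrable lborel (\<lambda>z. u z * V r (x - z))"
    using V_bounded[OF r] by (intro integrable_u_mult) auto
  have "E x = (LINT z|lborel. u z * symmetric_frac_lap s \<rho> (x - z))"
    using *(2) unfolding set_lebesgue_integral_def e1 e2 E_def ..
  also have "\<dots> = (LINT z|lborel. frac_lap_const CARD('n) s * (- (1/2) * (u z * N (x - z))
      + r powr (- 2 * s) * far_mass TYPE(real ^ 'n) s * (u z * \<rho> (x - z)) - u z * V r (x - z)))"
    by (intro Bochner_Integration.integral_cong)
        (auto simp: symmetric_frac_lap_\<rho>[OF r] N_def algebra_simps)
  also have "\<dots> = frac_lap_const CARD('n) s * (- (1/2) * (LINT z|lborel. u z * N (x - z))
      + r powr (- 2 * s) * far_mass TYPE(real ^ 'n) s * U x - (LINT z|lborel. u z * V r (x - z)))"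
    using i1 i2 integrable_u_\<rho>[of x] by (simp add: U_def)
  also have "(LINT z|lborel. u z * N (x - z)) = (LINT w|lborel. near_kernel s r w * second_diff U x w)"
    unfolding N_def by (rule near_convolution[OF r])
  finally show "E x = frac_lap_const CARD('n) s
      * (- (1/2) * (LINT w|lborel. near_kernel s r w * second_diff U x w)
         + r powr (- 2 * s) * far_mass TYPE(real ^ 'n) s * U x - (LINT z|lborel. u z * V r (x - z)))" .
qed

end

section \<open>The maximum principle for difference quotients\<close>

lemma inverse_power_Taylor:
  "\<exists>C\<ge>0. \<forall>a::real. \<bar>a\<bar> \<le> 1/2 \<longrightarrow> inverse ((1 - a) ^ m) \<le> 1 + real m * a + C * a\<^sup>2"
proof (induction m)
  case 0
  then show ?case by (intro exI[of _ 0]) auto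
next
  case (Suc m)
  then obtain C where C: "0 \<le> C" "\<And>a::real. \<bar>a\<bar> \<le> 1/2
      \<Longrightarrow> inverse ((1 - a) ^ m) \<le> 1 + real m * a + C * a\<^sup>2"
    by blast
  define C' where "C' = 2 + m + C + (2 * m + C) / 2 + C"
  show ?case
  proof (intro exI[of _ C'] conjI allI impI)
    show "0 \<le> C'" using C by (simp add: C'_def)
    fix a :: real assume a: "\<bar>a\<bar> \<le> 1/2"
    have 1: "inverse (1 - a) \<le> 1 + a + 2 * a\<^sup>2"
    proof -
      have "0 \<le> a\<^sup>2 * (1 - 2 * a)" using a by (intro mult_nonneg_nonneg) auto
      then have "1 \<le> (1 + a + 2 * a\<^sup>2) * (1 - a)"
        by (simp add: power2_eq_square algebra_simps)
      then show ?thesis using a by (simp add: field_simps)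
    qed
    have pos: "0 < inverse ((1 - a) ^ m)" using a by simp
    have "inverse ((1 - a) ^ Suc m) = inverse ((1 - a) ^ m) * inverse (1 - a)" by simp
    also have "\<dots> \<le> (1 + real m * a + C * a\<^sup>2) * (1 + a + 2 * a\<^sup>2)"
      using C(2)[OF a] 1 pos a order_trans[OF less_imp_le[OF pos] C(2)[OF a]]
      by (intro mult_mono) auto
    also have "\<dots> = 1 + real (Suc m) * a + (2 + m + C) * a\<^sup>2 + (2 * m + C) * (a * a\<^sup>2)
        + 2 * C * (a\<^sup>2 * a\<^sup>2)"
      by (simp add: power2_eq_square algebra_simps)
    also have "\<dots> \<le> 1 + real (Suc m) * a + (2 + m + C) * a\<^sup>2 + (2 * m + C) * (a\<^sup>2 / 2)
        + 2 * C * (a\<^sup>2 / 2)"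
    proof -
      have "a * a\<^sup>2 \<le> 1/2 * a\<^sup>2" using a by (intro mult_right_mono) auto
      then have "(2 * m + C) * (a * a\<^sup>2) \<le> (2 * m + C) * (a\<^sup>2 / 2)" using C
          by (intro mult_left_mono) auto
      moreover have "a\<^sup>2 \<le> 1/2"
        using power_mono[of "\<bar>a\<bar>" "1/2" 2] a by (simp add: power_divide)
      then have "a\<^sup>2 * a\<^sup>2 \<le> 1/2 * a\<^sup>2" by (intro mult_right_mono) auto
      then have "2 * C * (a\<^sup>2 * a\<^sup>2) \<le> 2 * C * (a\<^sup>2 / 2)" using C by (intro mult_left_mono) auto
      ultimately show ?thesis by linarith
    qed
    also have "\<dots> = 1 + real (Suc m) * a + C' * a\<^sup>2"
      by (simp add: C'_def algebra_simps)
    finally show "inverse ((1 - a) ^ Suc m) \<le> 1 + real (Suc m) * a + C' * a\<^sup>2" .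
  qed
qed

text \<open>A smooth substitute for the distance to the boundary of the ball. The distance itself has a
  kink at the centre, where its second differences would not be integrable against the near kernel
  for \<open>s \<ge> 1/2\<close>.\<close>

definition ball_weight :: "real \<Rightarrow> 'a::real_normed_vector \<Rightarrow> 'a \<Rightarrow> real" where
  "ball_weight R a x = R\<^sup>2 - (norm (x - a))\<^sup>2"

lemma ball_weight_pos: "x \<in> ball a R \<Longrightarrow> 0 < ball_weight R a x"
  unfolding ball_weight_def by (auto simp: dist_norm norm_minus_commute intro!: power_strict_mono)

lemma ball_weight_pos_iff: "0 \<le> R \<Longrightarrow> 0 < ball_weight R a x \<longleftrightarrow> x \<in> ball a R"
  unfolding ball_weight_def by (auto simp: dist_norm norm_minus_commute intro!: power_strict_mono
      dest: power_less_imp_less_base)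

lemma ball_weight_le_1: "0 \<le> R \<Longrightarrow> R \<le> 1 \<Longrightarrow> ball_weight R a x \<le> 1"
  unfolding ball_weight_def using power_le_one[of R 2] by (smt (verit) zero_le_power2)

text \<open>Inside a ball of radius comparable to the weight \<open>p\<close> at \<open>x\<close>, the barrier \<open>inverse (p ^ m)\<close>
  has second differences of its natural size, \<open>(norm w)\<^sup>2 / p\<^sup>2\<close> times its value: the weight at \<open>x
  \<plusminus> w\<close> is \<open>p * (1 - t)\<close> with \<open>|t| \<le> 1/2\<close>, and the terms of \<open>t\<close> that are linear in \<open>w\<close> cancel.\<close>
lemma barrier_second_diff:
  "\<exists>Q\<ge>0. \<forall>R (a::'a::euclidean_space) x w. 0 < R \<and> R \<le> 1 \<and> x \<in> ball a R \<and> norm w \<le> ball_weight R a x / 6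
      \<longrightarrow>
     x + w \<in> ball a R \<and>
     inverse (ball_weight R a (x + w) ^ m) + inverse (ball_weight R a (x - w) ^ m)
         - 2 * inverse (ball_weight R a x ^ m)
       \<le> inverse (ball_weight R a x ^ m) * (Q / (ball_weight R a x)\<^sup>2) * (norm w)\<^sup>2"
proof -
  obtain C where C: "0 \<le> C" "\<And>a::real. \<bar>a\<bar> \<le> 1/2 \<Longrightarrow> inverse ((1 - a) ^ m) \<le> 1 + real m * a + C * a\<^sup>2"
    using inverse_power_Taylor[of m] by blast
  define Q where "Q = 2 * real m + 18 * C"
  have "x + w \<in> ball a R \<and>
     inverse (ball_weight R a (x + w) ^ m) + inverse (ball_weight R a (x - w) ^ m)
         - 2 * inverse (ball_weight R a x ^ m)
       \<le> inverse (ball_weight R a x ^ m) * (Q / (ball_weight R a x)\<^sup>2) * (norm w)\<^sup>2"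
    if R: "0 < R" "R \<le> 1" and x: "x \<in> ball a R" and w: "norm w \<le> ball_weight R a x / 6" for R
        and a x w :: 'a
  proof -
    define p where "p = ball_weight R a x"
    define y where "y = x - a"
    define t where "t \<sigma> = (2 * \<sigma> * (y \<bullet> w) + (norm w)\<^sup>2) / p" for \<sigma> :: real
    have p: "0 < p" "p \<le> 1" using ball_weight_pos[OF x] ball_weight_le_1[of R a x] R
        by (auto simp: p_def)
    have y: "norm y \<le> 1" using x R by (simp add: y_def dist_norm norm_minus_commute)
    have "\<bar>y \<bullet> w\<bar> \<le> norm y * norm w" by (rule Cauchy_Schwarz_ineq2)
    also have "\<dots> \<le> norm w" using y by (simp add: mult_left_le_one_le)
    finally have yw: "\<bar>y \<bullet> w\<bar> \<le> norm w" .
    have w1: "norm w \<le> p / 6" using w by (simp add: p_def)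
    have w2: "(norm w)\<^sup>2 \<le> norm w"
      using w1 p by (simp add: power2_eq_square mult_left_le_one_le)
    have weq: "ball_weight R a (x + \<sigma> *\<^sub>R w) = p * (1 - t \<sigma>)" if "\<sigma>\<^sup>2 = 1" for \<sigma>
    proof -
      have nrm: "(norm (y + \<sigma> *\<^sub>R w))\<^sup>2 = (norm y)\<^sup>2 + (2 * \<sigma> * (y \<bullet> w) + \<sigma>\<^sup>2 * (norm w)\<^sup>2)"
        unfolding power2_norm_eq_inner
        by (simp add: inner_simps inner_commute power2_eq_square algebra_simps)
      have shift: "x + \<sigma> *\<^sub>R w - a = y + \<sigma> *\<^sub>R w" by (simp add: y_def)
      have "ball_weight R a (x + \<sigma> *\<^sub>R w) = p - (2 * \<sigma> * (y \<bullet> w) + \<sigma>\<^sup>2 * (norm w)\<^sup>2)"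
        unfolding ball_weight_def p_def shift nrm by (simp add: y_def)
      moreover have "p * t \<sigma> = 2 * \<sigma> * (y \<bullet> w) + (norm w)\<^sup>2" using p by (simp add: t_def)
      ultimately show ?thesis using that by (simp add: algebra_simps)
    qed
    have t3: "\<bar>t \<sigma>\<bar> \<le> 3 * norm w / p" if "\<sigma> = 1 \<or> \<sigma> = -1" for \<sigma>
    proof -
      have "\<bar>\<sigma> * (y \<bullet> w)\<bar> \<le> norm w" using that yw by auto
      then have "\<bar>2 * (\<sigma> * (y \<bullet> w)) + (norm w)\<^sup>2\<bar> \<le> 3 * norm w"
        using w2 zero_le_power2[of "norm w"] by linarith
      then show ?thesis using p by (simp add: t_def divide_right_mono mult.assoc)
    qed
    have "3 * norm w / p \<le> 1 / 2" using w1 p by (simp add: field_simps)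
    then have t_half: "\<bar>t \<sigma>\<bar> \<le> 1 / 2" if "\<sigma> = 1 \<or> \<sigma> = -1" for \<sigma>
      using t3[OF that] by linarith
    have t_sq: "(t \<sigma>)\<^sup>2 \<le> 9 * (norm w)\<^sup>2 / p\<^sup>2" if "\<sigma> = 1 \<or> \<sigma> = -1" for \<sigma>
      using power_mono[OF t3[OF that] abs_ge_zero, of 2] by (simp add: power_divide power_mult_distrib)
    have inv: "inverse (ball_weight R a (x + \<sigma> *\<^sub>R w) ^ m)
        \<le> inverse (p ^ m) * (1 + real m * t \<sigma> + C * (t \<sigma>)\<^sup>2)"
      if \<sigma>: "\<sigma> = 1 \<or> \<sigma> = -1" for \<sigma>
    proof -
      have "inverse (ball_weight R a (x + \<sigma> *\<^sub>R w) ^ m) = inverse (p ^ m) * inverse ((1 - t \<sigma>) ^ m)"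
        using \<sigma> by (subst weq) (auto simp: power_mult_distrib)
      also have "\<dots> \<le> inverse (p ^ m) * (1 + real m * t \<sigma> + C * (t \<sigma>)\<^sup>2)"
        using p C(2)[OF t_half[OF \<sigma>]] by (intro mult_left_mono) auto
      finally show ?thesis .
    qed
    have "0 < ball_weight R a (x + 1 *\<^sub>R w)"
      using t_half[of 1] p by (subst weq) auto
    then have 1: "x + w \<in> ball a R"
      using ball_weight_pos_iff[of R a "x + w"] R by simp
    have "inverse (ball_weight R a (x + w) ^ m) + inverse (ball_weight R a (x - w) ^ m)
        - 2 * inverse (p ^ m)
        \<le> inverse (p ^ m) * (1 + real m * t 1 + C * (t 1)\<^sup>2)
            + inverse (p ^ m) * (1 + real m * t (-1) + C * (t (-1))\<^sup>2)
           - 2 * inverse (p ^ m)"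
      using inv[of 1] inv[of "-1"] by simp
    also have "\<dots> = inverse (p ^ m) * (real m * (t 1 + t (-1)) + C * ((t 1)\<^sup>2 + (t (-1))\<^sup>2))"
      by (simp add: algebra_simps)
    also have "\<dots> \<le> inverse (p ^ m) *
        (real m * (2 * (norm w)\<^sup>2 / p\<^sup>2) + C * (9 * (norm w)\<^sup>2 / p\<^sup>2 + 9 * (norm w)\<^sup>2 / p\<^sup>2))"
    proof (intro mult_left_mono add_mono)
      have "t 1 + t (-1) = 2 * (norm w)\<^sup>2 / p" by (simp add: t_def add_divide_distrib[symmetric])
      also have "\<dots> \<le> 2 * (norm w)\<^sup>2 / p\<^sup>2"
        using p by (intro divide_left_mono) (auto simp: power2_eq_square mult_left_le_one_le)
      finally show "t 1 + t (-1) \<le> 2 * (norm w)\<^sup>2 / p\<^sup>2" .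
    qed (use t_sq p C in auto)
    also have "\<dots> = inverse (p ^ m) * (Q / p\<^sup>2) * (norm w)\<^sup>2"
      by (simp add: Q_def add_divide_distrib algebra_simps)
    finally show ?thesis using 1 by (simp add: p_def)
  qed
  moreover have "0 \<le> Q" using C by (simp add: Q_def)
  ultimately show ?thesis by blast
qed

text \<open>How small the ratio of the splitting radius to the weight must be: the condition with \<open>Q\<close>
  lets the mass of the far kernel absorb the near part, the one with \<open>K\<close> lets it absorb the
  right-hand side.\<close>
lemma absorption_radius:
  fixes s :: real
  assumes "0 < s" "0 < c" "0 < \<mu>"
  shows "\<exists>\<kappa>>0. \<kappa> \<le> 1/6 \<and> Q * \<kappa>\<^sup>2 * \<nu> \<le> \<mu> \<and> K * \<kappa> powr (2 * s) \<le> c * \<mu> / 4"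
proof -
  have "((\<lambda>\<kappa>::real. Q * \<kappa>\<^sup>2 * \<nu>) \<longlongrightarrow> Q * 0\<^sup>2 * \<nu>) (at_right 0)"
    by (intro tendsto_intros)
  then have 1: "eventually (\<lambda>\<kappa>. Q * \<kappa>\<^sup>2 * \<nu> < \<mu>) (at_right 0)"
    using assms by (intro order_tendstoD) auto
  have "((\<lambda>\<kappa>::real. \<kappa> powr (2 * s)) \<longlongrightarrow> 0) (at_right 0)"
    using assms by (intro tendsto_zero_powrI[where b = "2 * s"] tendsto_ident_at tendsto_const)
      (auto intro: eventually_mono[OF eventually_at_right_less])
  from tendsto_mult_left[OF this, of K]
  have 2: "eventually (\<lambda>\<kappa>. K * \<kappa> powr (2 * s) < c * \<mu> / 4) (at_right 0)"
    using assms by (intro order_tendstoD) auto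
  have 3: "eventually (\<lambda>\<kappa>::real. 0 < \<kappa> \<and> \<kappa> < 1/6) (at_right 0)"
    by (auto simp: eventually_at_right_field intro: exI[of _ "1/6"])
  from 1 2 3 have "eventually (\<lambda>\<kappa>. 0 < \<kappa> \<and> \<kappa> \<le> 1/6 \<and> Q * \<kappa>\<^sup>2 * \<nu> \<le> \<mu> \<and> K * \<kappa> powr (2 * s) \<le> c * \<mu> / 4)
      (at_right 0)"
    by eventually_elim auto
  from eventually_happens[OF this] show ?thesis by auto
qed

context mollified_solution
begin

lemma U_continuous: "continuous_on UNIV U"
  unfolding continuous_on_sequentially
proof (intro allI ballI impI, elim conjE)
  fix X :: "nat \<Rightarrow> real ^ 'n" and a assume X: "X \<longlonglongrightarrow> a"
  obtain B where B: "\<And>x. \<bar>\<rho> x\<bar> \<le> B" by (rule \<rho>_bounded) blast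
  have "(\<lambda>n. U (X n)) \<longlonglongrightarrow> U a"
    unfolding U_def
  proof (rule integral_dominated_convergence[where w = "\<lambda>z. norm (u z) * B"])
    show "AE z in lborel. (\<lambda>n. u z * \<rho> (X n - z)) \<longlonglongrightarrow> u z * \<rho> (a - z)"
    proof (intro AE_I2 tendsto_intros)
      fix z
      have "isCont \<rho> (a - z)" using \<rho>_continuous by (simp add: continuous_on_eq_continuous_at)
      then show "(\<lambda>n. \<rho> (X n - z)) \<longlonglongrightarrow> \<rho> (a - z)"
        by (rule isCont_tendsto_compose) (intro tendsto_intros X)
    qed
    show "AE z in lborel. norm (u z * \<rho> (X n - z)) \<le> norm (u z) * B" for n
      using B by (intro AE_I2) (simp add: abs_mult mult_left_mono del: \<rho>_nonneg)
  qed (use u_integrable in auto)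
  then show "(U \<circ> X) \<longlonglongrightarrow> U a" by (simp add: o_def)
qed

text \<open>The difference falls on the kernel, so the increment \<open>h\<close> is gained without any regularity of
  \<open>u\<close>.\<close>
lemma V_difference:
  assumes r: "0 < r"
  shows "\<bar>(LINT z|lborel. u z * V r (x + h - z)) - (LINT z|lborel. u z * V r (x - z))\<bar>
    \<le> (real CARD('n) + 2 * s) * r powr (- (real CARD('n) + 2 * s) - 1) * norm h
        * (LINT z|lborel. \<bar>u z\<bar>)"
proof -
  have i: "integrable lborel (\<lambda>z. u z * V r (x - z))" for x
    using V_bounded[OF r] by (intro integrable_u_mult) auto
  define L where "L = (real CARD('n) + 2 * s) * r powr (- (real CARD('n) + 2 * s) - 1) * norm h"
  have "\<bar>(LINT z|lborel. u z * V r (x + h - z)) - (LINT z|lborel. u z * V r (x - z))\<bar>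
      = \<bar>LINT z|lborel. u z * V r (x + h - z) - u z * V r (x - z)\<bar>"
    using i by simp
  also have "\<dots> \<le> (LINT z|lborel. \<bar>u z * V r (x + h - z) - u z * V r (x - z)\<bar>)"
    by (rule integral_abs_bound)
  also have "\<dots> \<le> (LINT z|lborel. L * \<bar>u z\<bar>)"
  proof (rule integral_mono)
    fix z
    have "\<bar>V r (x + h - z) - V r (x - z)\<bar> * \<bar>u z\<bar> \<le> L * \<bar>u z\<bar>"
      using V_Lipschitz[OF r, of "x + h - z" "x - z"] by (intro mult_right_mono) (auto simp: L_def)
    then show "\<bar>u z * V r (x + h - z) - u z * V r (x - z)\<bar> \<le> L * \<bar>u z\<bar>"
      by (simp add: right_diff_distrib[symmetric] abs_mult mult.commute)
  qed (use i u_integrable in auto)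
  finally show ?thesis by (simp add: L_def)
qed

text \<open>The maximum principle. Let \<open>M\<close> be the maximum of the weighted difference \<open>|W| * p ^ m\<close>,
  attained at \<open>x0\<close>. Then \<open>|W|\<close> lies below \<open>M\<close> times the barrier and touches it at \<open>x0\<close>, so second
  differences of \<open>W\<close> there are controlled by those of the barrier, and the equation at \<open>x0\<close> bounds
  \<open>M\<close>. The hypothesis on \<open>E\<close> will hold with a bound \<open>A\<close> for the weighted differences of \<open>u\<close>; the
  choice of \<open>\<kappa>\<close> lets \<open>A\<close> enter with the factor 1/2.\<close>
lemma weighted_difference_estimate:
  defines "m \<equiv> CARD('n) + 1"
  assumes R: "0 < R" "R \<le> 1"
    and dom: "\<And>x. x \<in> ball a R \<Longrightarrow> cball x \<epsilon> \<subseteq> ball 0 1 \<and> cball (x + h) \<epsilon> \<subseteq> ball 0 1"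
    and A: "0 \<le> A" and K: "0 \<le> K"
    and E: "\<And>x. x \<in> ball a R \<Longrightarrow> \<bar>E (x + h) - E x\<bar> \<le> K * A * inverse (ball_weight R a x ^ m)"
    and Q0: "0 \<le> Q" and Q: "\<And>x w. x \<in> ball a R \<Longrightarrow> norm w \<le> ball_weight R a x / 6 \<Longrightarrow>
     x + w \<in> ball a R \<and>
     inverse (ball_weight R a (x + w) ^ m) + inverse (ball_weight R a (x - w) ^ m)
         - 2 * inverse (ball_weight R a x ^ m)
       \<le> inverse (ball_weight R a x ^ m) * (Q / (ball_weight R a x)\<^sup>2) * (norm w)\<^sup>2"
    and \<kappa>: "0 < \<kappa>" "\<kappa> \<le> 1/6" "Q * \<kappa>\<^sup>2 * near_moment TYPE(real ^ 'n) s \<le> far_mass TYPE(real ^ 'n) s"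
      "K * \<kappa> powr (2 * s) \<le> frac_lap_const CARD('n) s * far_mass TYPE(real ^ 'n) s / 4"
    and x: "x \<in> ball a R"
  shows "\<bar>U (x + h) - U x\<bar> * ball_weight R a x ^ m
    \<le> A / 2 + 2 / far_mass TYPE(real ^ 'n) s * (real CARD('n) + 2 * s) * inverse (\<kappa> ^ m) * norm h
        * (LINT z|lborel. \<bar>u z\<bar>)"
proof -
  define W where "W x = U (x + h) - U x" for x
  define \<Phi> where "\<Phi> x = \<bar>W x\<bar> * ball_weight R a x ^ m" for x
  define c where "c = frac_lap_const CARD('n) s"
  define \<mu> where "\<mu> = far_mass TYPE(real ^ 'n) s"
  define \<nu> where "\<nu> = near_moment TYPE(real ^ 'n) s"
  define I where "I = (LINT z|lborel. \<bar>u z\<bar>)"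
  define e where "e = real CARD('n) + 2 * s"
  have c: "0 < c" using frac_lap_const_pos[OF s] by (simp add: c_def)
  have \<mu>: "0 < \<mu>" using far_mass_pos[OF s(1)] by (simp add: \<mu>_def)
  have e: "0 < e" using s by (simp add: e_def)
  have I: "0 \<le> I" by (simp add: I_def)
  have "continuous_on UNIV W"
    unfolding W_def by (intro continuous_intros continuous_on_compose2[OF U_continuous]) auto
  then have "continuous_on (cball a R) \<Phi>"
    unfolding \<Phi>_def ball_weight_def by (intro continuous_intros) (auto intro: continuous_on_subset)
  moreover have "compact (cball a R)" "cball a R \<noteq> {}" using R by auto
  ultimately obtain x0 where x0: "x0 \<in> cball a R" "\<And>y. y \<in> cball a R \<Longrightarrow> \<Phi> y \<le> \<Phi> x0"
    using continuous_attains_sup[of "cball a R" \<Phi>] by blast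
  define M where "M = \<Phi> x0"
  have target: "M \<le> A / 2 + 2 / \<mu> * e * inverse (\<kappa> ^ m) * norm h * I" (is "M \<le> ?T")
  proof (cases "M \<le> 0")
    case True
    have "0 \<le> ?T" using A \<mu> e I \<kappa> by (intro add_nonneg_nonneg mult_nonneg_nonneg) auto
    with True show ?thesis by linarith
  next
    case False
    then have M: "0 < M" by simp
    define p where "p = ball_weight R a x0"
    have "x0 \<in> ball a R"
    proof (rule ccontr)
      assume "x0 \<notin> ball a R"
      with x0 have "dist a x0 = R" by auto
      then have "ball_weight R a x0 = 0" by (simp add: ball_weight_def dist_norm norm_minus_commute)
      then have "M = 0" by (simp add: M_def \<Phi>_def m_def)
      with M show False by simp
    qed
    note x0b = this
    have p: "0 < p" "p \<le> 1" using ball_weight_pos[OF x0b] ball_weight_le_1[of R a x0] R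
        by (auto simp: p_def)
    define ip where "ip = inverse (p ^ m)"
    have ip: "0 < ip" using p by (simp add: ip_def)
    have W_le: "\<bar>W y\<bar> \<le> M * inverse (ball_weight R a y ^ m)" if "y \<in> ball a R" for y
    proof -
      have "\<bar>W y\<bar> * ball_weight R a y ^ m \<le> M" using x0(2)[of y] that by (simp add: M_def \<Phi>_def)
      then show ?thesis using ball_weight_pos[OF that] by (simp add: field_simps)
    qed
    have W0: "\<bar>W x0\<bar> = M * ip" using p by (simp add: M_def \<Phi>_def ip_def p_def)
    \<comment> \<open>Multiplying by the sign of \<open>W x0\<close> reduces to a positive maximum.\<close>
    define \<sigma> where "\<sigma> = sgn (W x0)"
    have "W x0 \<noteq> 0" using W0 M ip by auto
    then have \<sigma>: "\<sigma> * W x0 = M * ip" "\<bar>\<sigma>\<bar> = 1"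
      using W0 by (auto simp: \<sigma>_def sgn_if abs_if split: if_splits)
    have \<sigma>_le: "\<sigma> * t \<le> \<bar>t\<bar>" for t
      using abs_ge_self[of "\<sigma> * t"] \<sigma>(2) by (simp add: abs_mult)
    define r where "r = \<kappa> * p"
    have r: "0 < r" using \<kappa> p by (simp add: r_def)
    have r6: "norm w < r \<Longrightarrow> norm w \<le> p / 6" for w :: "real ^ 'n"
      using \<kappa>(2) p mult_right_mono[of \<kappa> "1/6" p] unfolding r_def by linarith
    define D where "D w = \<sigma> * second_diff W x0 w" for w
    have D_eq: "D w = \<sigma> * second_diff U (x0 + h) w - \<sigma> * second_diff U x0 w" for w
      by (simp add: D_def second_diff_def W_def algebra_simps)
    have D_le: "D w \<le> (M * ip * (Q / p\<^sup>2)) * (norm w)\<^sup>2" if w: "norm w < r" for w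
    proof -
      have q: "x0 + w \<in> ball a R" "x0 - w \<in> ball a R"
        "inverse (ball_weight R a (x0 + w) ^ m) + inverse (ball_weight R a (x0 - w) ^ m) - 2 * ip
            \<le> ip * (Q / p\<^sup>2) * (norm w)\<^sup>2"
        using Q[OF x0b, of w] Q[OF x0b, of "- w"] r6[OF w] by (auto simp: p_def ip_def)
      have "D w = \<sigma> * W (x0 + w) + \<sigma> * W (x0 - w) - 2 * (\<sigma> * W x0)"
        by (simp add: D_def second_diff_def algebra_simps)
      also have "\<dots> \<le> M * inverse (ball_weight R a (x0 + w) ^ m)
          + M * inverse (ball_weight R a (x0 - w) ^ m) - 2 * (M * ip)"
        using \<sigma>_le[of "W (x0 + w)"] \<sigma>_le[of "W (x0 - w)"] W_le[OF q(1)] W_le[OF q(2)] \<sigma>(1) by linarith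
      also have "\<dots> = M * (inverse (ball_weight R a (x0 + w) ^ m)
          + inverse (ball_weight R a (x0 - w) ^ m) - 2 * ip)"
        by (simp add: algebra_simps)
      also have "\<dots> \<le> M * (ip * (Q / p\<^sup>2) * (norm w)\<^sup>2)"
        using q(3) M by (intro mult_left_mono) auto
      finally show ?thesis by (simp add: mult_ac)
    qed
    note nc = near_convolution(2)[OF r]
    have nD_int: "integrable lborel (\<lambda>w. near_kernel s r w * D w)"
    proof -
      have "integrable lborel (\<lambda>w. \<sigma> * (near_kernel s r w * second_diff U (x0 + h) w)
          - \<sigma> * (near_kernel s r w * second_diff U x0 w))"
        using nc by (intro Bochner_Integration.integrable_diff integrable_mult_right)
      then show ?thesis by (simp add: D_eq algebra_simps)
    qed
    have nD_eq: "(LINT w|lborel. near_kernel s r w * D w)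
        = \<sigma> * (LINT w|lborel. near_kernel s r w * second_diff U (x0 + h) w)
        - \<sigma> * (LINT w|lborel. near_kernel s r w * second_diff U x0 w)"
    proof -
      have "(LINT w|lborel. near_kernel s r w * D w)
          = (LINT w|lborel. \<sigma> * (near_kernel s r w * second_diff U (x0 + h) w)
          - \<sigma> * (near_kernel s r w * second_diff U x0 w))"
        by (simp add: D_eq algebra_simps)
      then show ?thesis using nc by simp
    qed
    define ND where "ND = (LINT w|lborel. near_kernel s r w * D w)"
    have r2: "r powr (2 - 2 * s) = \<kappa>\<^sup>2 * p\<^sup>2 * r powr (- 2 * s)"
    proof -
      have "r powr (2 - 2 * s) = r powr 2 * r powr (- 2 * s)" by (simp add: powr_add[symmetric])
      then show ?thesis using r by (simp add: r_def power_mult_distrib)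
    qed
    have "ND \<le> (M * ip * (Q / p\<^sup>2)) * r powr (2 - 2 * s) * \<nu>"
      unfolding ND_def \<nu>_def using s r nD_int D_le M ip Q0
          by (intro integral_near_kernel_mult_le) (auto simp: D_def)
    also have "\<dots> = (M * ip * r powr (- 2 * s)) * (Q * \<kappa>\<^sup>2 * \<nu>)"
      using p by (simp add: r2)
    also have "\<dots> \<le> (M * ip * r powr (- 2 * s)) * \<mu>"
      using \<kappa>(3) M ip by (intro mult_left_mono) (auto simp: \<mu>_def \<nu>_def)
    finally have ND: "ND \<le> M * ip * r powr (- 2 * s) * \<mu>" .
    define T where "T x = (LINT z|lborel. u z * V r (x - z))" for x
    have Td: "\<bar>T (x0 + h) - T x0\<bar> \<le> e * r powr (- e - 1) * norm h * I"
      using V_difference[OF r, of x0 h] by (simp add: T_def e_def I_def)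
    note eqs = mollified_equation(2)[OF conjunct1[OF dom[OF x0b]] r]
        mollified_equation(2)[OF conjunct2[OF dom[OF x0b]] r]
    have "\<sigma> * (E (x0 + h) - E x0) = c
        * (- (1/2) * ND + r powr (- 2 * s) * \<mu> * (\<sigma> * W x0) - \<sigma> * (T (x0 + h) - T x0))"
      unfolding eqs ND_def nD_eq c_def \<mu>_def T_def W_def by (simp add: algebra_simps)
    moreover have "\<sigma> * (E (x0 + h) - E x0) \<le> K * A * ip"
      using \<sigma>_le[of "E (x0 + h) - E x0"] E[OF x0b] by (simp add: ip_def p_def)
    moreover have "c * (1/2 * (M * ip * r powr (- 2 * s) * \<mu>) - e * r powr (- e - 1) * norm h * I)
        \<le> c * (- (1/2) * ND + r powr (- 2 * s) * \<mu> * (\<sigma> * W x0) - \<sigma> * (T (x0 + h) - T x0))"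
    proof (rule mult_left_mono)
      have "r powr (- 2 * s) * \<mu> * (\<sigma> * W x0) = M * ip * r powr (- 2 * s) * \<mu>" by (simp add: \<sigma>(1))
      moreover have "\<sigma> * (T (x0 + h) - T x0) \<le> e * r powr (- e - 1) * norm h * I"
        using \<sigma>_le[of "T (x0 + h) - T x0"] Td by linarith
      ultimately show "1/2 * (M * ip * r powr (- 2 * s) * \<mu>) - e * r powr (- e - 1) * norm h * I
         \<le> - (1/2) * ND + r powr (- 2 * s) * \<mu> * (\<sigma> * W x0) - \<sigma> * (T (x0 + h) - T x0)"
        using ND by linarith
    qed (use c in simp)
    ultimately have main: "c * (1/2 * (M * ip * r powr (- 2 * s) * \<mu>)
        - e * r powr (- e - 1) * norm h * I) \<le> K * A * ip"
      by linarith
    \<comment> \<open>The factor that normalises the coefficient of \<open>M\<close> to 1. The powers of \<open>p\<close> in the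
      term with \<open>h\<close> cancel precisely because \<open>m = n + 1\<close>.\<close>
    define q where "q = 2 / (c * \<mu>) * (r powr (2 * s) * p ^ m)"
    have q: "0 \<le> q" using c \<mu> p by (simp add: q_def)
    have ipp: "ip * p ^ m = 1" using p by (simp add: ip_def)
    have rr: "r powr (- 2 * s) * r powr (2 * s) = 1" using r by (simp add: powr_add[symmetric])
    have rp: "r powr (- e - 1) * (r powr (2 * s) * p ^ m) = inverse (\<kappa> ^ m)"
    proof -
      have "r powr (- e - 1) * r powr (2 * s) = r powr (- real m)"
        by (simp add: powr_add[symmetric] e_def m_def algebra_simps)
      also have "\<dots> = inverse (r ^ m)" using r by (simp add: powr_minus powr_realpow)
      also have "\<dots> = inverse (\<kappa> ^ m) * ip" by (simp add: r_def power_mult_distrib ip_def)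
      finally show ?thesis using ipp by (simp add: mult.assoc[symmetric])
    qed
    have "q * (c * (1/2 * (M * ip * r powr (- 2 * s) * \<mu>) - e * r powr (- e - 1) * norm h * I))
        \<le> q * (K * A * ip)"
      using main q by (rule mult_left_mono)
    moreover have "q * (c * (1/2 * (M * ip * r powr (- 2 * s) * \<mu>) - e * r powr (- e - 1) * norm h * I))
       = M * (ip * p ^ m) * (r powr (- 2 * s) * r powr (2 * s))
           - 2 / \<mu> * e * (r powr (- e - 1) * (r powr (2 * s) * p ^ m)) * norm h * I"
      using c \<mu> by (simp add: q_def field_simps)
    moreover have "q * (K * A * ip) = (ip * p ^ m) * (K * r powr (2 * s)) * (2 / (c * \<mu>)) * A"
      by (simp add: q_def)
    ultimately have "M \<le> (K * r powr (2 * s)) * (2 / (c * \<mu>)) * A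
        + 2 / \<mu> * e * inverse (\<kappa> ^ m) * norm h * I"
      by (simp only: ipp rr rp)
    also have "(K * r powr (2 * s)) * (2 / (c * \<mu>)) * A \<le> (c * \<mu> / 4) * (2 / (c * \<mu>)) * A"
    proof -
      have "r \<le> \<kappa>" using \<kappa> p by (simp add: r_def mult_left_le)
      then have "r powr (2 * s) \<le> \<kappa> powr (2 * s)" using r s by (intro powr_mono2) auto
      then have "K * r powr (2 * s) \<le> K * \<kappa> powr (2 * s)" using K by (rule mult_left_mono)
      then have "K * r powr (2 * s) \<le> c * \<mu> / 4" using \<kappa>(4) by (simp add: c_def \<mu>_def)
      then show ?thesis using A c \<mu> by (intro mult_right_mono) auto
    qed
    also have "(c * \<mu> / 4) * (2 / (c * \<mu>)) * A = A / 2" using c \<mu> by simp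
    finally show ?thesis by simp
  qed
  have "\<Phi> x \<le> M" using x0(2)[of x] x by (simp add: M_def)
  with target show ?thesis by (simp add: \<Phi>_def W_def \<mu>_def e_def I_def)
qed

lemma U_approximates:
  assumes "\<And>z. dist z x < \<epsilon> \<Longrightarrow> \<bar>u z - u x\<bar> \<le> \<delta>"
  shows "\<bar>U x - u x\<bar> \<le> \<delta>"
proof -
  have i: "integrable lborel (\<lambda>z. \<rho> (x - z))" "(LINT z|lborel. \<rho> (x - z)) = 1"
    using lborel_integrable_reflect[OF \<rho>_integrable] lborel_integral_reflect[of \<rho> x] \<rho>_integral by auto
  have "U x - u x = (LINT z|lborel. u z * \<rho> (x - z) - u x * \<rho> (x - z))"
    using i integrable_u_\<rho>[of x] by (simp add: U_def)
  also have "\<bar>\<dots>\<bar> \<le> (LINT z|lborel. \<bar>u z * \<rho> (x - z) - u x * \<rho> (x - z)\<bar>)"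
    by (rule integral_abs_bound)
  also have "\<dots> \<le> (LINT z|lborel. \<delta> * \<rho> (x - z))"
  proof (rule integral_mono)
    fix z
    have "\<bar>u z - u x\<bar> * \<rho> (x - z) \<le> \<delta> * \<rho> (x - z)"
    proof (cases "dist z x < \<epsilon>")
      case True then show ?thesis by (intro mult_right_mono assms) auto
    next
      case False then show ?thesis by (simp add: \<rho>_eq_0 dist_norm norm_minus_commute)
    qed
    then show "\<bar>u z * \<rho> (x - z) - u x * \<rho> (x - z)\<bar> \<le> \<delta> * \<rho> (x - z)"
      by (simp add: left_diff_distrib[symmetric] abs_mult)
  qed (use i integrable_u_\<rho>[of x] in auto)
  finally show ?thesis using i by simp
qed

lemma E_difference:
  assumes x: "cball x \<epsilon> \<subseteq> ball 0 1" "cball (x + h) \<epsilon> \<subseteq> ball 0 1"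
    and B: "AE w in lborel. norm w < \<epsilon> \<longrightarrow> \<bar>f (u (x + h - w)) - f (u (x - w))\<bar> \<le> B"
  shows "\<bar>E (x + h) - E x\<bar> \<le> B"
proof -
  have E_eq: "E y = (LINT w|lborel. f (u (y - w)) * \<rho> w)" for y
    unfolding E_def by (subst lborel_integral_reflect[of _ y]) simp
  have i: "integrable lborel (\<lambda>w. f (u (y - w)) * \<rho> w)" if "cball y \<epsilon> \<subseteq> ball 0 1" for y
    using lborel_integrable_reflect[OF mollified_equation(1)[OF that zero_less_one], of y] by simp
  have "E (x + h) - E x = (LINT w|lborel. f (u (x + h - w)) * \<rho> w - f (u (x - w)) * \<rho> w)"
    unfolding E_eq using i[OF x(1)] i[OF x(2)] by simp
  also have "\<bar>\<dots>\<bar> \<le> (LINT w|lborel. \<bar>f (u (x + h - w)) * \<rho> w - f (u (x - w)) * \<rho> w\<bar>)"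
    by (rule integral_abs_bound)
  also have "\<dots> \<le> (LINT w|lborel. B * \<rho> w)"
  proof (rule integral_mono_AE)
    show "AE w in lborel. \<bar>f (u (x + h - w)) * \<rho> w - f (u (x - w)) * \<rho> w\<bar> \<le> B * \<rho> w"
      using B
    proof eventually_elim
      case (elim w)
      have "\<bar>f (u (x + h - w)) - f (u (x - w))\<bar> * \<rho> w \<le> B * \<rho> w"
      proof (cases "norm w < \<epsilon>")
        case True with elim show ?thesis by (intro mult_right_mono) auto
      qed (simp add: \<rho>_eq_0)
      then show ?case by (simp add: left_diff_distrib[symmetric] abs_mult)
    qed
  qed (use i[OF x(1)] i[OF x(2)] \<rho>_integrable in auto)
  finally show ?thesis using \<rho>_integral by simp
qed

end

text \<open>Mollifying at radius \<open>\<epsilon>\<close> in the ball of radius \<open>R - \<epsilon>\<close> only uses values of \<open>u\<close> in the ball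
  of radius \<open>R\<close>, and the weight there is not smaller. So a weighted bound for \<open>u\<close> passes to its
  mollification without loss.\<close>
lemma ball_weight_shrink:
  assumes "norm w \<le> \<epsilon>" "\<epsilon> \<le> R" "x \<in> ball a (R - \<epsilon>)"
  shows "ball_weight (R - \<epsilon>) a x \<le> ball_weight R a (x - w)"
proof -
  have 0: "0 \<le> \<epsilon>" using assms(1) norm_ge_zero[of w] by linarith
  have 1: "norm (x - w - a) \<le> norm (x - a) + \<epsilon>"
    using norm_triangle_ineq4[of "x - a" w] assms(1) by (simp add: algebra_simps)
  have 2: "norm (x - a) < R - \<epsilon>" using assms(3) by (simp add: dist_norm norm_minus_commute)
  have "(norm (x - w - a))\<^sup>2 \<le> (norm (x - a) + \<epsilon>)\<^sup>2" using 1 by (intro power_mono) auto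
  moreover have "0 \<le> 2 * \<epsilon> * (R - \<epsilon> - norm (x - a))" using 0 2 by simp
  ultimately show ?thesis
    unfolding ball_weight_def by (simp add: power2_eq_square algebra_simps)
qed

text \<open>A bound \<open>A\<close> for the weighted differences of \<open>u\<close> improves to \<open>A / 2 + C |h|\<close>: apply the
  maximum principle to the mollifications and let the radius tend to 0. Only points of continuity
  are considered, because there the mollifications converge; the right-hand side is an integral,
  for which almost every point suffices.\<close>
lemma difference_improvement:
  fixes s K :: real
  assumes s: "0 < s" "s < 1" and K: "0 \<le> K"
  obtains D where "0 \<le> D"
    "\<And>f (u :: real ^ 'n \<Rightarrow> real) a h R A x. \<lbrakk>
      weak_solution s f u; u \<in> borel_measurable borel; AE x in lborel. isCont u x;
      0 < R; R \<le> 1; ball a (2 * R) \<subseteq> ball 0 1; norm h \<le> R; 0 \<le> A;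
      \<And>x y. x \<in> ball a (2 * R) \<Longrightarrow> y \<in> ball a (2 * R) \<Longrightarrow> \<bar>f (u x) - f (u y)\<bar> \<le> K * \<bar>u x - u y\<bar>;
      \<And>x. x \<in> ball a R \<Longrightarrow> isCont u x \<Longrightarrow> isCont u (x + h) \<Longrightarrow>
        \<bar>u (x + h) - u x\<bar> * ball_weight R a x ^ (CARD('n) + 1) \<le> A;
      x \<in> ball a R; isCont u x; isCont u (x + h)\<rbrakk> \<Longrightarrow>
      \<bar>u (x + h) - u x\<bar> * ball_weight R a x ^ (CARD('n) + 1)
          \<le> A / 2 + D * norm h * (LINT z|lborel. \<bar>u z\<bar>)"
proof -
  let ?m = "CARD('n) + 1"
  obtain Q where Q: "0 \<le> Q" "\<And>R (a::real ^ 'n) x w. 0 < R \<Longrightarrow> R \<le> 1 \<Longrightarrow> x \<in> ball a R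
      \<Longrightarrow> norm w \<le> ball_weight R a x / 6 \<Longrightarrow>
     x + w \<in> ball a R \<and>
     inverse (ball_weight R a (x + w) ^ ?m) + inverse (ball_weight R a (x - w) ^ ?m)
         - 2 * inverse (ball_weight R a x ^ ?m)
       \<le> inverse (ball_weight R a x ^ ?m) * (Q / (ball_weight R a x)\<^sup>2) * (norm w)\<^sup>2"
    using barrier_second_diff[where m = ?m and 'a = "real ^ 'n"] by metis
  obtain \<kappa> where \<kappa>: "0 < \<kappa>" "\<kappa> \<le> 1/6" "Q * \<kappa>\<^sup>2 * near_moment TYPE(real ^ 'n) s
      \<le> far_mass TYPE(real ^ 'n) s"
      "K * \<kappa> powr (2 * s) \<le> frac_lap_const CARD('n) s * far_mass TYPE(real ^ 'n) s / 4"
    using absorption_radius[OF s(1) frac_lap_const_pos[OF s] far_mass_pos[OF s(1)]] by metis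
  define D where "D = 2 / far_mass TYPE(real ^ 'n) s * (real CARD('n) + 2 * s) * inverse (\<kappa> ^ ?m)"
  have D: "0 \<le> D" using far_mass_pos[OF s(1), where 'a = "real ^ 'n"] s \<kappa> by (simp add: D_def)
  have improve: "\<bar>u (x + h) - u x\<bar> * ball_weight R a x ^ ?m
      \<le> A / 2 + D * norm h * (LINT z|lborel. \<bar>u z\<bar>)"
    if weak: "weak_solution s f u" and um: "u \<in> borel_measurable borel"
        and cont: "AE x in lborel. isCont u x"
    and R: "0 < R" "R \<le> 1" and sub: "ball a (2 * R) \<subseteq> ball 0 1" and h: "norm h \<le> R" and A: "0 \<le> A"
    and Lip: "\<And>x y. x \<in> ball a (2 * R) \<Longrightarrow> y \<in> ball a (2 * R) \<Longrightarrow> \<bar>f (u x) - f (u y)\<bar> \<le> K * \<bar>u x - u y\<bar>"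
    and prev: "\<And>x. x \<in> ball a R \<Longrightarrow> isCont u x \<Longrightarrow> isCont u (x + h)
        \<Longrightarrow> \<bar>u (x + h) - u x\<bar> * ball_weight R a x ^ ?m \<le> A"
    and x: "x \<in> ball a R" "isCont u x" "isCont u (x + h)"
    for f and u :: "real ^ 'n \<Rightarrow> real" and a h R A x
  proof -
    let ?T = "A / 2 + D * norm h * (LINT z|lborel. \<bar>u z\<bar>)"
    define \<rho> where "\<rho> \<epsilon> = (SOME \<rho> :: real ^ 'n \<Rightarrow> real. mollifier \<epsilon> \<rho>)" for \<epsilon>
    have \<rho>: "mollifier \<epsilon> (\<rho> \<epsilon>)" if "0 < \<epsilon>" for \<epsilon>
      unfolding \<rho>_def using mollifier_exists[OF that] by (rule someI_ex)
    have loc: "mollified_solution s f u \<epsilon> (\<rho> \<epsilon>)" if "0 < \<epsilon>" for \<epsilon>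
      using s weak um \<rho>[OF that] by unfold_locales
    define Um where "Um \<epsilon> y = mollified_solution.U u (\<rho> \<epsilon>) y" for \<epsilon> y
    have est: "\<bar>Um \<epsilon> (x + h) - Um \<epsilon> x\<bar> * ball_weight (R - \<epsilon>) a x ^ ?m \<le> ?T"
      if \<epsilon>: "0 < \<epsilon>" "\<epsilon> < R - dist a x" for \<epsilon>
    proof -
      interpret mollified_solution s f u \<epsilon> "\<rho> \<epsilon>" by (rule loc[OF \<epsilon>(1)])
      have R': "0 < R - \<epsilon>" "R - \<epsilon> \<le> 1" using \<epsilon> R zero_le_dist[of a x] by linarith+
      have in2: "cball y \<epsilon> \<subseteq> ball a (2 * R)" "cball (y + h) \<epsilon> \<subseteq> ball a (2 * R)"
          if y: "y \<in> ball a (R - \<epsilon>)" for y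
      proof -
        have ya: "norm (y - a) < R - \<epsilon>" using y by (simp add: dist_norm norm_minus_commute)
        have "norm (z - a) < 2 * R" if "norm (y - z) \<le> \<epsilon>" for z
          using ya that norm_triangle_ineq4[of "y - a" "y - z"] R by simp
        then show "cball y \<epsilon> \<subseteq> ball a (2 * R)" by (auto simp: dist_norm norm_minus_commute)
        have "norm (z - a) < 2 * R" if z: "norm (y + h - z) \<le> \<epsilon>" for z
        proof -
          have "norm (z - a) = norm ((y - a) + h - (y + h - z))" by simp
          also have "\<dots> \<le> norm (y - a) + norm h + norm (y + h - z)"
            by (meson norm_triangle_ineq norm_triangle_ineq4 add_right_mono order_trans)
          finally show ?thesis using ya z h by linarith
        qed
        then show "cball (y + h) \<epsilon> \<subseteq> ball a (2 * R)" by (auto simp: dist_norm norm_minus_commute)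
      qed
      have "\<bar>mollified_solution.U u (\<rho> \<epsilon>) (x + h)
          - mollified_solution.U u (\<rho> \<epsilon>) x\<bar> * ball_weight (R - \<epsilon>) a x ^ ?m
        \<le> A / 2 + 2 / far_mass TYPE(real ^ 'n) s * (real CARD('n) + 2 * s) * inverse (\<kappa> ^ ?m) * norm h
            * (LINT z|lborel. \<bar>u z\<bar>)"
      proof (rule weighted_difference_estimate[OF R' _ A K _ Q(1) Q(2)[OF R'] \<kappa>])
        fix y assume y: "y \<in> ball a (R - \<epsilon>)"
        show dom: "cball y \<epsilon> \<subseteq> ball 0 1 \<and> cball (y + h) \<epsilon> \<subseteq> ball 0 1" using in2[OF y] sub by blast
        have wpos: "0 < ball_weight (R - \<epsilon>) a y" using ball_weight_pos[OF y] .
        show "\<bar>E (y + h) - E y\<bar> \<le> K * A * inverse (ball_weight (R - \<epsilon>) a y ^ ?m)"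
        proof (rule E_difference)
          show "AE w in lborel. norm w < \<epsilon> \<longrightarrow>
            \<bar>f (u (y + h - w)) - f (u (y - w))\<bar> \<le> K * A * inverse (ball_weight (R - \<epsilon>) a y ^ ?m)"
            using AE_lborel_reflect[OF cont, of y] AE_lborel_reflect[OF cont, of "y + h"]
          proof eventually_elim
            case (elim w)
            show ?case
            proof
              assume w: "norm w < \<epsilon>"
              have m1: "y - w \<in> ball a (2 * R)" "y + h - w \<in> ball a (2 * R)"
                using in2[OF y] w by (auto simp: subset_eq dist_norm)
              have yh: "y - w + h = y + h - w" by simp
              have ya: "norm (y - a) < R - \<epsilon>" using y by (simp add: dist_norm norm_minus_commute)
              have "norm (y - w - a) < R"
                using ya w norm_triangle_ineq4[of "y - a" w] by (simp add: algebra_simps)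
              then have m2: "y - w \<in> ball a R" by (simp add: dist_norm norm_minus_commute)
              have wle: "ball_weight (R - \<epsilon>) a y \<le> ball_weight R a (y - w)"
                using w R' y by (intro ball_weight_shrink) auto
              have "\<bar>u (y + h - w) - u (y - w)\<bar> * ball_weight (R - \<epsilon>) a y ^ ?m
                  \<le> \<bar>u (y + h - w) - u (y - w)\<bar> * ball_weight R a (y - w) ^ ?m"
                using wle wpos by (intro mult_left_mono power_mono) auto
              also have "\<dots> \<le> A" using prev[OF m2] elim by (simp add: yh)
              finally have "\<bar>u (y + h - w) - u (y - w)\<bar> \<le> A * inverse (ball_weight (R - \<epsilon>) a y ^ ?m)"
                using wpos by (simp add: field_simps)
              then have "K * \<bar>u (y + h - w) - u (y - w)\<bar>
                  \<le> K * (A * inverse (ball_weight (R - \<epsilon>) a y ^ ?m))"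
                using K by (rule mult_left_mono)
              then show "\<bar>f (u (y + h - w)) - f (u (y - w))\<bar>
                  \<le> K * A * inverse (ball_weight (R - \<epsilon>) a y ^ ?m)"
                using Lip[OF m1(2) m1(1)] by (simp add: mult.assoc)
            qed
          qed
        qed (use dom in auto)
      next
        show "x \<in> ball a (R - \<epsilon>)" using \<epsilon> by simp
      qed
      then show ?thesis by (simp add: Um_def D_def)
    qed
    have lim: "((\<lambda>\<epsilon>. Um \<epsilon> y) \<longlongrightarrow> u y) (at_right 0)" if y: "isCont u y" for y
    proof (rule tendstoI)
      fix \<delta> :: real assume "0 < \<delta>"
      then obtain d where d: "0 < d" "\<And>z. dist z y < d \<Longrightarrow> \<bar>u z - u y\<bar> < \<delta> / 2"
        using y unfolding continuous_at_eps_delta dist_real_def by (meson half_gt_zero)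
      show "eventually (\<lambda>\<epsilon>. dist (Um \<epsilon> y) (u y) < \<delta>) (at_right 0)"
        unfolding eventually_at_right_field
      proof (intro exI[of _ d] conjI allI impI d)
        fix \<epsilon> :: real assume \<epsilon>: "0 < \<epsilon>" "\<epsilon> < d"
        interpret mollified_solution s f u \<epsilon> "\<rho> \<epsilon>" by (rule loc[OF \<epsilon>(1)])
        have "\<bar>Um \<epsilon> y - u y\<bar> \<le> \<delta> / 2"
          unfolding Um_def by (rule U_approximates) (use d \<epsilon> in \<open>auto intro: less_imp_le\<close>)
        then show "dist (Um \<epsilon> y) (u y) < \<delta>" using \<open>0 < \<delta>\<close> by (simp add: dist_real_def)
      qed
    qed
    have "((\<lambda>\<epsilon>. \<bar>Um \<epsilon> (x + h) - Um \<epsilon> x\<bar> * ball_weight (R - \<epsilon>) a x ^ ?m)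
      \<longlongrightarrow> \<bar>u (x + h) - u x\<bar> * ball_weight (R - 0) a x ^ ?m) (at_right 0)"
      unfolding ball_weight_def by (intro tendsto_intros lim x)
    moreover have "eventually (\<lambda>\<epsilon>. \<bar>Um \<epsilon> (x + h) - Um \<epsilon> x\<bar> * ball_weight (R - \<epsilon>) a x ^ ?m \<le> ?T)
        (at_right 0)"
      unfolding eventually_at_right_field using x(1) est by (intro exI[of _ "R - dist a x"]) auto
    ultimately show ?thesis
      using tendsto_upperbound[OF _ _ trivial_limit_at_right_real] by fastforce
  qed
  show thesis by (rule that[OF D improve])
qed

text \<open>The supremum \<open>S\<close> of the weighted differences satisfies \<open>S \<le> S / 2 + C |h|\<close>, so \<open>S \<le> 2 C
  |h|\<close>. The last step needs \<open>S\<close> to be finite, which is where the bound \<open>M\<close> for \<open>u\<close> enters.\<close>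
lemma interior_Lipschitz:
  fixes s K R :: real
  assumes s: "0 < s" "s < 1" and K: "0 \<le> K" and R: "0 < R" "R \<le> 1"
  obtains L where "0 \<le> L"
    "\<And>f (u :: real ^ 'n \<Rightarrow> real) a h M. \<lbrakk>
      weak_solution s f u; u \<in> borel_measurable borel; AE x in lborel. isCont u x;
      ball a (2 * R) \<subseteq> ball 0 1; norm h \<le> R;
      \<And>x. x \<in> ball a (2 * R) \<Longrightarrow> \<bar>u x\<bar> \<le> M;
      \<And>x y. x \<in> ball a (2 * R) \<Longrightarrow> y \<in> ball a (2 * R) \<Longrightarrow> \<bar>f (u x) - f (u y)\<bar> \<le> K * \<bar>u x - u y\<bar>;
      isCont u a; isCont u (a + h)\<rbrakk> \<Longrightarrow>
      \<bar>u (a + h) - u a\<bar> \<le> L * (LINT z|lborel. \<bar>u z\<bar>) * norm h"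
proof -
  let ?m = "CARD('n) + 1"
  obtain D where D: "0 \<le> D" and imp: "\<And>f (u :: real ^ 'n \<Rightarrow> real) a h R A x. \<lbrakk>
      weak_solution s f u; u \<in> borel_measurable borel; AE x in lborel. isCont u x;
      0 < R; R \<le> 1; ball a (2 * R) \<subseteq> ball 0 1; norm h \<le> R; 0 \<le> A;
      \<And>x y. x \<in> ball a (2 * R) \<Longrightarrow> y \<in> ball a (2 * R) \<Longrightarrow> \<bar>f (u x) - f (u y)\<bar> \<le> K * \<bar>u x - u y\<bar>;
      \<And>x. x \<in> ball a R \<Longrightarrow> isCont u x \<Longrightarrow> isCont u (x + h) \<Longrightarrow>
        \<bar>u (x + h) - u x\<bar> * ball_weight R a x ^ ?m \<le> A;
      x \<in> ball a R; isCont u x; isCont u (x + h)\<rbrakk> \<Longrightarrow>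
      \<bar>u (x + h) - u x\<bar> * ball_weight R a x ^ ?m \<le> A / 2 + D * norm h * (LINT z|lborel. \<bar>u z\<bar>)"
    by (rule difference_improvement[OF s K, where 'n = 'n]) blast
  have Lipschitz: "\<bar>u (a + h) - u a\<bar> \<le> (2 * D * inverse ((R\<^sup>2) ^ ?m)) * (LINT z|lborel. \<bar>u z\<bar>) * norm h"
    if weak: "weak_solution s f u" "u \<in> borel_measurable borel" "AE x in lborel. isCont u x"
    "ball a (2 * R) \<subseteq> ball 0 1" "norm h \<le> R"
    and M: "\<And>x. x \<in> ball a (2 * R) \<Longrightarrow> \<bar>u x\<bar> \<le> M"
    and Lip: "\<And>x y. x \<in> ball a (2 * R) \<Longrightarrow> y \<in> ball a (2 * R) \<Longrightarrow> \<bar>f (u x) - f (u y)\<bar> \<le> K * \<bar>u x - u y\<bar>"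
    and a: "isCont u a" "isCont u (a + h)" for f and u :: "real ^ 'n \<Rightarrow> real" and a h M
  proof -
    define g where "g x = \<bar>u (x + h) - u x\<bar> * ball_weight R a x ^ ?m" for x
    define G where "G = {x \<in> ball a R. isCont u x \<and> isCont u (x + h)}"
    have aG: "a \<in> G" using a R by (simp add: G_def)
    have g0: "0 \<le> g x" if "x \<in> G" for x
      using that ball_weight_pos[of x a R] by (auto simp: g_def G_def less_imp_le)
    have g_bd: "g x \<le> 2 * M" if "x \<in> G" for x
    proof -
      have x: "x \<in> ball a R" using that by (simp add: G_def)
      have "norm (x + h - a) < 2 * R"
        using x \<open>norm h \<le> R\<close> norm_triangle_ineq[of "x - a" h]
        by (simp add: dist_norm norm_minus_commute algebra_simps)
      then have "x + h \<in> ball a (2 * R)" "x \<in> ball a (2 * R)"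
        using x R by (auto simp: dist_norm norm_minus_commute)
      then have "\<bar>u (x + h)\<bar> \<le> M" "\<bar>u x\<bar> \<le> M" using M by auto
      then have *: "\<bar>u (x + h) - u x\<bar> \<le> 2 * M" by linarith
      have "g x \<le> (2 * M) * 1"
        unfolding g_def using * ball_weight_pos[OF x] ball_weight_le_1[of R a x] R
        by (intro mult_mono power_le_one) auto
      then show ?thesis by simp
    qed
    define S where "S = (SUP x\<in>G. g x)"
    have bdd: "bdd_above (g ` G)" using g_bd by (auto simp: bdd_above_def)
    have gS: "g x \<le> S" if "x \<in> G" for x
      unfolding S_def using that bdd by (rule cSUP_upper)
    have S0: "0 \<le> S" using g0[OF aG] gS[OF aG] by linarith
    define D' where "D' = D * norm h * (LINT z|lborel. \<bar>u z\<bar>)"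
    have "S \<le> S / 2 + D'"
      unfolding S_def
    proof (rule cSUP_least)
      show "G \<noteq> {}" using aG by auto
      fix x assume x: "x \<in> G"
      have "g x \<le> S / 2 + D'"
        unfolding g_def D'_def
        by (rule imp[OF weak(1-3) R weak(4-5) S0 Lip]) (use gS x in \<open>auto simp: G_def g_def\<close>)
      then show "g x \<le> Sup (g ` G) / 2 + D'" by (simp add: S_def)
    qed
    then have "g a \<le> 2 * D'" using gS[OF aG] by linarith
    then have "\<bar>u (a + h) - u a\<bar> * (R\<^sup>2) ^ ?m \<le> 2 * D'" by (simp add: g_def ball_weight_def)
    then have "\<bar>u (a + h) - u a\<bar> \<le> 2 * D' * inverse ((R\<^sup>2) ^ ?m)" using R by (simp add: field_simps)
    then show ?thesis by (simp add: D'_def mult_ac)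
  qed
  show thesis by (rule that[OF _ Lipschitz]) (use D R in auto)
qed

section \<open>Radially decreasing solutions\<close>

lemma sphere_null_lborel: "sphere (0::'a::euclidean_space) r \<in> null_sets lborel"
proof -
  have "sphere (0::'a) r \<in> null_sets lebesgue"
    using negligible_sphere[of 0 r] by (simp add: negligible_iff_null_sets)
  then show ?thesis by (simp add: null_sets_completion_iff)
qed

lemma AE_lborel_open_ex:
  fixes S :: "'a::euclidean_space set"
  assumes "AE x in lborel. x \<in> S \<longrightarrow> P x" "open S" "S \<noteq> {}"
  shows "\<exists>x\<in>S. P x"
proof (rule ccontr)
  assume "\<not> ?thesis"
  then have "AE x in lborel. x \<notin> S" using assms(1) by (auto elim!: eventually_mono)
  then have "S \<in> null_sets lborel" using assms(2) by (subst (asm) AE_iff_null_sets[symmetric]) auto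
  then have "negligible S"
    by (simp add: negligible_iff_null_sets null_sets_completionI)
  with assms show False using open_not_negligible by blast
qed

definition radial_profile :: "(real ^ 'n \<Rightarrow> real) \<Rightarrow> (real \<Rightarrow> real) \<Rightarrow> bool" where
  "radial_profile u \<phi> \<longleftrightarrow> (\<forall>x\<in>ball 0 1 - {0}. u x = \<phi> (norm x)) \<and> antimono_on {0<..<1::real} \<phi>"

lemma radial_profile_eq: "radial_profile u \<phi> \<Longrightarrow> 0 < norm x \<Longrightarrow> norm x < 1 \<Longrightarrow> u x = \<phi> (norm x)"
  by (auto simp: radial_profile_def)

lemma radial_profile_antimono: "radial_profile u \<phi> \<Longrightarrow> 0 < a \<Longrightarrow> a \<le> b \<Longrightarrow> b < 1 \<Longrightarrow> \<phi> b \<le> \<phi> a"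
  by (auto simp: radial_profile_def monotone_on_def)

lemma radial_profile_countable_discont:
  assumes "radial_profile u \<phi>"
  shows "countable {a \<in> {0<..<1}. \<not> isCont \<phi> a}"
proof -
  have "mono_on {0<..<1} (\<lambda>r. - \<phi> r)"
    using assms by (auto simp: radial_profile_def monotone_on_def)
  from mono_on_ctble_discont_open[OF _ this]
  have *: "countable {a \<in> {0<..<1}. \<not> isCont (\<lambda>r. - \<phi> r) a}" by simp
  have "isCont (\<lambda>r. - \<phi> r) a \<Longrightarrow> isCont \<phi> a" for a
    using isCont_minus[of a "\<lambda>r. - \<phi> r"] by simp
  then show ?thesis by (intro countable_subset[OF _ *]) blast
qed

lemma radial_profile_isCont:
  assumes "radial_profile u \<phi>" "0 < norm x" "norm x < 1" "isCont \<phi> (norm x)"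
  shows "isCont u x"
proof -
  have "isCont (\<lambda>x. \<phi> (norm x)) x"
    by (rule isCont_o2[where f = norm and g = \<phi>, OF _ assms(4)]) (intro continuous_intros)
  moreover have "eventually (\<lambda>y. u y = \<phi> (norm y)) (nhds x)"
  proof (rule eventually_nhds_in_open[THEN eventually_mono])
    show "open (ball 0 1 - {0} :: (real ^ 'n) set)" by auto
    show "x \<in> ball 0 1 - {0}" using assms by auto
  qed (use assms(1) in \<open>auto simp: radial_profile_def\<close>)
  ultimately show ?thesis by (simp add: isCont_cong)
qed

lemma radial_profile_dense_isCont:
  assumes "radial_profile u \<phi>" "0 \<le> a" "a < b" "b \<le> 1"
  shows "\<exists>r. a < r \<and> r < b \<and> isCont \<phi> r"
proof (rule ccontr)
  assume "\<not> ?thesis"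
  then have "{a<..<b} \<subseteq> {a \<in> {0<..<1}. \<not> isCont \<phi> a}" using assms by auto
  then have "countable {a<..<b}"
    using radial_profile_countable_discont[OF assms(1)] countable_subset by blast
  then show False using assms(3) uncountable_open_interval by blast
qed

text \<open>The discontinuities lie on countably many spheres: those of the monotone profile, the unit
  sphere and the origin.\<close>
lemma radial_AE_isCont:
  fixes u :: "real ^ 'n \<Rightarrow> real"
  assumes u: "radial_profile u \<phi>" and out: "\<And>x. x \<notin> ball 0 1 \<Longrightarrow> u x = 0"
  shows "AE x in lborel. isCont u x"
proof -
  define D where "D = {a \<in> {0<..<1}. \<not> isCont \<phi> a}"
  have D: "countable D" unfolding D_def by (rule radial_profile_countable_discont[OF u])
  have "(\<Union>r\<in>insert 0 (insert 1 D). sphere (0::real ^ 'n) r) \<in> null_sets lborel"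
    using D by (intro null_sets_UN' sphere_null_lborel) auto
  then show ?thesis
  proof (rule AE_I')
    show "{x \<in> space lborel. \<not> isCont u x} \<subseteq> (\<Union>r\<in>insert 0 (insert 1 D). sphere (0::real ^ 'n) r)"
    proof
      fix x :: "real ^ 'n" assume "x \<in> {x \<in> space lborel. \<not> isCont u x}"
      then have nc: "\<not> isCont u x" by simp
      consider "norm x = 0" | "norm x = 1" | "0 < norm x" "norm x < 1" | "1 < norm x"
        by (metis linorder_neqE_linordered_idom norm_not_less_zero)
      then have "norm x \<in> insert 0 (insert 1 D)"
      proof cases
        case 3
        then show ?thesis using radial_profile_isCont[OF u, of x] nc by (auto simp: D_def)
      next
        case 4
        have "eventually (\<lambda>y. u y = 0) (nhds x)"
        proof (rule eventually_nhds_in_open[THEN eventually_mono])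
          show "open (- cball 0 1 :: (real ^ 'n) set)" by auto
          show "x \<in> - cball 0 1" using 4 by auto
        qed (use out in auto)
        then have "isCont u x" by (simp add: isCont_cong)
        with nc show ?thesis by simp
      qed auto
      then show "x \<in> (\<Union>r\<in>insert 0 (insert 1 D). sphere (0::real ^ 'n) r)"
        by (intro UN_I[of "norm x"]) auto
    qed
  qed
qed

text \<open>Nearby points of continuity are compared through \<open>interior_Lipschitz\<close> along a fixed ray;
  monotonicity extends the bound to all radii, as each can be enclosed between radii of
  continuity. Radii that are not close are compared through the bound \<open>M\<close> on the profile.\<close>
lemma radial_Lipschitz:
  fixes s K \<alpha> \<beta> \<eta> :: real
  assumes s: "0 < s" "s < 1" and K: "0 \<le> K" and \<alpha>: "0 < \<alpha>" and \<beta>: "\<beta> < 1" and \<eta>: "0 < \<eta>" "\<eta> \<le> 1"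
  obtains L where "0 \<le> L"
    "\<And>f (u :: real ^ 'n \<Rightarrow> real) \<phi> M r r'. \<lbrakk>
      weak_solution s f u; u \<in> borel_measurable borel; radial_profile u \<phi>;
      \<And>r. \<alpha> < r \<Longrightarrow> r < \<beta> \<Longrightarrow> \<bar>\<phi> r\<bar> \<le> M;
      \<And>r r'. \<alpha> < r \<Longrightarrow> r < \<beta> \<Longrightarrow> \<alpha> < r' \<Longrightarrow> r' < \<beta> \<Longrightarrow> \<bar>f (\<phi> r) - f (\<phi> r')\<bar> \<le> K * \<bar>\<phi> r - \<phi> r'\<bar>;
      r \<in> {\<alpha> + \<eta>..\<beta> - \<eta>}; r' \<in> {\<alpha> + \<eta>..\<beta> - \<eta>}\<rbrakk> \<Longrightarrow>
      \<bar>\<phi> r - \<phi> r'\<bar> \<le> (L * (LINT z|lborel. \<bar>u z\<bar>) + 16 * M / \<eta>) * \<bar>r - r'\<bar>"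
proof -
  define R where "R = \<eta> / 4"
  have R: "0 < R" "R \<le> 1" using \<eta> by (auto simp: R_def)
  obtain L where L: "0 \<le> L" and Lip: "\<And>f (u :: real ^ 'n \<Rightarrow> real) a h M. \<lbrakk>
      weak_solution s f u; u \<in> borel_measurable borel; AE x in lborel. isCont u x;
      ball a (2 * R) \<subseteq> ball 0 1; norm h \<le> R;
      \<And>x. x \<in> ball a (2 * R) \<Longrightarrow> \<bar>u x\<bar> \<le> M;
      \<And>x y. x \<in> ball a (2 * R) \<Longrightarrow> y \<in> ball a (2 * R) \<Longrightarrow> \<bar>f (u x) - f (u y)\<bar> \<le> K * \<bar>u x - u y\<bar>;
      isCont u a; isCont u (a + h)\<rbrakk> \<Longrightarrow>
      \<bar>u (a + h) - u a\<bar> \<le> L * (LINT z|lborel. \<bar>u z\<bar>) * norm h"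
    by (rule interior_Lipschitz[OF s K R, where 'n = 'n]) blast
  have main: "\<bar>\<phi> r - \<phi> r'\<bar> \<le> (L * (LINT z|lborel. \<bar>u z\<bar>) + 16 * M / \<eta>) * \<bar>r - r'\<bar>"
    if weak: "weak_solution s f u" and um: "u \<in> borel_measurable borel" and rad: "radial_profile u \<phi>"
      and M: "\<And>r. \<alpha> < r \<Longrightarrow> r < \<beta> \<Longrightarrow> \<bar>\<phi> r\<bar> \<le> M"
      and fLip: "\<And>r r'. \<alpha> < r \<Longrightarrow> r < \<beta> \<Longrightarrow> \<alpha> < r' \<Longrightarrow> r' < \<beta> \<Longrightarrow> \<bar>f (\<phi> r) - f (\<phi> r')\<bar> \<le> K * \<bar>\<phi> r - \<phi> r'\<bar>"
      and r: "r \<in> {\<alpha> + \<eta>..\<beta> - \<eta>}" and r': "r' \<in> {\<alpha> + \<eta>..\<beta> - \<eta>}"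
    for f and u :: "real ^ 'n \<Rightarrow> real" and \<phi> M r r'
  proof -
    define I where "I = (LINT z|lborel. \<bar>u z\<bar>)"
    have I: "0 \<le> I" by (simp add: I_def)
    have cont: "AE x in lborel. isCont u x"
      using rad by (rule radial_AE_isCont) (use weak in \<open>auto simp: weak_solution_def\<close>)
    obtain e :: "real ^ 'n" where e: "norm e = 1" using vector_choose_size[of 1] by auto
    have good: "\<bar>\<phi> b - \<phi> a\<bar> \<le> L * I * \<bar>b - a\<bar>"
      if a: "\<alpha> + \<eta> / 2 < a" "a < \<beta> - \<eta> / 2" "isCont \<phi> a" and b: "\<alpha> < b" "b < \<beta>" "isCont \<phi> b"
          and ab: "\<bar>b - a\<bar> \<le> R" for a b
    proof -
      have a0: "0 < a" "a < 1" and b0: "0 < b" "b < 1" using a b \<alpha> \<beta> \<eta> by linarith+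
      have n: "norm (a *\<^sub>R e) = a" "norm (b *\<^sub>R e) = b" using a0 b0 e by auto
      have sh: "a *\<^sub>R e + (b - a) *\<^sub>R e = b *\<^sub>R e" by (simp add: algebra_simps)
      have ann: "\<alpha> < norm x \<and> norm x < \<beta>" if "x \<in> ball (a *\<^sub>R e) (2 * R)" for x
      proof -
        have "norm (x - a *\<^sub>R e) < \<eta> / 2" using that by (simp add: R_def dist_norm norm_minus_commute)
        then show ?thesis using norm_triangle_ineq3[of x "a *\<^sub>R e"] n a by linarith
      qed
      have ux: "u x = \<phi> (norm x)" if "\<alpha> < norm x" "norm x < \<beta>" for x
        using that \<alpha> \<beta> by (intro radial_profile_eq[OF rad]) auto
      have "\<bar>u (a *\<^sub>R e + (b - a) *\<^sub>R e) - u (a *\<^sub>R e)\<bar>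
          \<le> L * (LINT z|lborel. \<bar>u z\<bar>) * norm ((b - a) *\<^sub>R e)"
      proof (rule Lip[OF weak um cont, where M = M])
        show "ball (a *\<^sub>R e) (2 * R) \<subseteq> ball 0 1" using ann \<beta> by force
        show "norm ((b - a) *\<^sub>R e) \<le> R" using ab e by simp
        show "\<bar>u x\<bar> \<le> M" if "x \<in> ball (a *\<^sub>R e) (2 * R)" for x
          using ann[OF that] M ux by simp
        show "\<bar>f (u x) - f (u y)\<bar> \<le> K * \<bar>u x - u y\<bar>"
            if "x \<in> ball (a *\<^sub>R e) (2 * R)" "y \<in> ball (a *\<^sub>R e) (2 * R)" for x y
          using ann[OF that(1)] ann[OF that(2)] fLip ux by simp
        show "isCont u (a *\<^sub>R e)" using a0 a n by (intro radial_profile_isCont[OF rad]) auto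
        show "isCont u (a *\<^sub>R e + (b - a) *\<^sub>R e)" unfolding sh using b0 b n
            by (intro radial_profile_isCont[OF rad]) auto
      qed
      moreover have "u (a *\<^sub>R e) = \<phi> a" "u (b *\<^sub>R e) = \<phi> b"
        using ux[of "a *\<^sub>R e"] ux[of "b *\<^sub>R e"] n a b \<eta> by auto
      ultimately show ?thesis using e unfolding sh by (simp add: I_def)
    qed
    have le: "\<phi> a - \<phi> b \<le> (L * I + 16 * M / \<eta>) * (b - a)" and le0: "\<phi> b \<le> \<phi> a"
      if ab: "\<alpha> + \<eta> \<le> a" "a \<le> b" "b \<le> \<beta> - \<eta>" for a b
    proof -
      show "\<phi> b \<le> \<phi> a" using ab \<alpha> \<beta> \<eta> by (intro radial_profile_antimono[OF rad]) auto
      have abM: "\<bar>\<phi> a\<bar> \<le> M" "\<bar>\<phi> b\<bar> \<le> M" using ab \<eta> by (auto intro: M)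
      then have M0: "0 \<le> M" by linarith
      show "\<phi> a - \<phi> b \<le> (L * I + 16 * M / \<eta>) * (b - a)"
      proof (cases "b - a \<le> R / 2")
        case True
        have "\<phi> a - \<phi> b \<le> L * I * (b - a)"
        proof (rule field_le_epsilon)
          fix \<epsilon> :: real assume \<epsilon>: "0 < \<epsilon>"
          define \<delta> where "\<delta> = min (R / 4) (\<epsilon> / (2 * (L * I + 1)))"
          have LI: "0 \<le> L * I" using L I by simp
          then have \<delta>: "0 < \<delta>" "\<delta> \<le> R / 4" "L * I * (2 * \<delta>) \<le> \<epsilon>"
          proof -
            show "0 < \<delta>" using R \<epsilon> LI by (simp add: \<delta>_def)
            show "\<delta> \<le> R / 4" unfolding \<delta>_def by (rule min.cobounded1)
            have "\<delta> \<le> \<epsilon> / (2 * (L * I + 1))" unfolding \<delta>_def by (rule min.cobounded2)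
            then have "(L * I + 1) * (2 * \<delta>) \<le> \<epsilon>" using LI by (simp add: field_simps)
            moreover have "L * I * (2 * \<delta>) \<le> (L * I + 1) * (2 * \<delta>)" using \<open>0 < \<delta>\<close>
                by (intro mult_right_mono) auto
            ultimately show "L * I * (2 * \<delta>) \<le> \<epsilon>" by linarith
          qed
          obtain a' where a': "a - \<delta> < a'" "a' < a" "isCont \<phi> a'"
            using radial_profile_dense_isCont[OF rad, of "a - \<delta>" a] \<delta> ab \<alpha> \<beta> \<eta> R by (auto simp: R_def)
          obtain b' where b': "b < b'" "b' < b + \<delta>" "isCont \<phi> b'"
            using radial_profile_dense_isCont[OF rad, of b "b + \<delta>"] \<delta> ab \<alpha> \<beta> \<eta> R by (auto simp: R_def)
          have "\<phi> a \<le> \<phi> a'" "\<phi> b' \<le> \<phi> b"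
            using a' b' ab \<delta> \<alpha> \<beta> \<eta> by (auto simp: R_def intro!: radial_profile_antimono[OF rad])
          moreover have "\<bar>\<phi> b' - \<phi> a'\<bar> \<le> L * I * \<bar>b' - a'\<bar>"
            using a' b' ab True \<delta> \<eta> R by (intro good) (auto simp: R_def)
          moreover have "L * I * \<bar>b' - a'\<bar> \<le> L * I * (b - a + 2 * \<delta>)"
            using a' b' ab LI by (intro mult_left_mono) auto
          moreover have "L * I * (b - a + 2 * \<delta>) \<le> L * I * (b - a) + \<epsilon>"
            using \<delta>(3) by (simp add: distrib_left)
          ultimately show "\<phi> a - \<phi> b \<le> L * I * (b - a) + \<epsilon>" by linarith
        qed
        moreover have "0 \<le> 16 * M / \<eta> * (b - a)" using M0 \<eta> ab by simp
        ultimately show ?thesis by (simp add: distrib_right)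
      next
        case False
        have "\<phi> a - \<phi> b \<le> 2 * M" using abM by linarith
        also have "2 * M = 16 * M / \<eta> * (R / 2)" using \<eta> by (simp add: R_def)
        also have "\<dots> \<le> 16 * M / \<eta> * (b - a)" using False M0 \<eta> by (intro mult_left_mono) auto
        also have "\<dots> \<le> (L * I + 16 * M / \<eta>) * (b - a)" using L I ab by (intro mult_right_mono) auto
        finally show ?thesis .
      qed
    qed
    show ?thesis
    proof (cases "r \<le> r'")
      case True
      then show ?thesis using le[of r r'] le0[of r r'] r r' by (simp add: I_def)
    next
      case False
      then show ?thesis using le[of r' r] le0[of r' r] r r' by (simp add: I_def)
    qed
  qed
  show thesis by (rule that[OF L main])
qed

lemma MVT_abs_bound:
  fixes f :: "real \<Rightarrow> real"
  assumes f: "\<And>t. f field_differentiable at t" and K: "\<And>t. min a b \<le> t \<Longrightarrow> t \<le> max a b \<Longrightarrow> \<bar>deriv f t\<bar> \<le> K"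
  shows "\<bar>f a - f b\<bar> \<le> K * \<bar>a - b\<bar>"
proof -
  have d: "(f has_real_derivative deriv f t) (at t)" for t
    using f by (simp add: DERIV_deriv_iff_field_differentiable)
  have *: "\<bar>f y - f x\<bar> \<le> K * (y - x)" if xy: "x < y" "min a b = x" "max a b = y" for x y
  proof -
    obtain z where z: "x < z" "z < y" "f y - f x = (y - x) * deriv f z"
      using MVT2[OF xy(1) d] by blast
    have "\<bar>f y - f x\<bar> = \<bar>deriv f z\<bar> * (y - x)" using z xy by (simp add: abs_mult)
    also have "\<dots> \<le> K * (y - x)" using K[of z] z xy by (intro mult_right_mono) auto
    finally show ?thesis .
  qed
  show ?thesis
    using *[of a b] *[of b a] by (cases a b rule: linorder_cases) (auto simp: abs_minus_commute)
qed

lemma AE_annulus_ex: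
  fixes P :: "real ^ 'n \<Rightarrow> bool"
  assumes P: "AE x in lborel. x \<in> ball 0 (7/8) - ball 0 (3/8) \<longrightarrow> P x" and ab: "3/8 \<le> a" "a < b" "b \<le> 7/8"
  shows "\<exists>x. a < norm x \<and> norm x < b \<and> P x"
proof -
  let ?S = "{x :: real ^ 'n. a < norm x \<and> norm x < b}"
  have "open ?S" by (intro open_Collect_conj open_Collect_less continuous_intros)
  moreover obtain x :: "real ^ 'n" where "norm x = (a + b) / 2"
      using vector_choose_size[of "(a + b) / 2"] ab by auto
  then have "x \<in> ?S" using ab by auto
  then have "?S \<noteq> {}" by blast
  moreover have "AE x in lborel. x \<in> ?S \<longrightarrow> P x" using P ab by (auto elim!: eventually_mono)
  ultimately show ?thesis using AE_lborel_open_ex[of ?S P] by blast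
qed

lemma radial_profile_AE_bounded:
  fixes u :: "real ^ 'n \<Rightarrow> real"
  assumes rad: "radial_profile u \<phi>" and M: "AE x in lborel. x \<in> ball 0 (7/8) - ball 0 (3/8) \<longrightarrow> \<bar>u x\<bar> \<le> M"
    and r: "3/8 < r" "r < 7/8"
  shows "\<bar>\<phi> r\<bar> \<le> M"
proof -
  obtain x1 where x1: "3/8 < norm x1" "norm x1 < r" "\<bar>u x1\<bar> \<le> M" using AE_annulus_ex[OF M, of "3/8" r] r
      by auto
  obtain x2 where x2: "r < norm x2" "norm x2 < 7/8" "\<bar>u x2\<bar> \<le> M" using AE_annulus_ex[OF M, of r "7/8"] r
      by auto
  have "u x1 = \<phi> (norm x1)" "u x2 = \<phi> (norm x2)" using x1 x2 r
      by (auto intro!: radial_profile_eq[OF rad])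
  moreover have "\<phi> r \<le> \<phi> (norm x1)" "\<phi> (norm x2) \<le> \<phi> r"
    using x1 x2 r by (auto intro!: radial_profile_antimono[OF rad])
  ultimately show ?thesis using x1 x2 by linarith
qed

text \<open>Two passes. In the first, \<open>f\<close> is Lipschitz on the interval spanned by the values of the
  profile with an uncontrolled constant \<open>K'\<close>, and the only conclusion is that the profile is
  continuous between 13/32 and 27/32. In the second, every value between two values of the profile
  is then itself a value of the profile, where \<open>|f'| \<le> K\<close>, so the mean value theorem makes \<open>f\<close>
  Lipschitz with the constant \<open>K\<close>. Each pass loses 1/32 at both ends of the range of radii, whence
  \<open>512 = 16 / (1/32)\<close>.\<close>
lemma solution_profile_Lipschitz:
  fixes s :: real
  assumes s: "0 < s" "s < 1"
  obtains L where 
    "\<And>f (u :: real ^ 'n \<Rightarrow> real) \<phi> M K r r'. \<lbrakk>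
      class_C2 f; weak_solution s f u; u \<in> borel_measurable borel; radial_profile u \<phi>; 0 \<le> K;
      AE x in lborel. x \<in> ball 0 (7/8) - ball 0 (3/8) \<longrightarrow> \<bar>u x\<bar> \<le> M;
      AE x in lborel. x \<in> ball 0 (7/8) - ball 0 (3/8) \<longrightarrow> \<bar>deriv f (u x)\<bar> \<le> K;
      r \<in> {7/16..13/16}; r' \<in> {7/16..13/16}\<rbrakk> \<Longrightarrow>
      \<bar>\<phi> r - \<phi> r'\<bar> \<le> (L K * (LINT z|lborel. \<bar>u z\<bar>) + 512 * M) * \<bar>r - r'\<bar>"
    "\<And>K. 0 \<le> K \<Longrightarrow> 0 \<le> L K"
proof -
  \<comment> \<open>The constant has to be chosen for each \<open>K\<close> before the solution is given.\<close>
  define good where "good K L \<longleftrightarrow> 0 \<le> L \<and> (\<forall>f (u :: real ^ 'n \<Rightarrow> real) \<phi> M r r'.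
      weak_solution s f u \<longrightarrow> u \<in> borel_measurable borel \<longrightarrow> radial_profile u \<phi> \<longrightarrow>
      (\<forall>r. 13/32 < r \<longrightarrow> r < 27/32 \<longrightarrow> \<bar>\<phi> r\<bar> \<le> M) \<longrightarrow>
      (\<forall>r r'. 13/32 < r \<longrightarrow> r < 27/32 \<longrightarrow> 13/32 < r' \<longrightarrow> r' < 27/32 \<longrightarrow> \<bar>f (\<phi> r) - f (\<phi> r')\<bar> \<le> K * \<bar>\<phi> r - \<phi> r'\<bar>)
          \<longrightarrow>
      r \<in> {7/16..13/16} \<longrightarrow> r' \<in> {7/16..13/16} \<longrightarrow>
      \<bar>\<phi> r - \<phi> r'\<bar> \<le> (L * (LINT z|lborel. \<bar>u z\<bar>) + 512 * M) * \<bar>r - r'\<bar>)" for K L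
  have ex_good: "\<exists>L. good K L" if K: "0 \<le> K" for K
  proof -
    have num: "0 < (13/32::real)" "(27/32::real) < 1" "0 < (1/32::real)" "(1/32::real) \<le> 1" by simp_all
    obtain L where "0 \<le> L" and L: "\<And>f (u :: real ^ 'n \<Rightarrow> real) \<phi> M r r'. \<lbrakk>
      weak_solution s f u; u \<in> borel_measurable borel; radial_profile u \<phi>;
      \<And>r. 13/32 < r \<Longrightarrow> r < 27/32 \<Longrightarrow> \<bar>\<phi> r\<bar> \<le> M;
      \<And>r r'. 13/32 < r \<Longrightarrow> r < 27/32 \<Longrightarrow> 13/32 < r' \<Longrightarrow> r' < 27/32 \<Longrightarrow> \<bar>f (\<phi> r) - f (\<phi> r')\<bar> \<le> K * \<bar>\<phi> r - \<phi> r'\<bar>;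
      r \<in> {13/32 + 1/32..27/32 - 1/32}; r' \<in> {13/32 + 1/32..27/32 - 1/32}\<rbrakk> \<Longrightarrow>
      \<bar>\<phi> r - \<phi> r'\<bar> \<le> (L * (LINT z|lborel. \<bar>u z\<bar>) + 16 * M / (1/32)) * \<bar>r - r'\<bar>"
      by (rule radial_Lipschitz[OF s K num, where 'n = 'n]) blast
    have "good K L"
      unfolding good_def
    proof (intro conjI allI impI)
      fix f \<phi> :: "real \<Rightarrow> real" and u :: "real ^ 'n \<Rightarrow> real" and M r r' :: real
      assume a: "weak_solution s f u" "u \<in> borel_measurable borel" "radial_profile u \<phi>"
        "\<forall>r. 13/32 < r \<longrightarrow> r < 27/32 \<longrightarrow> \<bar>\<phi> r\<bar> \<le> M"
        "\<forall>r r'. 13/32 < r \<longrightarrow> r < 27/32 \<longrightarrow> 13/32 < r' \<longrightarrow> r' < 27/32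
            \<longrightarrow> \<bar>f (\<phi> r) - f (\<phi> r')\<bar> \<le> K * \<bar>\<phi> r - \<phi> r'\<bar>"
        "r \<in> {7/16..13/16}" "r' \<in> {7/16..13/16}"
      show "\<bar>\<phi> r - \<phi> r'\<bar> \<le> (L * (LINT z|lborel. \<bar>u z\<bar>) + 512 * M) * \<bar>r - r'\<bar>"
        using L[OF a(1-3), of M r r'] a(4-7) by simp
    qed (rule \<open>0 \<le> L\<close>)
    then show ?thesis ..
  qed
  define L where "L K = (SOME L. good K L)" for K
  have L: "good K (L K)" if "0 \<le> K" for K unfolding L_def using ex_good[OF that] by (rule someI_ex)
  have main: "\<bar>\<phi> r - \<phi> r'\<bar> \<le> (L K * (LINT z|lborel. \<bar>u z\<bar>) + 512 * M) * \<bar>r - r'\<bar>"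
    if f: "class_C2 f" and weak: "weak_solution s f u" and um: "u \<in> borel_measurable borel"
      and rad: "radial_profile u \<phi>" and K: "0 \<le> K"
      and M: "AE x in lborel. x \<in> ball 0 (7/8) - ball 0 (3/8) \<longrightarrow> \<bar>u x\<bar> \<le> M"
      and fK: "AE x in lborel. x \<in> ball 0 (7/8) - ball 0 (3/8) \<longrightarrow> \<bar>deriv f (u x)\<bar> \<le> K"
      and r: "r \<in> {7/16..13/16}" and r': "r' \<in> {7/16..13/16}"
    for f and u :: "real ^ 'n \<Rightarrow> real" and \<phi> M K r r'
  proof -
    have fd: "f field_differentiable at t" for t using f by (simp add: class_C2_def)
    have f'c: "isCont (deriv f) t" for t
      using f by (auto simp: class_C2_def intro: field_differentiable_imp_continuous_at)
    then have f'c_on: "continuous_on A (deriv f)" for A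
      by (simp add: continuous_at_imp_continuous_on)
    have f'bd: "\<exists>K'\<ge>0. \<forall>t\<in>{\<phi> (7/8)..\<phi> (3/8)}. \<bar>deriv f t\<bar> \<le> K'"
    proof -
      have "bounded (deriv f ` {\<phi> (7/8)..\<phi> (3/8)})"
        using compact_continuous_image[OF f'c_on] compact_Icc compact_imp_bounded by blast
      then show ?thesis unfolding bounded_pos by (auto intro: less_imp_le)
    qed
    then obtain K' where K': "0 \<le> K'" "\<And>t. \<phi> (7/8) \<le> t \<Longrightarrow> t \<le> \<phi> (3/8) \<Longrightarrow> \<bar>deriv f t\<bar> \<le> K'" by auto
    have mono: "\<phi> (7/8) \<le> \<phi> t \<and> \<phi> t \<le> \<phi> (3/8)" if "3/8 < t" "t < 7/8" for t
      using that by (auto intro!: radial_profile_antimono[OF rad])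
    have Lip0: "\<bar>f (\<phi> r) - f (\<phi> r')\<bar> \<le> K' * \<bar>\<phi> r - \<phi> r'\<bar>" if "3/8 < r" "r < 7/8" "3/8 < r'" "r' < 7/8"
        for r r'
      using mono[of r] mono[of r'] that by (intro MVT_abs_bound fd K') auto
    obtain L' where L': "\<And>r r'. r \<in> {3/8 + 1/32..7/8 - 1/32} \<Longrightarrow> r' \<in> {3/8 + 1/32..7/8 - 1/32} \<Longrightarrow>
        \<bar>\<phi> r - \<phi> r'\<bar> \<le> L' * \<bar>r - r'\<bar>"
    proof (rule radial_Lipschitz[OF s K'(1), of "3/8" "7/8" "1/32", where 'n = 'n])
      fix L0 :: real
      assume L0: "\<And>f (u :: real ^ 'n \<Rightarrow> real) \<phi> M r r'. \<lbrakk>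
      weak_solution s f u; u \<in> borel_measurable borel; radial_profile u \<phi>;
      \<And>r. 3/8 < r \<Longrightarrow> r < 7/8 \<Longrightarrow> \<bar>\<phi> r\<bar> \<le> M;
      \<And>r r'. 3/8 < r \<Longrightarrow> r < 7/8 \<Longrightarrow> 3/8 < r' \<Longrightarrow> r' < 7/8 \<Longrightarrow> \<bar>f (\<phi> r) - f (\<phi> r')\<bar> \<le> K' * \<bar>\<phi> r - \<phi> r'\<bar>;
      r \<in> {3/8 + 1/32..7/8 - 1/32}; r' \<in> {3/8 + 1/32..7/8 - 1/32}\<rbrakk> \<Longrightarrow>
      \<bar>\<phi> r - \<phi> r'\<bar> \<le> (L0 * (LINT z|lborel. \<bar>u z\<bar>) + 16 * M / (1/32)) * \<bar>r - r'\<bar>"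
      show thesis
        by (rule that, rule L0[OF weak um rad radial_profile_AE_bounded[OF rad M] Lip0])
    qed auto
    have cont: "isCont \<phi> t" if t: "13/32 < t" "t < 27/32" for t
    proof -
      have "\<bar>L'\<bar>-lipschitz_on {13/32<..<27/32} \<phi>"
      proof (rule lipschitz_onI)
        fix x y :: real assume "x \<in> {13/32<..<27/32}" "y \<in> {13/32<..<27/32}"
        then have "\<bar>\<phi> x - \<phi> y\<bar> \<le> L' * \<bar>x - y\<bar>" by (intro L') auto
        also have "\<dots> \<le> \<bar>L'\<bar> * \<bar>x - y\<bar>" by (intro mult_right_mono) auto
        finally show "dist (\<phi> x) (\<phi> y) \<le> \<bar>L'\<bar> * dist x y" by (simp add: dist_real_def)
      qed simp
      then have "continuous_on {13/32<..<27/32} \<phi>" by (rule lipschitz_on_continuous_on)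
      then show ?thesis using t by (simp add: continuous_on_eq_continuous_at)
    qed
    have f'K: "\<bar>deriv f (\<phi> t)\<bar> \<le> K" if t: "13/32 < t" "t < 27/32" for t
    proof (rule ccontr)
      assume "\<not> ?thesis"
      then have K1: "K < \<bar>deriv f (\<phi> t)\<bar>" by simp
      have "isCont (\<lambda>t. \<bar>deriv f (\<phi> t)\<bar>) t"
        by (intro isCont_rabs isCont_o2[OF cont[OF t] f'c])
      then have "eventually (\<lambda>t. K < \<bar>deriv f (\<phi> t)\<bar>) (at t)"
        using K1 by (intro order_tendstoD) (auto simp: isCont_def)
      then obtain d where d: "0 < d" "\<And>x. x \<noteq> t \<Longrightarrow> dist x t < d \<Longrightarrow> K < \<bar>deriv f (\<phi> x)\<bar>"
        by (auto simp: eventually_at)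
      define b where "b = min (t + d) (27/32)"
      have b: "t < b" "b \<le> 7/8" "b \<le> 27/32" "b \<le> t + d" using t d by (auto simp: b_def min_def)
      obtain x where x: "t < norm x" "norm x < b" "\<bar>deriv f (u x)\<bar> \<le> K"
        using AE_annulus_ex[OF fK _ b(1,2)] t by auto
      have "u x = \<phi> (norm x)" using x t by (intro radial_profile_eq[OF rad]) (use b in auto)
      then show False using d(2)[of "norm x"] x b by (auto simp: dist_real_def)
    qed
    have LipK: "\<bar>f (\<phi> r) - f (\<phi> r')\<bar> \<le> K * \<bar>\<phi> r - \<phi> r'\<bar>"
      if r: "13/32 < r" "r < 27/32" and r': "13/32 < r'" "r' < 27/32" for r r'
    proof (rule MVT_abs_bound[OF fd])
      fix v assume v: "min (\<phi> r) (\<phi> r') \<le> v" "v \<le> max (\<phi> r) (\<phi> r')"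
      have "\<exists>t. min r r' \<le> t \<and> t \<le> max r r' \<and> \<phi> t = v"
      proof (rule IVT2)
        have "\<phi> (max r r') \<le> \<phi> (min r r')" using r r' by (intro radial_profile_antimono[OF rad]) auto
        then show "\<phi> (max r r') \<le> v" "v \<le> \<phi> (min r r')" using v
            by (auto simp: min_def max_def split: if_splits)
        show "\<forall>t. min r r' \<le> t \<and> t \<le> max r r' \<longrightarrow> isCont \<phi> t" using r r' by (auto intro!: cont)
      qed auto
      then obtain t where t: "min r r' \<le> t" "t \<le> max r r'" "\<phi> t = v" by blast
      then show "\<bar>deriv f v\<bar> \<le> K" using f'K[of t] r r' by auto
    qed
    have "\<bar>\<phi> r\<bar> \<le> M" if "13/32 < r" "r < 27/32" for r
        using radial_profile_AE_bounded[OF rad M, of r] that by simp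
    with L[OF K] show ?thesis
      unfolding good_def using weak um rad LipK r r' by blast
  qed
  show thesis
  proof (rule that[of L])
    show "0 \<le> L K" if "0 \<le> K" for K using L[OF that] by (simp add: good_def)
  qed (rule main)
qed

section \<open>The Poisson kernel of the extension\<close>

lemma poisson_profile_nonneg [simp]: "0 \<le> poisson_profile s x y"
  by (simp add: poisson_profile_def)

lemma poisson_profile_measurable [measurable]:
  "(\<lambda>x :: real ^ 'n. poisson_profile s x y) \<in> borel_measurable borel"
  unfolding poisson_profile_def by measurable

lemma poisson_profile_le:
  fixes x :: "real ^ 'n"
  assumes "0 < s" "0 < y"
  shows "poisson_profile s x y \<le> y powr (2 * s) * far_kernel s y x"
proof -
  define e where "e = real CARD('n) + 2 * s"
  have e: "0 < e" using assms by (simp add: e_def)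
  have m: "0 < max (norm x) y" using assms by simp
  have "(max (norm x) y)\<^sup>2 \<le> (norm x)\<^sup>2 + y\<^sup>2" by (auto simp: max_def)
  then have "((norm x)\<^sup>2 + y\<^sup>2) powr (- (e / 2)) \<le> ((max (norm x) y)\<^sup>2) powr (- (e / 2))"
    using m e by (intro powr_mono2') auto
  also have "\<dots> = max (norm x) y powr (- e)"
    using m by (simp add: powr_numeral[symmetric] powr_powr del: powr_numeral)
  finally have *: "((norm x)\<^sup>2 + y\<^sup>2) powr (- (e / 2)) \<le> far_kernel s y x"
    by (simp add: far_kernel_def e_def)
  have "poisson_profile s x y = y powr (2 * s) * ((norm x)\<^sup>2 + y\<^sup>2) powr (- (e / 2))"
    by (simp add: poisson_profile_def e_def powr_minus_divide del: minus_add_distrib)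
  with * show ?thesis by (simp add: mult_left_mono)
qed

lemma integrable_poisson_profile:
  assumes "0 < s" "0 < y"
  shows "integrable lborel (\<lambda>x :: real ^ 'n. poisson_profile s x y)"
proof (rule Bochner_Integration.integrable_bound)
  show "integrable lborel (\<lambda>x :: real ^ 'n. y powr (2 * s) * far_kernel s y x)"
    using assms by (intro integrable_mult_right integrable_far_kernel)
  show "AE x in lborel. norm (poisson_profile s (x :: real ^ 'n) y)
      \<le> norm (y powr (2 * s) * far_kernel s y x)"
    using poisson_profile_le[OF assms] by (intro AE_I2) simp
qed simp

lemma poisson_profile_scale:
  fixes x :: "real ^ 'n"
  assumes "0 < y"
  shows "y ^ CARD('n) * poisson_profile s (y *\<^sub>R x) y = poisson_profile s x 1"
proof -
  define q where "q = (real CARD('n) + 2 * s) / 2"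
  have "(norm (y *\<^sub>R x))\<^sup>2 + y\<^sup>2 = y\<^sup>2 * ((norm x)\<^sup>2 + 1)"
    by (simp add: power_mult_distrib algebra_simps)
  then have "((norm (y *\<^sub>R x))\<^sup>2 + y\<^sup>2) powr q = (y\<^sup>2) powr q * ((norm x)\<^sup>2 + 1) powr q"
    by (simp add: powr_mult)
  also have "(y\<^sup>2) powr q = y ^ CARD('n) * y powr (2 * s)"
  proof -
    have "(y\<^sup>2) powr q = y powr (2 * q)"
      using assms by (simp add: powr_numeral[symmetric] powr_powr del: powr_numeral)
    also have "2 * q = real CARD('n) + 2 * s" by (simp add: q_def)
    finally show ?thesis using assms by (simp add: powr_add powr_realpow)
  qed
  finally show ?thesis
    using assms by (simp add: poisson_profile_def q_def[symmetric])
qed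

lemma integral_poisson_profile:
  assumes "0 < y"
  shows "(LINT x|lborel. poisson_profile s (x :: real ^ 'n) y)
      = (LINT x|lborel. poisson_profile s (x :: real ^ 'n) 1)"
proof -
  have "(LINT x|lborel. poisson_profile s (x :: real ^ 'n) y)
      = y ^ CARD('n) * (LINT x|lborel. poisson_profile s (y *\<^sub>R x :: real ^ 'n) y)"
    using assms by (subst lborel_integral_affine[of y _ 0]) simp_all
  also have "\<dots> = (LINT x|lborel. y ^ CARD('n) * poisson_profile s (y *\<^sub>R x :: real ^ 'n) y)" by simp
  finally show ?thesis using poisson_profile_scale[OF assms, where 'n = 'n] by simp
qed

lemma integral_poisson_profile_pos:
  assumes "0 < s"
  shows "0 < (LINT x|lborel. poisson_profile s (x :: real ^ 'n) 1)"
proof -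
  have int: "integrable lborel (\<lambda>x :: real ^ 'n. poisson_profile s x 1)"
    using assms by (rule integrable_poisson_profile) simp
  have "(norm x)\<^sup>2 + 1 \<noteq> 0" for x :: "real ^ 'n"
    using zero_le_power2[of "norm x"] by linarith
  then have pos: "0 < poisson_profile s (x :: real ^ 'n) 1" for x
    by (simp add: poisson_profile_def)
  have "(LINT x|lborel. poisson_profile s (x :: real ^ 'n) 1) \<noteq> 0"
  proof
    assume "(LINT x|lborel. poisson_profile s (x :: real ^ 'n) 1) = 0"
    then have "AE x :: real ^ 'n in lborel. poisson_profile s x 1 = 0"
      using integral_nonneg_eq_0_iff_AE[OF int] by simp
    then have "AE x :: real ^ 'n in lborel. x \<in> UNIV \<longrightarrow> False"
    proof eventually_elim
      case (elim x)
      with pos[of x] show ?case by simp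
    qed
    from AE_lborel_open_ex[OF this] show False by auto
  qed
  moreover have "0 \<le> (LINT x|lborel. poisson_profile s (x :: real ^ 'n) 1)" by simp
  ultimately show ?thesis by linarith
qed

lemma poisson_const_eq:
  assumes "0 < s"
  shows "poisson_const TYPE('n::finite) s = 1 / (LINT x|lborel. poisson_profile s (x :: real ^ 'n) 1)"
  unfolding poisson_const_def
proof (rule the_equality)
  let ?Z = "LINT x|lborel. poisson_profile s (x :: real ^ 'n) 1"
  have Z: "0 < ?Z" by (rule integral_poisson_profile_pos[OF assms])
  show "\<forall>y>0. (LINT x|lborel. 1 / ?Z * poisson_profile s (x :: real ^ 'n) y) = 1"
  proof (intro allI impI)
    fix y :: real assume "0 < y"
    then show "(LINT x|lborel. 1 / ?Z * poisson_profile s (x :: real ^ 'n) y) = 1"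
      using Z by (simp add: integral_poisson_profile[of y])
  qed
  fix c assume "\<forall>y>0. (LINT x|lborel. c * poisson_profile s (x :: real ^ 'n) y) = 1"
  then have "(LINT x|lborel. c * poisson_profile s (x :: real ^ 'n) 1) = 1" by simp
  then have "c * ?Z = 1" by simp
  then show "c = 1 / ?Z" using Z by (simp add: field_simps)
qed

lemma poisson_const_pos: "0 < s \<Longrightarrow> 0 < poisson_const TYPE('n::finite) s"
  using integral_poisson_profile_pos[of s, where 'n = 'n] by (simp add: poisson_const_eq)

lemma poisson_kernel_nonneg: "0 < s \<Longrightarrow> 0 \<le> poisson_kernel s (x :: real ^ 'n) y"
  using poisson_const_pos[of s, where 'n = 'n] by (simp add: poisson_kernel_def)

lemma poisson_kernel_measurable [measurable]:
  "(\<lambda>x :: real ^ 'n. poisson_kernel s x y) \<in> borel_measurable borel"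
  unfolding poisson_kernel_def by measurable

lemma poisson_kernel_integral:
  assumes "0 < s" "0 < y"
  shows "integrable lborel (\<lambda>x :: real ^ 'n. poisson_kernel s x y)"
    and "(LINT x|lborel. poisson_kernel s (x :: real ^ 'n) y) = 1"
proof -
  show "integrable lborel (\<lambda>x :: real ^ 'n. poisson_kernel s x y)"
    unfolding poisson_kernel_def using assms by (intro integrable_mult_right integrable_poisson_profile)
  show "(LINT x|lborel. poisson_kernel s (x :: real ^ 'n) y) = 1"
    using integral_poisson_profile[OF assms(2), of s, where 'n = 'n]
        integral_poisson_profile_pos[OF assms(1), where 'n = 'n]
    by (simp add: poisson_kernel_def poisson_const_eq[OF assms(1)])
qed

definition poisson_gradient :: "real \<Rightarrow> real ^ 'n \<Rightarrow> real \<Rightarrow> real ^ 'n" where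
  "poisson_gradient s x y =
     (- (poisson_const TYPE('n) s * y powr (2 * s) * (real CARD('n) + 2 * s)
         * ((norm x)\<^sup>2 + y\<^sup>2) powr (- ((real CARD('n) + 2 * s) / 2) - 1))) *\<^sub>R x"

lemma poisson_kernel_eq:
  fixes x :: "real ^ 'n"
  shows "poisson_kernel s x y = poisson_const TYPE('n) s * y powr (2 * s)
      * ((norm x)\<^sup>2 + y\<^sup>2) powr (- ((real CARD('n) + 2 * s) / 2))"
  by (simp add: poisson_kernel_def poisson_profile_def powr_minus_divide del: minus_add_distrib)

lemma poisson_kernel_bounded:
  fixes x :: "real ^ 'n"
  assumes "0 < s" "0 < y"
  shows "\<bar>poisson_kernel s x y\<bar> \<le> poisson_const TYPE('n) s * y powr (2 * s)
      * (y\<^sup>2) powr (- ((real CARD('n) + 2 * s) / 2))"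
proof -
  have "((norm x)\<^sup>2 + y\<^sup>2) powr (- ((real CARD('n) + 2 * s) / 2))
      \<le> (y\<^sup>2) powr (- ((real CARD('n) + 2 * s) / 2))"
    using assms by (intro powr_mono2') (auto simp: add_nonneg_nonneg)
  then have "poisson_kernel s x y
      \<le> poisson_const TYPE('n) s * y powr (2 * s) * (y\<^sup>2) powr (- ((real CARD('n) + 2 * s) / 2))"
    unfolding poisson_kernel_eq using poisson_const_pos[OF assms(1), where 'n = 'n]
        by (intro mult_left_mono) auto
  then show ?thesis using poisson_kernel_nonneg[OF assms(1), of x y] by simp
qed

text \<open>Applied with \<open>t = (norm x)\<^sup>2\<close> and \<open>b = y\<^sup>2\<close>. The bound on the second derivative is uniform
  in \<open>t \<ge> 0\<close>.\<close>
lemma powr_Taylor_remainder: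
  fixes t a b q :: real
  assumes "0 < b" "0 < q" "0 \<le> t" "0 \<le> t + a"
  shows "\<bar>(t + a + b) powr (- q) - (t + b) powr (- q) + q * (t + b) powr (- q - 1) * a\<bar>
    \<le> q * (q + 1) * b powr (- q - 2) * a\<^sup>2"
proof -
  define S where "S = {min t (t + a)..max t (t + a)}"
  have S0: "0 \<le> \<tau>" if "\<tau> \<in> S" for \<tau> using that assms by (auto simp: S_def)
  have conv: "convex S" by (simp add: S_def)
  have tS: "t \<in> S" "t + a \<in> S" by (auto simp: S_def)
  define g' where "g' \<tau> = - q * (\<tau> + b) powr (- q - 1)" for \<tau>
  define B where "B = q * (q + 1) * b powr (- q - 2)"
  have g'_bd: "\<bar>g' \<tau> - g' t\<bar> \<le> B * \<bar>a\<bar>" if \<tau>: "\<tau> \<in> S" for \<tau>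
  proof -
    have "norm (g' \<tau> - g' t) \<le> B * norm (\<tau> - t)"
    proof (rule field_differentiable_bound[OF conv])
      fix x assume x: "x \<in> S"
      show "(g' has_field_derivative (q * (q + 1) * (x + b) powr (- q - 2))) (at x within S)"
        unfolding g'_def using S0[OF x] assms by (auto intro!: derivative_eq_intros simp: algebra_simps)
      show "norm (q * (q + 1) * (x + b) powr (- q - 2)) \<le> B"
        unfolding B_def using S0[OF x] assms by (auto intro!: mult_left_mono powr_mono2')
    qed (use \<tau> tS in auto)
    also have "\<dots> \<le> B * \<bar>a\<bar>"
      using \<tau> assms by (intro mult_left_mono) (auto simp: S_def B_def)
    finally show ?thesis by simp
  qed
  have "norm (((t + a + b) powr (- q) - g' t * (t + a)) - ((t + b) powr (- q) - g' t * t))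
      \<le> (B * \<bar>a\<bar>) * norm (t + a - t)"
  proof (rule field_differentiable_bound[OF conv, where f = "\<lambda>\<tau>. (\<tau> + b) powr (- q) - g' t * \<tau>"
      and f' = "\<lambda>\<tau>. g' \<tau> - g' t"])
    fix x assume x: "x \<in> S"
    show "((\<lambda>\<tau>. (\<tau> + b) powr (- q) - g' t * \<tau>) has_field_derivative (g' x - g' t)) (at x within S)"
      using S0[OF x] assms by (auto intro!: derivative_eq_intros simp: g'_def)
    show "norm (g' x - g' t) \<le> B * \<bar>a\<bar>" using g'_bd[OF x] by simp
  qed (use tS in auto)
  moreover have "(B * \<bar>a\<bar>) * norm (t + a - t) = B * a\<^sup>2" by (simp add: power2_eq_square)
  moreover have "((t + a + b) powr (- q) - g' t * (t + a)) - ((t + b) powr (- q) - g' t * t)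
      = (t + a + b) powr (- q) - (t + b) powr (- q) + q * (t + b) powr (- q - 1) * a"
    by (simp add: g'_def algebra_simps)
  ultimately show ?thesis by (simp only: B_def real_norm_def)
qed

lemma poisson_kernel_remainder:
  fixes s y :: real
  assumes s: "0 < s" and y: "0 < y"
  shows "\<exists>C\<ge>0. \<forall>x h :: real ^ 'n. norm x \<le> 2 \<longrightarrow> norm h \<le> 1 \<longrightarrow>
    \<bar>poisson_kernel s (x + h) y - poisson_kernel s x y - h \<bullet> poisson_gradient s x y\<bar> \<le> C * (norm h)\<^sup>2"
proof -
  define q where "q = (real CARD('n) + 2 * s) / 2"
  define c where "c = poisson_const TYPE('n) s * y powr (2 * s)"
  have q: "0 < q" using s by (simp add: q_def)
  have c: "0 \<le> c" using poisson_const_pos[OF s, where 'n = 'n] by (simp add: c_def)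
  define C1 where "C1 = q * (q + 1) * (y\<^sup>2) powr (- q - 2) * 25"
  define C2 where "C2 = q * (y\<^sup>2) powr (- q - 1)"
  have "\<bar>poisson_kernel s (x + h) y - poisson_kernel s x y - h \<bullet> poisson_gradient s x y\<bar>
      \<le> c * (C1 + C2) * (norm h)\<^sup>2"
    if x: "norm x \<le> 2" and h: "norm h \<le> 1" for x h :: "real ^ 'n"
  proof -
    define t where "t = (norm x)\<^sup>2"
    define a where "a = 2 * (x \<bullet> h) + (norm h)\<^sup>2"
    have ta: "(norm (x + h))\<^sup>2 = t + a"
      by (simp add: t_def a_def power2_norm_eq_inner inner_simps inner_commute)
    have ta0: "0 \<le> t" "0 \<le> t + a" using ta[symmetric] by (simp_all add: t_def)
    have "\<bar>x \<bullet> h\<bar> \<le> norm x * norm h" by (rule Cauchy_Schwarz_ineq2)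
    also have "\<dots> \<le> 2 * norm h" using x by (intro mult_right_mono) auto
    finally have xh: "\<bar>x \<bullet> h\<bar> \<le> 2 * norm h" .
    have "(norm h)\<^sup>2 \<le> norm h" using h by (simp add: power2_eq_square mult_left_le_one_le)
    then have "\<bar>a\<bar> \<le> 5 * norm h" using xh zero_le_power2[of "norm h"] unfolding a_def by linarith
    then have a2: "a\<^sup>2 \<le> 25 * (norm h)\<^sup>2"
      using power_mono[of "\<bar>a\<bar>" "5 * norm h" 2] by (simp add: power_mult_distrib)
    have y2: "0 < y\<^sup>2" using y by simp
    define r where "r = (t + a + y\<^sup>2) powr (- q) - (t + y\<^sup>2) powr (- q)
        + q * (t + y\<^sup>2) powr (- q - 1) * a"
    define r2 where "r2 = q * (t + y\<^sup>2) powr (- q - 1) * (norm h)\<^sup>2"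
    have "\<bar>r\<bar> \<le> q * (q + 1) * (y\<^sup>2) powr (- q - 2) * a\<^sup>2"
      unfolding r_def by (rule powr_Taylor_remainder[OF y2 q ta0])
    also have "\<dots> \<le> C1 * (norm h)\<^sup>2"
      using a2 q by (simp add: C1_def mult.assoc mult_left_mono)
    finally have r: "\<bar>r\<bar> \<le> C1 * (norm h)\<^sup>2" .
    have "(t + y\<^sup>2) powr (- q - 1) \<le> (y\<^sup>2) powr (- q - 1)"
      using y2 ta0 q by (intro powr_mono2') auto
    then have r2: "\<bar>r2\<bar> \<le> C2 * (norm h)\<^sup>2"
      using q by (simp add: r2_def C2_def abs_mult mult_left_mono mult_right_mono)
    have "poisson_kernel s (x + h) y - poisson_kernel s x y - h \<bullet> poisson_gradient s x y = c * (r - r2)"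
      unfolding poisson_kernel_eq poisson_gradient_def ta t_def[symmetric] q_def[symmetric]
          c_def[symmetric]
      by (simp add: r_def r2_def a_def q_def inner_commute algebra_simps)
    also have "\<bar>\<dots>\<bar> = c * \<bar>r - r2\<bar>" using c by (simp add: abs_mult)
    also have "\<dots> \<le> c * (C1 * (norm h)\<^sup>2 + C2 * (norm h)\<^sup>2)"
      using r r2 c by (intro mult_left_mono) auto
    finally show ?thesis by (simp add: algebra_simps)
  qed
  moreover have "0 \<le> c * (C1 + C2)" using c q by (simp add: C1_def C2_def)
  ultimately show ?thesis by blast
qed

lemma poisson_gradient_bound_y:
  fixes x :: "real ^ 'n"
  assumes s: "0 < s" and y: "0 < y"
  shows "norm (poisson_gradient s x y)
      \<le> poisson_const TYPE('n) s * y powr (2 * s) * (real CARD('n) + 2 * s)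
         * (y\<^sup>2) powr (- ((real CARD('n) + 2 * s) / 2) - 1) * norm x"
proof -
  have "((norm x)\<^sup>2 + y\<^sup>2) powr (- ((real CARD('n) + 2 * s) / 2) - 1)
      \<le> (y\<^sup>2) powr (- ((real CARD('n) + 2 * s) / 2) - 1)"
    using assms by (intro powr_mono2') (auto simp: add_nonneg_nonneg)
  then show ?thesis
    using poisson_const_pos[OF s, where 'n = 'n] s
    unfolding poisson_gradient_def by (simp add: abs_mult mult_left_mono mult_right_mono)
qed

lemma poisson_gradient_far:
  fixes x :: "real ^ 'n"
  assumes s: "0 < s" and y: "0 < y" "y \<le> 1" and d: "0 < d" "d \<le> norm x"
  shows "norm (poisson_gradient s x y)
      \<le> poisson_const TYPE('n) s * (real CARD('n) + 2 * s) * d powr (- (real CARD('n) + 2 * s) - 1)"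
proof -
  define e where "e = real CARD('n) + 2 * s"
  define c where "c = poisson_const TYPE('n) s"
  have e: "0 < e" using s by (simp add: e_def)
  have c: "0 < c" using poisson_const_pos[OF s] by (simp add: c_def)
  have x: "0 < norm x" using d by linarith
  have "((norm x)\<^sup>2 + y\<^sup>2) powr (- (e / 2) - 1) \<le> ((norm x)\<^sup>2) powr (- (e / 2) - 1)"
    using x e by (intro powr_mono2') auto
  also have "\<dots> = norm x powr (- e - 2)"
    using x by (simp add: powr_numeral[symmetric] powr_powr algebra_simps del: powr_numeral)
  finally have 1: "((norm x)\<^sup>2 + y\<^sup>2) powr (- (e / 2) - 1) * norm x \<le> norm x powr (- e - 2) * norm x"
    by (intro mult_right_mono) auto
  have "norm x powr (- e - 2) * norm x = norm x powr ((- e - 2) + 1)"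
    using x by (simp only: powr_add) simp
  moreover have "(- e - 2) + 1 = - e - 1" by simp
  ultimately have "norm x powr (- e - 2) * norm x = norm x powr (- e - 1)" by (simp only:)
  also have "\<dots> \<le> d powr (- e - 1)" using d e by (intro powr_mono2') auto
  finally have 2: "((norm x)\<^sup>2 + y\<^sup>2) powr (- (e / 2) - 1) * norm x \<le> d powr (- e - 1)" using 1
      by linarith
  have 3: "y powr (2 * s) \<le> 1" using y s by (simp add: powr_le1)
  have "norm (poisson_gradient s x y)
      = c * e * (y powr (2 * s) * (((norm x)\<^sup>2 + y\<^sup>2) powr (- (e / 2) - 1) * norm x))"
    using c e by (simp add: poisson_gradient_def c_def[symmetric] e_def[symmetric] abs_mult)
  also have "\<dots> \<le> c * e * (1 * d powr (- e - 1))"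
    using c e 2 3 by (intro mult_left_mono mult_mono) auto
  finally show ?thesis by (simp add: c_def e_def)
qed

lemma poisson_gradient_measurable [measurable]:
  "(\<lambda>x :: real ^ 'n. poisson_gradient s x y) \<in> borel_measurable borel"
  unfolding poisson_gradient_def by measurable

text \<open>Differentiation under the integral at fixed height \<open>y\<close>: the first-order remainder of the
  kernel is quadratic in \<open>h\<close>, uniformly over the support of \<open>w\<close>.\<close>
lemma poisson_convolution_gradient:
  fixes w :: "real ^ 'n \<Rightarrow> real" and s y :: real
  assumes s: "0 < s" and y: "0 < y" and x: "norm x < 1"
    and w: "integrable lborel w" and out: "\<And>z. z \<notin> ball 0 1 \<Longrightarrow> w z = 0"
  shows "integrable lborel (\<lambda>z. w z *\<^sub>R poisson_gradient s (x - z) y)"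
    and "GDERIV (\<lambda>x. LINT z|lborel. poisson_kernel s (x - z) y * w z) x :>
        (LINT z|lborel. w z *\<^sub>R poisson_gradient s (x - z) y)"
proof -
  have [measurable]: "w \<in> borel_measurable borel" using w by simp
  obtain C where C: "0 \<le> C" "\<And>x h :: real ^ 'n. norm x \<le> 2 \<Longrightarrow> norm h \<le> 1 \<Longrightarrow>
    \<bar>poisson_kernel s (x + h) y - poisson_kernel s x y - h \<bullet> poisson_gradient s x y\<bar> \<le> C * (norm h)\<^sup>2"
    using poisson_kernel_remainder[OF s y, where 'n = 'n] by blast
  define B where "B = poisson_const TYPE('n) s * y powr (2 * s) * (real CARD('n) + 2 * s)
         * (y\<^sup>2) powr (- ((real CARD('n) + 2 * s) / 2) - 1)"
  have B: "0 \<le> B" using poisson_const_pos[OF s, where 'n = 'n] s by (simp add: B_def)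
  have xz: "norm (x - z) \<le> 2" if "w z \<noteq> 0" for z
    using that out[of z] x norm_triangle_ineq4[of x z] by (cases "z \<in> ball 0 1") auto
  show intG: "integrable lborel (\<lambda>z. w z *\<^sub>R poisson_gradient s (x - z) y)"
  proof (rule Bochner_Integration.integrable_bound)
    show "integrable lborel (\<lambda>z. (B * 2) * w z)" using w by simp
    show "AE z in lborel. norm (w z *\<^sub>R poisson_gradient s (x - z) y) \<le> norm ((B * 2) * w z)"
    proof (rule AE_I2)
      fix z
      show "norm (w z *\<^sub>R poisson_gradient s (x - z) y) \<le> norm ((B * 2) * w z)"
      proof (cases "w z = 0")
        case False
        have "norm (poisson_gradient s (x - z) y) \<le> B * norm (x - z)"
          using poisson_gradient_bound_y[OF s y, of "x - z"] by (simp add: B_def)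
        also have "\<dots> \<le> B * 2" using xz[OF False] B by (rule mult_left_mono)
        finally have "\<bar>w z\<bar> * norm (poisson_gradient s (x - z) y) \<le> \<bar>w z\<bar> * (B * 2)"
            by (intro mult_left_mono) auto
        then show ?thesis using B by (simp add: abs_mult mult_ac)
      qed simp
    qed
  qed measurable
  define v where "v x = (LINT z|lborel. poisson_kernel s (x - z) y * w z)" for x :: "real ^ 'n"
  define D where "D = (LINT z|lborel. w z *\<^sub>R poisson_gradient s (x - z) y)"
  have intP: "integrable lborel (\<lambda>z. poisson_kernel s (x - z) y * w z)" for x :: "real ^ 'n"
  proof -
    have "integrable lborel (\<lambda>z. w z * poisson_kernel s (x - z) y)"
      by (rule integrable_mult_bounded[OF w _ poisson_kernel_bounded[OF s y]]) measurable
    then show ?thesis by (simp add: mult.commute)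
  qed
  have rem: "\<bar>v (x + h) - v x - h \<bullet> D\<bar> \<le> C * (LINT z|lborel. \<bar>w z\<bar>) * (norm h)\<^sup>2" if h: "norm h \<le> 1"
      for h
  proof -
    let ?F = "\<lambda>z. (poisson_kernel s (x - z + h) y - poisson_kernel s (x - z) y
        - h \<bullet> poisson_gradient s (x - z) y) * w z"
    have eq: "?F z = poisson_kernel s (x + h - z) y * w z - poisson_kernel s (x - z) y * w z
        - h \<bullet> (w z *\<^sub>R poisson_gradient s (x - z) y)" for z
      by (simp add: algebra_simps)
    have intF: "integrable lborel ?F"
      unfolding eq using intP intG by (intro Bochner_Integration.integrable_diff integrable_inner_right)
    have "v (x + h) - v x - h \<bullet> D = (LINT z|lborel. ?F z)"
      unfolding eq v_def D_def using intP intG by (simp del: inner_scaleR_right)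
    also have "\<bar>\<dots>\<bar> \<le> (LINT z|lborel. \<bar>?F z\<bar>)" by (rule integral_abs_bound)
    also have "\<dots> \<le> (LINT z|lborel. (C * (norm h)\<^sup>2) * \<bar>w z\<bar>)"
    proof (rule integral_mono)
      fix z
      show "\<bar>?F z\<bar> \<le> (C * (norm h)\<^sup>2) * \<bar>w z\<bar>"
      proof (cases "w z = 0")
        case False
        then show ?thesis using C(2)[OF xz[OF False] h] by (simp add: abs_mult mult_right_mono)
      qed simp
    qed (use w intF in auto)
    finally show ?thesis by (simp add: mult_ac)
  qed
  define J where "J = C * (LINT z|lborel. \<bar>w z\<bar>)"
  have J: "0 \<le> J" using C by (simp add: J_def)
  show "GDERIV (\<lambda>x. LINT z|lborel. poisson_kernel s (x - z) y * w z) x :>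
      (LINT z|lborel. w z *\<^sub>R poisson_gradient s (x - z) y)"
    unfolding gderiv_def v_def[symmetric] D_def[symmetric] has_derivative_at
  proof (intro conjI)
    show "bounded_linear (\<lambda>h. h \<bullet> D)" by (rule bounded_linear_inner_left)
    show "(\<lambda>h. norm (v (x + h) - v x - h \<bullet> D) / norm h) \<midarrow>0\<rightarrow> 0"
    proof (rule Lim_null_comparison)
      have "eventually (\<lambda>h::real ^ 'n. norm h < 1) (at 0)"
        by (auto simp: eventually_at intro!: exI[of _ 1])
      then show "eventually (\<lambda>h. norm (norm (v (x + h) - v x - h \<bullet> D) / norm h) \<le> J * norm h) (at 0)"
      proof eventually_elim
        case (elim h)
        show ?case
        proof (cases "h = 0")
          case False
          then show ?thesis using rem[of h] elim by (simp add: J_def power2_eq_square field_simps)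
        qed (simp add: J)
      qed
      show "((\<lambda>h::real ^ 'n. J * norm h) \<longlongrightarrow> 0) (at 0)"
        by (auto intro!: tendsto_eq_intros)
    qed
  qed
qed

lemma GDERIV_norm_le:
  fixes F :: "'a::real_inner \<Rightarrow> real"
  assumes D: "GDERIV F x :> D" and L: "\<And>h. \<bar>F (x + h) - F x\<bar> \<le> L * norm h" and L0: "0 \<le> L"
  shows "norm D \<le> L"
proof (cases "D = 0")
  case True
  with L0 show ?thesis by simp
next
  case False
  define e where "e = D /\<^sub>R norm D"
  have e: "norm e = 1" using False by (simp add: e_def)
  have eD: "e \<bullet> D = norm D" using False
      by (simp add: e_def power2_norm_eq_inner[symmetric] power2_eq_square)
  have "((\<lambda>t. F (x + t *\<^sub>R e)) has_derivative (\<lambda>t. (t *\<^sub>R e) \<bullet> D)) (at 0)"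
    using D unfolding gderiv_def
    by (intro has_derivative_compose[where f = "\<lambda>t. x + t *\<^sub>R e" and f' = "\<lambda>t. t *\<^sub>R e" and g = F
        and s = UNIV])
       (auto intro!: derivative_eq_intros)
  then have "((\<lambda>t. F (x + t *\<^sub>R e)) has_real_derivative norm D) (at 0)"
    unfolding has_field_derivative_def by (simp add: eD mult.commute[of _ "norm D"])
  then have "((\<lambda>t. (F (x + t *\<^sub>R e) - F x) / t) \<longlongrightarrow> norm D) (at 0)"
    by (simp add: DERIV_def)
  then show ?thesis
  proof (rule tendsto_upperbound)
    show "eventually (\<lambda>t. (F (x + t *\<^sub>R e) - F x) / t \<le> L) (at 0)"
    proof (rule eventually_at_topological[THEN iffD2], intro exI[of _ UNIV] conjI ballI impI)
      fix t :: real assume t: "t \<noteq> 0"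
      have "(F (x + t *\<^sub>R e) - F x) / t \<le> \<bar>F (x + t *\<^sub>R e) - F x\<bar> / \<bar>t\<bar>"
        by (metis abs_divide abs_ge_self)
      also have "\<dots> \<le> L" using L[of "t *\<^sub>R e"] t e by (simp add: field_simps)
      finally show "(F (x + t *\<^sub>R e) - F x) / t \<le> L" .
    qed auto
  qed auto
qed

lemma poisson_convolution_Lipschitz:
  fixes w :: "real ^ 'n \<Rightarrow> real" and s y :: real
  assumes s: "0 < s" and y: "0 < y" and w: "integrable lborel w"
      and L: "\<And>p q. \<bar>w p - w q\<bar> \<le> L * norm (p - q)"
  shows "\<bar>(LINT z|lborel. poisson_kernel s (x + h - z) y * w z)
      - (LINT z|lborel. poisson_kernel s (x - z) y * w z)\<bar> \<le> L * norm h"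
proof -
  have [measurable]: "w \<in> borel_measurable borel" using w by simp
  have eq: "(LINT z|lborel. poisson_kernel s (x - z) y * w z)
      = (LINT z|lborel. poisson_kernel s z y * w (x - z))" for x :: "real ^ 'n"
    by (subst lborel_integral_reflect[of _ x]) simp
  have int: "integrable lborel (\<lambda>z. poisson_kernel s z y * w (x - z))" for x :: "real ^ 'n"
  proof -
    have "integrable lborel (\<lambda>z. w (x - z) * poisson_kernel s z y)"
      by (rule integrable_mult_bounded[OF lborel_integrable_reflect[OF w] _
          poisson_kernel_bounded[OF s y]]) measurable
    then show ?thesis by (simp add: mult.commute)
  qed
  have "(LINT z|lborel. poisson_kernel s (x + h - z) y * w z)
      - (LINT z|lborel. poisson_kernel s (x - z) y * w z)
     = (LINT z|lborel. poisson_kernel s z y * w (x + h - z) - poisson_kernel s z y * w (x - z))"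
    unfolding eq using int by simp
  also have "\<bar>\<dots>\<bar> \<le> (LINT z|lborel. \<bar>poisson_kernel s z y * w (x + h - z)
      - poisson_kernel s z y * w (x - z)\<bar>)"
    by (rule integral_abs_bound)
  also have "\<dots> \<le> (LINT z|lborel. poisson_kernel s (z :: real ^ 'n) y * (L * norm h))"
  proof (rule integral_mono)
    fix z
    have "poisson_kernel s z y * \<bar>w (x + h - z) - w (x - z)\<bar> \<le> poisson_kernel s z y * (L * norm h)"
      using L[of "x + h - z" "x - z"] poisson_kernel_nonneg[OF s] by (intro mult_left_mono) auto
    then show "\<bar>poisson_kernel s z y * w (x + h - z) - poisson_kernel s z y * w (x - z)\<bar>
        \<le> poisson_kernel s z y * (L * norm h)"
      using poisson_kernel_nonneg[OF s, of z y] by (simp add: right_diff_distrib[symmetric] abs_mult)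
  qed (use int poisson_kernel_integral[OF s y, where 'n = 'n] in auto)
  also have "\<dots> = L * norm h"
    using poisson_kernel_integral[OF s y, where 'n = 'n] by simp
  finally show ?thesis .
qed

section \<open>The gradient bound\<close>

lemma Linf_norm_AE:
  fixes g :: "'a::euclidean_space \<Rightarrow> real"
  assumes S [measurable]: "S \<in> sets borel" and [measurable]: "g \<in> borel_measurable borel"
    and B: "\<And>x. x \<in> S \<Longrightarrow> \<bar>g x\<bar> \<le> B"
  shows "AE x in lborel. x \<in> S \<longrightarrow> \<bar>g x\<bar> \<le> real_of_ereal (Linf_norm S g)"
proof -
  define N where "N = Linf_norm S g"
  have "(\<lambda>x. ereal (norm (g x))) \<in> borel_measurable (restrict_space lborel S)"
    by (intro measurable_restrict_space1) measurable
  moreover have "AE x in restrict_space lborel S. ereal (norm (g x)) \<le> ereal B"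
    using B by (subst AE_restrict_space_iff) auto
  ultimately have "N \<le> ereal B" unfolding N_def Linf_norm_def by (rule esssup_I)
  then have "N \<noteq> \<infinity>" by auto
  have "AE x in restrict_space lborel S. ereal (norm (g x)) \<le> N"
    unfolding N_def Linf_norm_def by (rule esssup_AE)
  then have "AE x in lborel. x \<in> S \<longrightarrow> ereal (norm (g x)) \<le> N"
    by (subst (asm) AE_restrict_space_iff) auto
  then show ?thesis
  proof eventually_elim
    case (elim x)
    show ?case
    proof
      assume "x \<in> S"
      with elim have "ereal \<bar>g x\<bar> \<le> N" by simp
      with \<open>N \<noteq> \<infinity>\<close> show "\<bar>g x\<bar> \<le> real_of_ereal (Linf_norm S g)"
        unfolding N_def[symmetric] by (cases N) auto
    qed
  qed
qed

text \<open>A cutoff in the radius, equal to 1 between 15/32 and 25/32 and supported between 14/32 and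
  26/32. The first interval exceeds the interval from 1/2 to 3/4 by 1/32 on either side.\<close>

definition trapezoid :: "real \<Rightarrow> real" where
  "trapezoid r = max 0 (min 1 (min (32 * r - 14) (26 - 32 * r)))"

lemma trapezoid_bounds: "0 \<le> trapezoid r" "trapezoid r \<le> 1"
  by (auto simp: trapezoid_def)

lemma trapezoid_eq_1: "15/32 \<le> r \<Longrightarrow> r \<le> 25/32 \<Longrightarrow> trapezoid r = 1"
  by (auto simp: trapezoid_def)

lemma trapezoid_eq_0: "r \<notin> {7/16..13/16} \<Longrightarrow> trapezoid r = 0"
  by (auto simp: trapezoid_def min_def max_def)

lemma trapezoid_Lipschitz: "\<bar>trapezoid r - trapezoid t\<bar> \<le> 32 * \<bar>r - t\<bar>"
  unfolding trapezoid_def by (auto simp: min_def max_def abs_if split: if_splits)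

lemma trapezoid_mult_Lipschitz:
  assumes \<Lambda>: "0 \<le> \<Lambda>" and M: "\<And>r. r \<in> {7/16..13/16} \<Longrightarrow> \<bar>\<phi> r\<bar> \<le> M"
    and Lip: "\<And>r t. r \<in> {7/16..13/16} \<Longrightarrow> t \<in> {7/16..13/16} \<Longrightarrow> \<bar>\<phi> r - \<phi> t\<bar> \<le> \<Lambda> * \<bar>r - t\<bar>"
  shows "\<bar>trapezoid r * \<phi> r - trapezoid t * \<phi> t\<bar> \<le> (\<Lambda> + 32 * M) * \<bar>r - t\<bar>"
proof -
  have M0: "0 \<le> M" using M[of "1/2"] by auto
  have cut: "\<bar>trapezoid r - trapezoid t\<bar> * \<bar>\<phi> t\<bar> \<le> 32 * M * \<bar>r - t\<bar>" if "t \<in> {7/16..13/16}" for r t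
  proof -
    have "\<bar>trapezoid r - trapezoid t\<bar> * \<bar>\<phi> t\<bar> \<le> (32 * \<bar>r - t\<bar>) * M"
      using trapezoid_Lipschitz M[OF that] by (intro mult_mono) auto
    then show ?thesis by (simp add: mult_ac)
  qed
  have L0: "0 \<le> \<Lambda> * \<bar>r - t\<bar>" "0 \<le> 32 * M * \<bar>r - t\<bar>" using \<Lambda> M0 by auto
  consider "t \<in> {7/16..13/16}" "r \<in> {7/16..13/16}" | "t \<in> {7/16..13/16}" "r \<notin> {7/16..13/16}"
    | "t \<notin> {7/16..13/16}" "r \<in> {7/16..13/16}" | "t \<notin> {7/16..13/16}" "r \<notin> {7/16..13/16}" by blast
  then show ?thesis
  proof cases
    case 1
    have "trapezoid r * \<phi> r - trapezoid t * \<phi> t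
        = trapezoid r * (\<phi> r - \<phi> t) + (trapezoid r - trapezoid t) * \<phi> t"
      by (simp add: algebra_simps)
    also have "\<bar>\<dots>\<bar> \<le> trapezoid r * \<bar>\<phi> r - \<phi> t\<bar> + \<bar>trapezoid r - trapezoid t\<bar> * \<bar>\<phi> t\<bar>"
      using trapezoid_bounds[of r] by (intro order_trans[OF abs_triangle_ineq]) (simp add: abs_mult)
    also have "trapezoid r * \<bar>\<phi> r - \<phi> t\<bar> \<le> 1 * (\<Lambda> * \<bar>r - t\<bar>)"
      using trapezoid_bounds[of r] Lip[OF 1(2) 1(1)] by (intro mult_mono) auto
    finally show ?thesis using cut[OF 1(1), of r] by (simp add: distrib_right)
  next
    case 2
    then show ?thesis using cut[OF 2(1), of r] L0 trapezoid_eq_0[OF 2(2)]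
      by (simp add: abs_mult distrib_right)
  next
    case 3
    then show ?thesis using cut[OF 3(2), of t] L0 trapezoid_eq_0[OF 3(1)]
      by (simp add: abs_mult distrib_right abs_minus_commute)
  next
    case 4
    then show ?thesis using L0 trapezoid_eq_0[OF 4(1)] trapezoid_eq_0[OF 4(2)]
      by (simp add: distrib_right)
  qed
qed

lemma gradient_x_eqI:
  assumes "has_gradient_x v p D"
  shows "gradient_x v p = D"
  unfolding gradient_x_def
proof (rule the_equality, rule assms)
  fix D' assume "has_gradient_x v p D'"
  then have "(\<lambda>h. h \<bullet> D') = (\<lambda>h. h \<bullet> D)"
    using assms unfolding has_gradient_x_def gderiv_def by (rule has_derivative_unique)
  then have "(D' - D) \<bullet> D' = (D' - D) \<bullet> D" by metis
  then have "(D' - D) \<bullet> (D' - D) = 0" by (subst inner_diff_right) simp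
  then show "D' = D" by simp
qed

text \<open>Split \<open>u = w + w'\<close> by the cutoff. The gradient of the extension of \<open>w\<close> is at most the
  Lipschitz constant of \<open>w\<close>; the integral for \<open>w'\<close> only sees the gradient of the kernel at points
  of norm at least 1/32.\<close>
lemma extension_gradient_bound:
  fixes u :: "real ^ 'n \<Rightarrow> real" and s y :: real
  assumes s: "0 < s" and y: "0 < y" "y < 1" and x: "1/2 < norm x" "norm x < 3/4"
    and u: "integrable lborel u" and out: "\<And>z. z \<notin> ball 0 1 \<Longrightarrow> u z = 0" and rad: "radial_profile u \<phi>"
    and \<Lambda>: "0 \<le> \<Lambda>" and M: "\<And>r. r \<in> {7/16..13/16} \<Longrightarrow> \<bar>\<phi> r\<bar> \<le> M"
    and Lip: "\<And>r t. r \<in> {7/16..13/16} \<Longrightarrow> t \<in> {7/16..13/16} \<Longrightarrow> \<bar>\<phi> r - \<phi> t\<bar> \<le> \<Lambda> * \<bar>r - t\<bar>"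
  shows "has_gradient_x (s_harmonic_ext s u) (x, y)
      (LINT z|lborel. u z *\<^sub>R poisson_gradient s (x - z) y)"
    and "norm (LINT z|lborel. u z *\<^sub>R poisson_gradient s (x - z) y)
      \<le> (\<Lambda> + 32 * M) + poisson_const TYPE('n) s * (real CARD('n) + 2 * s)
          * (1/32) powr (- (real CARD('n) + 2 * s) - 1) * (LINT z|lborel. \<bar>u z\<bar>)"
proof -
  define w where "w z = trapezoid (norm z) * u z" for z
  define w' where "w' z = (1 - trapezoid (norm z)) * u z" for z
  have [measurable]: "u \<in> borel_measurable borel" using u by simp
  have [measurable]: "trapezoid \<in> borel_measurable borel" unfolding trapezoid_def[abs_def] by measurable
  have x1: "norm x < 1" using x by simp
  have "integrable lborel (\<lambda>z. u z * trapezoid (norm z))"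
    using trapezoid_bounds by (intro integrable_mult_bounded[where B = 1] u) auto
  then have w: "integrable lborel w" by (simp add: w_def[abs_def] mult.commute)
  have "integrable lborel (\<lambda>z. u z * (1 - trapezoid (norm z)))"
    using trapezoid_bounds by (intro integrable_mult_bounded[where B = 1] u) auto
  then have w': "integrable lborel w'" by (simp add: w'_def[abs_def] mult.commute)
  note grad = poisson_convolution_gradient[OF s y(1) x1]
  show "has_gradient_x (s_harmonic_ext s u) (x, y)
      (LINT z|lborel. u z *\<^sub>R poisson_gradient s (x - z) y)"
    unfolding has_gradient_x_def s_harmonic_ext_def using grad(2)[OF u out] by simp
  define \<psi> where "\<psi> r = trapezoid r * \<phi> r" for r
  have w_eq: "w z = \<psi> (norm z)" for z
  proof (cases "norm z \<in> {7/16..13/16}")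
    case True
    then have "u z = \<phi> (norm z)" by (intro radial_profile_eq[OF rad]) auto
    then show ?thesis by (simp add: w_def \<psi>_def)
  next
    case False
    then show ?thesis by (simp add: w_def \<psi>_def trapezoid_eq_0)
  qed
  have M0: "0 \<le> M" using M[of "1/2"] by auto
  have wLip: "\<bar>w p - w q\<bar> \<le> (\<Lambda> + 32 * M) * norm (p - q)" for p q
  proof -
    have "\<bar>w p - w q\<bar> \<le> (\<Lambda> + 32 * M) * \<bar>norm p - norm q\<bar>"
      unfolding w_eq \<psi>_def using \<Lambda> M Lip by (rule trapezoid_mult_Lipschitz)
    also have "\<dots> \<le> (\<Lambda> + 32 * M) * norm (p - q)"
      using \<Lambda> M0 by (intro mult_left_mono norm_triangle_ineq3) auto
    finally show ?thesis .
  qed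
  have w_out: "w z = 0" and w'_out: "w' z = 0" if "z \<notin> ball 0 1" for z
    using out[OF that] by (auto simp: w_def w'_def)
  have near: "norm (LINT z|lborel. w z *\<^sub>R poisson_gradient s (x - z) y) \<le> \<Lambda> + 32 * M"
  proof (rule GDERIV_norm_le)
    show "GDERIV (\<lambda>x. LINT z|lborel. poisson_kernel s (x - z) y * w z) x :>
        (LINT z|lborel. w z *\<^sub>R poisson_gradient s (x - z) y)"
      using w w_out by (rule grad(2))
  qed (use poisson_convolution_Lipschitz[OF s y(1) w wLip] \<Lambda> M0 in auto)
  define G where "G = poisson_const TYPE('n) s * (real CARD('n) + 2 * s)
      * (1/32) powr (- (real CARD('n) + 2 * s) - 1)"
  have G: "0 \<le> G" using poisson_const_pos[OF s, where 'n = 'n] s by (simp add: G_def)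
  have "norm (LINT z|lborel. w' z *\<^sub>R poisson_gradient s (x - z) y)
      \<le> (LINT z|lborel. norm (w' z *\<^sub>R poisson_gradient s (x - z) y))"
    by (rule integral_norm_bound)
  also have "\<dots> \<le> (LINT z|lborel. G * \<bar>u z\<bar>)"
  proof (rule integral_mono)
    show "integrable lborel (\<lambda>z. norm (w' z *\<^sub>R poisson_gradient s (x - z) y))"
      using grad(1)[OF w' w'_out] by (rule integrable_norm)
    fix z
    show "norm (w' z *\<^sub>R poisson_gradient s (x - z) y) \<le> G * \<bar>u z\<bar>"
    proof (cases "norm z \<in> {15/32..25/32}")
      case True
      then show ?thesis using G by (simp add: w'_def trapezoid_eq_1)
    next
      case False
      then have "1/32 \<le> \<bar>norm x - norm z\<bar>" using x by auto
      also have "\<dots> \<le> norm (x - z)" by (rule norm_triangle_ineq3)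
      finally have "norm (poisson_gradient s (x - z) y) \<le> G"
        unfolding G_def using s y by (intro poisson_gradient_far) auto
      moreover have "\<bar>w' z\<bar> \<le> \<bar>u z\<bar>"
        using trapezoid_bounds[of "norm z"] by (simp add: w'_def abs_mult mult_left_le_one_le)
      ultimately have "\<bar>w' z\<bar> * norm (poisson_gradient s (x - z) y) \<le> \<bar>u z\<bar> * G"
        by (intro mult_mono) auto
      then show ?thesis by (simp add: mult.commute)
    qed
  qed (use u in auto)
  finally have far: "norm (LINT z|lborel. w' z *\<^sub>R poisson_gradient s (x - z) y)
      \<le> G * (LINT z|lborel. \<bar>u z\<bar>)" by simp
  have split: "w z + w' z = u z" for z by (simp add: w_def w'_def algebra_simps)
  have "(LINT z|lborel. u z *\<^sub>R poisson_gradient s (x - z) y)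
      = (LINT z|lborel. w z *\<^sub>R poisson_gradient s (x - z) y + w' z *\<^sub>R poisson_gradient s (x - z) y)"
    by (simp only: scaleR_add_left[symmetric] split)
  also have "\<dots> = (LINT z|lborel. w z *\<^sub>R poisson_gradient s (x - z) y)
      + (LINT z|lborel. w' z *\<^sub>R poisson_gradient s (x - z) y)"
    using grad(1)[OF w w_out] grad(1)[OF w' w'_out] by (rule Bochner_Integration.integral_add)
  finally show "norm (LINT z|lborel. u z *\<^sub>R poisson_gradient s (x - z) y)
      \<le> (\<Lambda> + 32 * M) + poisson_const TYPE('n) s * (real CARD('n) + 2 * s)
          * (1/32) powr (- (real CARD('n) + 2 * s) - 1) * (LINT z|lborel. \<bar>u z\<bar>)"
    using norm_triangle_mono[OF near far] by (simp add: G_def)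
qed

lemma gradient_x_measurable:
  fixes u :: "real ^ 'n \<Rightarrow> real"
  assumes [measurable]: "u \<in> borel_measurable borel"
    and grad: "\<And>x y. (x, y) \<in> annular_cylinder \<Longrightarrow>
      gradient_x (s_harmonic_ext s u) (x, y) = (LINT z|lborel. u z *\<^sub>R poisson_gradient s (x - z) y)"
  shows "gradient_x (s_harmonic_ext s u) \<in> borel_measurable (restrict_space lborel annular_cylinder)"
proof -
  let ?F = "\<lambda>p :: (real ^ 'n) \<times> real. LINT z|lborel. u z *\<^sub>R poisson_gradient s (fst p - z) (snd p)"
  have [measurable]: "(\<lambda>q :: ((real ^ 'n) \<times> real) \<times> (real ^ 'n). fst (fst q) - snd q) \<in> borel_measurable
      borel"
    "(\<lambda>q :: ((real ^ 'n) \<times> real) \<times> (real ^ 'n). snd (fst q)) \<in> borel_measurable borel"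
    "(\<lambda>q :: ((real ^ 'n) \<times> real) \<times> (real ^ 'n). snd q) \<in> borel_measurable borel"
    by (intro borel_measurable_continuous_onI continuous_intros)+
  have [measurable]: "(\<lambda>q :: ((real ^ 'n) \<times> real) \<times> (real ^ 'n). u (snd q)) \<in> borel_measurable borel"
    by (rule measurable_compose[where f = snd and N = borel]) measurable
  have "(\<lambda>q :: ((real ^ 'n) \<times> real) \<times> (real ^ 'n). u (snd q) *\<^sub>R poisson_gradient s
      (fst (fst q) - snd q) (snd (fst q)))
      \<in> borel_measurable borel"
    unfolding poisson_gradient_def by measurable
  then have "(\<lambda>(p, z). u z *\<^sub>R poisson_gradient s (fst p - z) (snd p))
      \<in> borel_measurable (lborel \<Otimes>\<^sub>M (lborel :: (real ^ 'n) measure))"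
    by (simp add: lborel_prod split_beta)
  then have "?F \<in> borel_measurable lborel"
    by (rule lborel.borel_measurable_lebesgue_integral)
  then have "?F \<in> borel_measurable (restrict_space lborel annular_cylinder)"
    by (rule measurable_restrict_space1)
  moreover have "gradient_x (s_harmonic_ext s u) p = ?F p"
      if "p \<in> space (restrict_space lborel annular_cylinder)" for p
    using that grad[of "fst p" "snd p"] by (simp add: space_restrict_space)
  ultimately show ?thesis by (subst measurable_cong) auto
qed

theorem proposition3p4:
  fixes s :: real
  assumes "0 < s" and "s < 1"
  shows "\<exists>C :: real \<Rightarrow> ereal \<Rightarrow> ereal \<Rightarrow> real.
    \<forall>(f :: real \<Rightarrow> real) (u :: real ^ 'n \<Rightarrow> real).
      mono f \<and> class_C2 f \<and> u \<in> frac_sobolev s \<and>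
      radially_decreasing u \<and> weak_solution s f u \<longrightarrow>
      (\<forall>p\<in>annular_cylinder. \<exists>D. has_gradient_x (s_harmonic_ext s u) p D) \<and>
      Linf_norm annular_cylinder (gradient_x (s_harmonic_ext s u))
        \<le> ereal (C (L1_norm (ball 0 1) u)
                   (Linf_norm (ball 0 (7/8) - ball 0 (3/8)) u)
                   (Linf_norm (ball 0 (7/8) - ball 0 (3/8)) (\<lambda>x. deriv f (u x))))"
proof -
  note s = assms
  obtain L where L0: "\<And>K. 0 \<le> K \<Longrightarrow> 0 \<le> L K" and L:
    "\<And>f (u :: real ^ 'n \<Rightarrow> real) \<phi> M K r r'. \<lbrakk>
      class_C2 f; weak_solution s f u; u \<in> borel_measurable borel; radial_profile u \<phi>; 0 \<le> K;
      AE x in lborel. x \<in> ball 0 (7/8) - ball 0 (3/8) \<longrightarrow> \<bar>u x\<bar> \<le> M;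
      AE x in lborel. x \<in> ball 0 (7/8) - ball 0 (3/8) \<longrightarrow> \<bar>deriv f (u x)\<bar> \<le> K;
      r \<in> {7/16..13/16}; r' \<in> {7/16..13/16}\<rbrakk> \<Longrightarrow>
      \<bar>\<phi> r - \<phi> r'\<bar> \<le> (L K * (LINT z|lborel. \<bar>u z\<bar>) + 512 * M) * \<bar>r - r'\<bar>"
    by (rule solution_profile_Lipschitz[OF s, where 'n = 'n]) blast
  define G where "G = poisson_const TYPE('n) s * (real CARD('n) + 2 * s)
      * (1/32) powr (- (real CARD('n) + 2 * s) - 1)"
  \<comment> \<open>For an admissible solution both essential suprema are finite, so \<open>real_of_ereal\<close> loses nothing;
    the maximum with 0 supplies the sign under which \<open>L\<close> was chosen.\<close>
  define C where "C I M K = (L (max 0 (real_of_ereal K)) * I + 512 * real_of_ereal M)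
      + 32 * real_of_ereal M + G * I" for I and M K
  have main: "(\<forall>p\<in>annular_cylinder. \<exists>D. has_gradient_x (s_harmonic_ext s u) p D) \<and>
      Linf_norm annular_cylinder (gradient_x (s_harmonic_ext s u))
        \<le> ereal (C (L1_norm (ball 0 1) u)
                   (Linf_norm (ball 0 (7/8) - ball 0 (3/8)) u)
                   (Linf_norm (ball 0 (7/8) - ball 0 (3/8)) (\<lambda>x. deriv f (u x))))"
    if f: "class_C2 f" and uS: "u \<in> frac_sobolev s" and urad: "radially_decreasing u"
        and weak: "weak_solution s f u"
    for f and u :: "real ^ 'n \<Rightarrow> real"
  proof -
    let ?S = "ball 0 (7/8) - ball 0 (3/8) :: (real ^ 'n) set"
    have um [measurable]: "u \<in> borel_measurable borel" using uS by (simp add: frac_sobolev_def)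
    obtain \<phi> where rad: "radial_profile u \<phi>" using urad
        by (auto simp: radially_decreasing_def radial_profile_def)
    have out: "u z = 0" if "z \<notin> ball 0 1" for z using weak that by (auto simp: weak_solution_def)
    have e1: "indicator (ball 0 1) z *\<^sub>R u z = u z" "indicator (ball 0 1) z *\<^sub>R \<bar>u z\<bar> = \<bar>u z\<bar>" for z
      using out[of z] by (auto simp: indicator_def)
    have "set_integrable lborel (ball 0 1) u" using weak unfolding weak_solution_def by blast
    then have u: "integrable lborel u" by (simp only: set_integrable_def e1)
    define I where "I = (LINT z|lborel. \<bar>u z\<bar>)"
    have I: "0 \<le> I" by (simp add: I_def)
    have I_eq: "L1_norm (ball 0 1) u = I"
      by (simp only: L1_norm_def set_lebesgue_integral_def e1 I_def)
    define M where "M = real_of_ereal (Linf_norm ?S u)"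
    define K where "K = real_of_ereal (Linf_norm ?S (\<lambda>x. deriv f (u x)))"
    have f'c: "continuous_on A (deriv f)" for A
      using f by (auto simp: class_C2_def intro: continuous_at_imp_continuous_on
          field_differentiable_imp_continuous_at)
    have [measurable]: "deriv f \<in> borel_measurable borel"
        by (rule borel_measurable_continuous_onI[OF f'c])
    have range: "u x \<in> {\<phi> (7/8)..\<phi> (3/8)}" if "x \<in> ?S" for x
    proof -
      have x: "3/8 \<le> norm x" "norm x < 7/8" using that by auto
      then have "u x = \<phi> (norm x)" by (intro radial_profile_eq[OF rad]) auto
      then show ?thesis using x by (auto intro!: radial_profile_antimono[OF rad])
    qed
    have "bounded (deriv f ` {\<phi> (7/8)..\<phi> (3/8)})"
      using compact_continuous_image[OF f'c] compact_Icc compact_imp_bounded by blast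
    then obtain B where "\<forall>t\<in>{\<phi> (7/8)..\<phi> (3/8)}. \<bar>deriv f t\<bar> \<le> B"
      unfolding bounded_iff by auto
    then have B: "\<bar>deriv f t\<bar> \<le> B" if "t \<in> {\<phi> (7/8)..\<phi> (3/8)}" for t using that by blast
    have M_AE: "AE x in lborel. x \<in> ?S \<longrightarrow> \<bar>u x\<bar> \<le> M"
      unfolding M_def
    proof (rule Linf_norm_AE[where B = "max \<bar>\<phi> (7/8)\<bar> \<bar>\<phi> (3/8)\<bar>"])
      fix x assume "x \<in> ?S"
      from range[OF this] show "\<bar>u x\<bar> \<le> max \<bar>\<phi> (7/8)\<bar> \<bar>\<phi> (3/8)\<bar>" by auto
    qed auto
    have "AE x in lborel. x \<in> ?S \<longrightarrow> \<bar>deriv f (u x)\<bar> \<le> K"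
      unfolding K_def using range B by (intro Linf_norm_AE[where B = B]) auto
    then have K_AE: "AE x in lborel. x \<in> ?S \<longrightarrow> \<bar>deriv f (u x)\<bar> \<le> max 0 K"
      by (auto elim!: eventually_mono)
    have \<phi>M: "\<bar>\<phi> r\<bar> \<le> M" if "r \<in> {7/16..13/16}" for r
      using that by (intro radial_profile_AE_bounded[OF rad M_AE]) auto
    have M0: "0 \<le> M" using \<phi>M[of "1/2"] by auto
    define \<Lambda> where "\<Lambda> = L (max 0 K) * I + 512 * M"
    have \<Lambda>: "0 \<le> \<Lambda>" using L0[of "max 0 K"] I M0 by (simp add: \<Lambda>_def)
    have Lip: "\<bar>\<phi> r - \<phi> t\<bar> \<le> \<Lambda> * \<bar>r - t\<bar>" if "r \<in> {7/16..13/16}" "t \<in> {7/16..13/16}" for r t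
      unfolding \<Lambda>_def I_def using L[OF f weak um rad _ M_AE K_AE that] by simp
    have mem: "1/2 < norm x" "norm x < 3/4" "0 < y" "y < 1" if "(x, y) \<in> annular_cylinder"
        for x :: "real ^ 'n" and y
      using that by (auto simp: annular_cylinder_def)
    have grad: "has_gradient_x (s_harmonic_ext s u) (x, y)
        (LINT z|lborel. u z *\<^sub>R poisson_gradient s (x - z) y)"
      and bound: "norm (LINT z|lborel. u z *\<^sub>R poisson_gradient s (x - z) y)
          \<le> C I (Linf_norm ?S u) (Linf_norm ?S (\<lambda>x. deriv f (u x)))"
      if "(x, y) \<in> annular_cylinder" for x :: "real ^ 'n" and y
    proof -
      note b = extension_gradient_bound[OF s(1) mem(3)[OF that] mem(4)[OF that] mem(1)[OF that]
          mem(2)[OF that] u out rad \<Lambda> \<phi>M Lip]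
      show "has_gradient_x (s_harmonic_ext s u) (x, y)
          (LINT z|lborel. u z *\<^sub>R poisson_gradient s (x - z) y)"
        by (rule b(1))
      show "norm (LINT z|lborel. u z *\<^sub>R poisson_gradient s (x - z) y)
          \<le> C I (Linf_norm ?S u) (Linf_norm ?S (\<lambda>x. deriv f (u x)))"
        using b(2) by (simp add: C_def M_def[symmetric] K_def[symmetric] \<Lambda>_def G_def I_def)
    qed
    have geq: "gradient_x (s_harmonic_ext s u) (x, y)
        = (LINT z|lborel. u z *\<^sub>R poisson_gradient s (x - z) y)"
      if "(x, y) \<in> annular_cylinder" for x :: "real ^ 'n" and y
      using grad[OF that] by (rule gradient_x_eqI)
    have "annular_cylinder \<in> sets (borel :: ((real ^ 'n) \<times> real) measure)"
      unfolding annular_cylinder_def borel_prod[symmetric] by (intro pair_measureI) auto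
    then have cyl: "annular_cylinder \<inter> space lborel \<in> sets (lborel :: ((real ^ 'n) \<times> real) measure)"
        by simp
    have "Linf_norm annular_cylinder (gradient_x (s_harmonic_ext s u))
        \<le> ereal (C I (Linf_norm ?S u) (Linf_norm ?S (\<lambda>x. deriv f (u x))))"
      unfolding Linf_norm_def
    proof (rule esssup_I)
      have [measurable]: "gradient_x (s_harmonic_ext s u) \<in> borel_measurable
          (restrict_space lborel annular_cylinder)"
        using um geq by (rule gradient_x_measurable)
      show "(\<lambda>p. ereal (norm (gradient_x (s_harmonic_ext s u) p))) \<in> borel_measurable
          (restrict_space lborel annular_cylinder)"
        by measurable
      show "AE p in restrict_space lborel annular_cylinder. ereal
          (norm (gradient_x (s_harmonic_ext s u) p))
          \<le> ereal (C I (esssup (restrict_space lborel ?S) (\<lambda>x. ereal (norm (u x))))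
               (esssup (restrict_space lborel ?S) (\<lambda>x. ereal (norm (deriv f (u x))))))"
        using cyl geq bound unfolding Linf_norm_def[symmetric] by (subst AE_restrict_space_iff) auto
    qed
    moreover have "\<exists>D. has_gradient_x (s_harmonic_ext s u) p D" if "p \<in> annular_cylinder" for p
      using grad[of "fst p" "snd p"] that by auto
    ultimately show ?thesis by (simp add: I_eq)
  qed
  show ?thesis by (rule exI[of _ C]) (use main in blast)
qed

end
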